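(* Consider the Abelian sandpile model on the level-$n$ Sierpiński graph $\mathsf{SG}_n=(V_n,E_n)$ with sink set $C_n=\{A_2^n,A_3^n\}$ (the top and the bottom right corner vertices), and let $\sigma_n$ denote a uniformly random recurrent sandpile. Let the bulk average height be $$\sigma=\lim_{n\to\infty}\frac{1}{|V_n|}\sum_{v\in V_n\setminus C_n}\mathbb{E}[\sigma_n(v)],$$ and let $\zeta=\lim_{n\to\infty}\zeta_n$ be the limit of the bulk average looping constants $$\zeta_n=\frac{1}{|V_n|}\sum_{v\in V_n}\mathbb{E}\big[\,|\{\text{neighbours of } v \text{ in }\mathsf{SG}_n\text{ visited by } LE(X_v)\}|\,\big],$$ where $X_v$ is the simple random walk on $\mathsf{SG}_n$ started at $v$ and stopped when first visiting $C_n$, and $LE(X_v)$ is its loop erasure. Then $$\sigma=\frac{\zeta+3}{2}.$$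
   Context: **Sierpiński graphs.** For a graph $G=(V,E)$ with $V\subset\mathbb{R}^2$ and $x\in\mathbb{R}^2$, $x+G$ denotes the graph with vertex set $\{x+y: y\in V\}$ and edge set $\{\{x+a,x+b\}:\{a,b\}\in E\}$. The graph $\mathsf{SG}_0$ is the triangle with vertices $(0,0)$, $(1,0)$, $\tfrac12(1,\sqrt3)$ and all three edges between them. For $n\ge1$, $$\mathsf{SG}_n=\mathsf{SG}_{n-1}\cup\big((2^{n-1},0)+\mathsf{SG}_{n-1}\big)\cup\big((2^{n-2},2^{n-2}\sqrt3)+\mathsf{SG}_{n-1}\big),$$ where the union is of vertex sets and of edge sets. One has $|V_n|=\tfrac32(3^n+1)$ and $|E_n|=3^{n+1}$. The corner vertices of $\mathsf{SG}_n$ are $A_1^n=(0,0)$ (bottom left), $A_2^n=2^{n-1}(1,\sqrt3)$ (top) and $A_3^n=(2^n,0)$ (bottom right). **Abelian sandpile model with sink set $S$.** Let $G=(V,E)$ be a finite connected graph and $\emptyset\ne S\subsetneq V$ (the vertices of $S$ are identified to a single sink, edges being counted with multiplicity). A sandpile is a function $\sigma:V\setminus S\to\mathbb{Z}$; in the Markov chain below the values are nonnegative integers. It is stable if $\sigma(v)<\deg_G(v)$ for all $v\in V\setminus S$, and unstable at $v$ if $\sigma(v)\ge\deg_G(v)$. Toppling at $v\in V\setminus S$ removes $\deg_G(v)$ particles from $v$ and adds one particle to each neighbour of $v$, particles sent to $S$ being lost. Toppling unstable vertices successively leads after finitely many topplings to a stable sandpile, which does not depend on the order of topplings; it is called the stabilization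 $\sigma^\circ$. The sandpile Markov chain on the set of stable sandpiles with values in $\{0,1,2,\dots\}$ is $\sigma_{k+1}=(\sigma_k+\delta_{X_k})^\circ$, where $X_0,X_1,\dots$ are i.i.d. uniform on $V\setminus S$ and $\delta_x$ is the indicator function of $x$. A sandpile is recurrent if it is a recurrent state of this Markov chain. The unique stationary distribution is the uniform distribution on the finite set of recurrent sandpiles. **Loop erasure.** For a finite path $\gamma=(x_1,\dots,x_m)$ in a graph, put $i_1=1$ and, inductively for $j>1$, $i_j=\max\{i\le m: x_i=x_{i_{j-1}}\}+1$, stopping at the first $J$ with $x_{i_J}=x_m$. The loop erasure is $LE(\gamma)=(x_{i_1},\dots,x_{i_J})$. If $v\in C_n$, the walk $X_v$ is stopped immediately and $LE(X_v)=(v)$. *)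

theory Defs
  imports "HOL-Probability.Probability"
begin

subsection \<open>Graphs\<close>

record 'a graph =
  verts :: "'a set"
  edges :: "'a set set"

definition neighbors :: "'a graph \<Rightarrow> 'a \<Rightarrow> 'a set" where
  "neighbors G v = {w \<in> verts G. {v, w} \<in> edges G}"

definition deg :: "'a graph \<Rightarrow> 'a \<Rightarrow> nat" where
  "deg G v = card (neighbors G v)"

definition graph_union :: "'a graph \<Rightarrow> 'a graph \<Rightarrow> 'a graph" where
  "graph_union G H = \<lparr>verts = verts G \<union> verts H, edges = edges G \<union> edges H\<rparr>"

definition translate :: "'a::ab_group_add \<Rightarrow> 'a graph \<Rightarrow> 'a graph" where
  "translate x G = \<lparr>verts = (\<lambda>y. x + y) ` verts G,
                    edges = {{x + a, x + b} | a b. {a, b} \<in> edges G}\<rparr>"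

subsection \<open>Sierpinski graphs\<close>

text \<open>The recursion is shifted by one: the offsets of \<open>SG (Suc n)\<close> are \<open>(2\<^sup>n, 0)\<close> and
  \<open>2\<^sup>n\<^sup>-\<^sup>1 (1, \<surd>3)\<close>, the latter written with \<open>2\<^sup>n / 2\<close> since \<open>n\<close> may be \<open>0\<close>.\<close>

primrec SG :: "nat \<Rightarrow> (real \<times> real) graph" where
  "SG 0 =
     (let a = (0, 0); b = (1, 0); c = (1 / 2, sqrt 3 / 2)
      in \<lparr>verts = {a, b, c}, edges = {{a, b}, {b, c}, {a, c}}\<rparr>)"
| "SG (Suc n) =
     graph_union (SG n)
       (graph_union (translate (2 ^ n, 0) (SG n))
                    (translate (2 ^ n / 2, 2 ^ n / 2 * sqrt 3) (SG n)))"

definition top_corner :: "nat \<Rightarrow> real \<times> real" where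
  "top_corner n = (2 ^ n / 2, 2 ^ n / 2 * sqrt 3)"

definition right_corner :: "nat \<Rightarrow> real \<times> real" where
  "right_corner n = (2 ^ n, 0)"

definition sinks :: "nat \<Rightarrow> (real \<times> real) set" where
  "sinks n = {top_corner n, right_corner n}"

subsection \<open>The Abelian sandpile model\<close>

text \<open>Throughout, \<open>S\<close> is the sink set. A sandpile, a function on \<open>V \<setminus> S\<close>, is represented by the
  function on the whole vertex type that extends it by \<open>0\<close>.\<close>

definition sandpiles :: "'a graph \<Rightarrow> 'a set \<Rightarrow> ('a \<Rightarrow> int) set" where
  "sandpiles G S = {\<sigma>. \<forall>v. v \<notin> verts G - S \<longrightarrow> \<sigma> v = 0}"

definition stable :: "'a graph \<Rightarrow> 'a set \<Rightarrow> ('a \<Rightarrow> int) \<Rightarrow> bool" where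
  "stable G S \<sigma> \<longleftrightarrow> (\<forall>v \<in> verts G - S. \<sigma> v < int (deg G v))"

definition topple :: "'a graph \<Rightarrow> 'a set \<Rightarrow> 'a \<Rightarrow> ('a \<Rightarrow> int) \<Rightarrow> ('a \<Rightarrow> int)" where
  "topple G S v \<sigma> =
     (\<lambda>u. if u = v then \<sigma> u - int (deg G v)
          else if u \<in> neighbors G v - S then \<sigma> u + 1
          else \<sigma> u)"

definition topples_to :: "'a graph \<Rightarrow> 'a set \<Rightarrow> ('a \<Rightarrow> int) \<Rightarrow> ('a \<Rightarrow> int) \<Rightarrow> bool" where
  "topples_to G S \<sigma> \<tau> \<longleftrightarrow>
     (\<exists>v \<in> verts G - S. \<sigma> v \<ge> int (deg G v) \<and> \<tau> = topple G S v \<sigma>)"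

definition stabilization :: "'a graph \<Rightarrow> 'a set \<Rightarrow> ('a \<Rightarrow> int) \<Rightarrow> ('a \<Rightarrow> int)" where
  "stabilization G S \<sigma> = (THE \<tau>. (topples_to G S)\<^sup>*\<^sup>* \<sigma> \<tau> \<and> stable G S \<tau>)"

definition sandpile_states :: "'a graph \<Rightarrow> 'a set \<Rightarrow> ('a \<Rightarrow> int) set" where
  "sandpile_states G S = {\<sigma> \<in> sandpiles G S. stable G S \<sigma> \<and> (\<forall>v. 0 \<le> \<sigma> v)}"

text \<open>\<open>sandpile_chain G S \<sigma> X k\<close> is the state after \<open>k\<close> steps of the sandpile Markov chain
  started in \<open>\<sigma>\<close> when the particles are added at \<open>X 0, X 1, \<dots>\<close>.\<close>

primrec sandpile_chain ::
  "'a graph \<Rightarrow> 'a set \<Rightarrow> ('a \<Rightarrow> int) \<Rightarrow> (nat \<Rightarrow> 'a) \<Rightarrow> nat \<Rightarrow> ('a \<Rightarrow> int)" where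
  "sandpile_chain G S \<sigma> X 0 = \<sigma>"
| "sandpile_chain G S \<sigma> X (Suc k) =
     stabilization G S (\<lambda>v. sandpile_chain G S \<sigma> X k v + of_bool (v = X k))"

definition additions :: "'a graph \<Rightarrow> 'a set \<Rightarrow> (nat \<Rightarrow> 'a) measure" where
  "additions G S = PiM UNIV (\<lambda>_. uniform_count_measure (verts G - S))"

definition recurrent_sandpiles :: "'a graph \<Rightarrow> 'a set \<Rightarrow> ('a \<Rightarrow> int) set" where
  "recurrent_sandpiles G S =
     {\<sigma> \<in> sandpile_states G S.
        AE X in additions G S. \<exists>k \<ge> 1. sandpile_chain G S \<sigma> X k = \<sigma>}"

definition expected_height :: "'a graph \<Rightarrow> 'a set \<Rightarrow> 'a \<Rightarrow> real" where
  "expected_height G S v =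
     measure_pmf.expectation (pmf_of_set (recurrent_sandpiles G S)) (\<lambda>\<sigma>. real_of_int (\<sigma> v))"

subsection \<open>Simple random walk and loop erasure\<close>

text \<open>The law of the simple random walk started at \<open>v\<close>, on the space of infinite sequences of
  vertices, is given by the Ionescu-Tulcea construction: the kernel \<open>srw_kernel G v i\<close> is the
  conditional law of the \<open>i\<close>-th position given the positions before it.\<close>

definition srw_kernel :: "'a graph \<Rightarrow> 'a \<Rightarrow> nat \<Rightarrow> (nat \<Rightarrow> 'a) \<Rightarrow> 'a measure" where
  "srw_kernel G v i X =
     (if i = 0 then return (count_space (verts G)) v
      else point_measure (verts G)
             (\<lambda>w. if w \<in> neighbors G (X (i - 1)) then 1 / real (deg G (X (i - 1))) else 0))"

lemma Ionescu_Tulcea_srw: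
  assumes "finite (verts G)" "v \<in> verts G" "\<And>u. u \<in> verts G \<Longrightarrow> neighbors G u \<noteq> {}"
  shows "Ionescu_Tulcea (srw_kernel G v) (\<lambda>_. count_space (verts G))"
proof -
  let ?V = "verts G"
  let ?K = "\<lambda>u. point_measure ?V (\<lambda>w. if w \<in> neighbors G u then 1 / real (deg G u) else 0)"
  have prob: "prob_space (?K u)" if u: "u \<in> ?V" for u
  proof
    have fin: "finite (neighbors G u)" and sub: "neighbors G u \<subseteq> ?V"
      using assms(1) by (auto simp: neighbors_def)
    have "deg G u > 0"
      using fin assms(3)[OF u] by (simp add: deg_def card_gt_0_iff)
    then have "(\<Sum>w\<in>?V. if w \<in> neighbors G u then 1 / real (deg G u) else 0) = 1"
      using assms(1) fin sub
      by (simp add: sum.If_cases Int_absorb1 deg_def[symmetric])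
    then have "(\<Sum>w\<in>?V. ennreal (if w \<in> neighbors G u then 1 / real (deg G u) else 0)) = 1"
      by (subst sum_ennreal) auto
    then show "emeasure (?K u) (space (?K u)) = 1"
      using assms(1) by (simp add: space_point_measure emeasure_point_measure_finite)
  qed
  have K: "?K \<in> count_space ?V \<rightarrow>\<^sub>M subprob_algebra (count_space ?V)"
    using prob by (auto simp: space_subprob_algebra sets_point_measure
        intro!: prob_space_imp_subprob_space)
  have 1: "srw_kernel G v i \<in> PiM {0..<i} (\<lambda>_. count_space ?V) \<rightarrow>\<^sub>M subprob_algebra (count_space ?V)" for i
  proof (cases "i = 0")
    case True
    then show ?thesis
      using assms(2) by (simp add: srw_kernel_def[abs_def])
  next
    case False
    then have "(\<lambda>X. X (i - 1)) \<in> PiM {0..<i} (\<lambda>_. count_space ?V) \<rightarrow>\<^sub>M count_space ?V"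
      by (intro measurable_component_singleton) auto
    from measurable_compose[OF this K] False show ?thesis
      by (simp add: srw_kernel_def[abs_def])
  qed
  have 2: "prob_space (srw_kernel G v i x)" if "x \<in> space (PiM {0..<i} (\<lambda>_. count_space ?V))" for i x
    using that prob[of "x (i - 1)"] assms(2)
    by (auto simp: srw_kernel_def space_PiM PiE_iff intro!: prob_space_return)
  show ?thesis using 1 2 by (rule Ionescu_Tulcea.intro)
qed

definition srw :: "'a graph \<Rightarrow> 'a \<Rightarrow> (nat \<Rightarrow> 'a) measure" where
  "srw G v =
     projective_family.lim UNIV
       (Ionescu_Tulcea.CI (srw_kernel G v) (\<lambda>_. count_space (verts G)))
       (\<lambda>_. count_space (verts G))"

text \<open>For walks that never visit \<open>C\<close>, which have probability \<open>0\<close>, the value is irrelevant.\<close>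

definition stopped_path :: "'a set \<Rightarrow> (nat \<Rightarrow> 'a) \<Rightarrow> 'a list" where
  "stopped_path C X = map X [0..<Suc (LEAST k. X k \<in> C)]"

text \<open>Positions in a path are counted from \<open>0\<close>, so \<open>loop_erasure_index \<gamma> j\<close> is \<open>i\<^bsub>j+1\<^esub> - 1\<close>. Only
  the indices up to the stopping index are meaningful.\<close>

primrec loop_erasure_index :: "'a list \<Rightarrow> nat \<Rightarrow> nat" where
  "loop_erasure_index \<gamma> 0 = 0"
| "loop_erasure_index \<gamma> (Suc j) =
     Max {i. i < length \<gamma> \<and> \<gamma> ! i = \<gamma> ! loop_erasure_index \<gamma> j} + 1"

definition loop_erasure :: "'a list \<Rightarrow> 'a list" where
  "loop_erasure \<gamma> =
     map (\<lambda>j. \<gamma> ! loop_erasure_index \<gamma> j)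
       [0..<Suc (LEAST J. \<gamma> ! loop_erasure_index \<gamma> J = last \<gamma>)]"

definition expected_visited_neighbors :: "'a graph \<Rightarrow> 'a set \<Rightarrow> 'a \<Rightarrow> real" where
  "expected_visited_neighbors G C v =
     (\<integral>X. real (card (neighbors G v \<inter> set (loop_erasure (stopped_path C X)))) \<partial>srw G v)"

subsection \<open>The two bulk averages\<close>

definition bulk_height :: "nat \<Rightarrow> real" where
  "bulk_height n =
     (\<Sum>v \<in> verts (SG n) - sinks n. expected_height (SG n) (sinks n) v) / real (card (verts (SG n)))"

definition bulk_looping :: "nat \<Rightarrow> real" where
  "bulk_looping n =
     (\<Sum>v \<in> verts (SG n). expected_visited_neighbors (SG n) (sinks n) v) / real (card (verts (SG n)))"

end

theory Submission
  imports Defs "HOL-Library.Confluence" "HOL-Computational_Algebra.Polynomial"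
begin

text \<open>Both bulk averages are governed by one number. Identify the sinks to a single vertex and write
\<open>T\<close> for the number of spanning trees and \<open>U\<close> for the number of connected spanning
subgraphs with one edge more than a tree. The total height of a uniformly random recurrent
sandpile has mean \<open>c - l + U / T\<close>, where \<open>c\<close> edges avoid the sinks and \<open>l\<close> edges join two
sinks (\<open>sum_expected_heights\<close>). The total number of neighbours visited by the loop-erased walks
is \<open>|V| + 2 * U / T\<close> up to a bounded error (\<open>sum_visited_SG\<close>). Since \<open>|E| / |V|\<close> tends to
\<open>2\<close>, dividing by \<open>|V|\<close> gives \<open>\<sigma> = 2 + u\<close> and \<open>\<zeta> = 1 + 2 * u\<close> with
\<open>u = lim U / (T * |V|)\<close>, which is the claimed relation once \<open>u\<close> is known to exist.

Both come from exact formulas for finite graphs, proved by deletion and contraction of an edge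
\<open>e\<close> between a sink and a vertex \<open>u\<close>: either \<open>e\<close> is deleted, or \<open>e\<close> is deleted and \<open>u\<close>
becomes a sink, and \<open>T\<close> and \<open>U\<close> are the sums of their values in the two cases. On the sandpile
side, the recurrent sandpiles are those without forbidden subconfigurations
(\<open>recurrent_eq_allowed\<close>), and the two cases separate those with less than the maximal height at
\<open>u\<close> from those with the maximal height (\<open>allowed_split\<close>). This is Merino's argument,
restricted to the first moment of the height.

On the side of the walk, the loop erasure started at \<open>v\<close> equals a given simple path \<open>\<gamma>\<close> with
probability \<open>T(S \<union> \<gamma>) / T(S)\<close>, where \<open>T(S \<union> \<gamma>)\<close> counts the trees for the sink set
\<open>S \<union> \<gamma>\<close> (\<open>erasure_mass_eq\<close>). Cutting the walk at its last visit to \<open>v\<close> shows that the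
probabilities of the paths from \<open>v\<close> are, up to a common factor, those of their tails for the sink
set \<open>S \<union> {v}\<close>; the factor is determined by the total mass \<open>1\<close>, because the numbers
\<open>T(S \<union> \<gamma>)\<close> of all simple paths \<open>\<gamma>\<close> from \<open>v\<close> add up to \<open>T(S)\<close>.

For the existence of \<open>u\<close>, the graph of level \<open>n + 1\<close> consists of three copies of the graph of
level \<open>n\<close> glued in a ring at corners. Sorting the edge sets by the way they connect the three
corners gives polynomial recursions for their generating functions (\<open>span_poly_SG\<close>). Their
coefficients count forests and forests with one surplus edge. The quotients of the latter by the
former, divided by \<open>3^n\<close>, satisfy a linear recursion whose matrix contracts differences, up to
an exponentially small perturbation, and so they converge (\<open>convergent_xB\<close>).\<close>


section \<open>Spanning trees and unicyclic subgraphs relative to a sink\<close>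

definition graph_on :: "'a set \<Rightarrow> 'a set set \<Rightarrow> bool" where
  "graph_on V E \<longleftrightarrow> finite V \<and> (\<forall>e\<in>E. \<exists>u\<in>V. \<exists>v\<in>V. u \<noteq> v \<and> e = {u, v})"

definition nbs :: "'a set set \<Rightarrow> 'a \<Rightarrow> 'a set" where
  "nbs E v = {w. {v, w} \<in> E}"

abbreviation joined :: "'a set set \<Rightarrow> 'a \<Rightarrow> 'a \<Rightarrow> bool" where
  "joined H \<equiv> (\<lambda>x y. {x, y} \<in> H)\<^sup>*\<^sup>*"

text \<open>After \<open>S\<close> has been identified to one vertex, these are the edge sets that connect the whole
graph. In this formulation the contraction of an edge at the sink enlarges \<open>S\<close> and keeps \<open>V\<close>.\<close>

definition linked :: "'a set \<Rightarrow> 'a set \<Rightarrow> 'a set set \<Rightarrow> bool" where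
  "linked V S H \<longleftrightarrow> (\<forall>v\<in>V. \<exists>s\<in>S. joined H v s)"

definition spanners :: "'a set \<Rightarrow> 'a set set \<Rightarrow> 'a set \<Rightarrow> nat \<Rightarrow> 'a set set set" where
  "spanners V E S m = {H. H \<subseteq> E \<and> linked V S H \<and> card H = m}"

definition num_trees :: "'a set \<Rightarrow> 'a set set \<Rightarrow> 'a set \<Rightarrow> nat" where
  "num_trees V E S = card (spanners V E S (card (V - S)))"

text \<open>Edges inside \<open>S\<close> are kept. They act as loops at the identified sink, so that they never occur
in a tree, but each of them turns every tree into a unicyclic subgraph.\<close>

definition num_unicyclic :: "'a set \<Rightarrow> 'a set set \<Rightarrow> 'a set \<Rightarrow> nat" where
  "num_unicyclic V E S = card (spanners V E S (Suc (card (V - S))))"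

lemma graph_onD:
  assumes "graph_on V E" "{u, v} \<in> E"
  shows "u \<in> V" "v \<in> V" "u \<noteq> v"
proof -
  obtain a b where "a \<in> V" "b \<in> V" "a \<noteq> b" "{u, v} = {a, b}"
    using assms unfolding graph_on_def by meson
  then show "u \<in> V" "v \<in> V" "u \<noteq> v"
    by (auto simp: doubleton_eq_iff)
qed

lemma graph_on_finite_verts: "graph_on V E \<Longrightarrow> finite V"
  by (simp add: graph_on_def)

lemma graph_on_finite_edges: "graph_on V E \<Longrightarrow> finite E"
  by (rule finite_subset[of _ "Pow V"]) (auto simp: graph_on_def)

lemma graph_on_subset: "graph_on V E \<Longrightarrow> E' \<subseteq> E \<Longrightarrow> graph_on V E'"
  by (auto simp: graph_on_def)

lemma nbs_subset: "graph_on V E \<Longrightarrow> nbs E v \<subseteq> V - {v}"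
  using graph_onD[of V E v] by (auto simp: nbs_def)

lemma finite_nbs: "graph_on V E \<Longrightarrow> finite (nbs E v)"
  by (rule finite_subset[OF nbs_subset]) (auto dest: graph_on_finite_verts)

lemma nbs_sym: "w \<in> nbs E v \<longleftrightarrow> v \<in> nbs E w"
  by (simp add: nbs_def insert_commute)

lemma joined_sym: "joined H x y \<Longrightarrow> joined H y x"
proof (induction rule: rtranclp_induct)
  case (step y z)
  then show ?case
    by (metis (no_types, lifting) converse_rtranclp_into_rtranclp insert_commute)
qed auto

lemma joined_mono: "H \<subseteq> H' \<Longrightarrow> joined H x y \<Longrightarrow> joined H' x y"
  by (rule predicate2D[OF rtranclp_mono]) auto

lemma linked_mono: "linked V S H \<Longrightarrow> S \<subseteq> S' \<Longrightarrow> linked V S' H"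
  unfolding linked_def by blast

text \<open>A path that uses the edge \<open>{u, s}\<close> meets \<open>{u, s}\<close>, and up to that point it does not use the
edge; hence the presence of the edge amounts to declaring \<open>u\<close> a sink.\<close>

lemma linked_insert_edge:
  assumes "s \<in> S"
  shows "linked V S (insert {u, s} H) \<longleftrightarrow> linked V (insert u S) H"
proof
  assume L: "linked V S (insert {u, s} H)"
  have "\<exists>s'\<in>insert u S. joined H v s'" if "joined (insert {u, s} H) v x" "x \<in> S" for v x
    using that
  proof (induction rule: converse_rtranclp_induct)
    case base
    then show ?case by auto
  next
    case (step y z)
    then show ?case
      using assms by (metis (no_types, lifting) converse_rtranclp_into_rtranclp doubleton_eq_iff
          insertE insert_iff rtranclp.rtrancl_refl)
  qed
  with L show "linked V (insert u S) H"
    unfolding linked_def by blast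
next
  assume L: "linked V (insert u S) H"
  have us: "joined (insert {u, s} H) u s" by auto
  show "linked V S (insert {u, s} H)"
    unfolding linked_def
  proof
    fix v assume "v \<in> V"
    then obtain s' where s': "s' \<in> insert u S" "joined H v s'"
      using L by (auto simp: linked_def)
    then have vs: "joined (insert {u, s} H) v s'"
      using joined_mono[of H "insert {u, s} H"] by blast
    show "\<exists>t\<in>S. joined (insert {u, s} H) v t"
    proof (cases "s' = u")
      case True
      have "joined (insert {u, s} H) v s"
        using rtranclp_trans[OF vs] us True by metis
      then show ?thesis using assms by (intro bexI[where x=s])
    next
      case False
      then have "s' \<in> S" using s' by blast
      with vs show ?thesis by (intro bexI[where x=s'])
    qed
  qed
qed

lemma finite_spanners: "finite E \<Longrightarrow> finite (spanners V E S m)"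
  by (rule finite_subset[of _ "Pow E"]) (auto simp: spanners_def)

lemma card_spanners_split:
  assumes "finite E" "{u, s} \<in> E" "s \<in> S"
  shows "card (spanners V E S (Suc m)) =
           card (spanners V (E - {{u, s}}) S (Suc m)) +
           card (spanners V (E - {{u, s}}) (insert u S) m)"
proof -
  let ?e = "{u, s}"
  let ?A = "spanners V (E - {?e}) S (Suc m)"
  let ?B = "spanners V (E - {?e}) (insert u S) m"
  have "spanners V E S (Suc m) = ?A \<union> insert ?e ` ?B"
  proof (intro equalityI subsetI)
    fix H assume H: "H \<in> spanners V E S (Suc m)"
    show "H \<in> ?A \<union> insert ?e ` ?B"
    proof (cases "?e \<in> H")
      case True
      have "finite H"
        using H assms(1) finite_subset by (auto simp: spanners_def)
      then have "H - {?e} \<in> ?B"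
        using H True linked_insert_edge[OF assms(3), of V u "H - {?e}"]
        by (auto simp: spanners_def insert_absorb)
      then show ?thesis
        using True by (metis UnCI image_eqI insert_Diff)
    next
      case False
      with H show ?thesis by (auto simp: spanners_def)
    qed
  next
    fix H assume "H \<in> ?A \<union> insert ?e ` ?B"
    then show "H \<in> spanners V E S (Suc m)"
    proof
      assume "H \<in> insert ?e ` ?B"
      then obtain H' where H': "H' \<in> ?B" "H = insert ?e H'" by blast
      have "finite H'"
        using H' assms(1) finite_subset by (auto simp: spanners_def)
      then show ?thesis
        using H' assms linked_insert_edge[OF assms(3), of V u H']
        by (auto simp: spanners_def card_insert_if)
    qed (auto simp: spanners_def)
  qed
  moreover have "?A \<inter> insert ?e ` ?B = {}"
    by (auto simp: spanners_def)
  moreover have "inj_on (insert ?e) ?B"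
    by (rule inj_onI) (metis (no_types, lifting) Diff_insert_absorb insert_Diff_if insert_iff
        mem_Collect_eq spanners_def subset_Diff_insert)
  ultimately show ?thesis
    using assms(1) by (simp add: card_Un_disjoint finite_spanners card_image)
qed

lemma num_trees_split:
  assumes "graph_on V E" "u \<in> V - S" "s \<in> S" "{u, s} \<in> E"
  shows "num_trees V E S = num_trees V (E - {{u, s}}) S + num_trees V (E - {{u, s}}) (insert u S)"
proof -
  have "card (V - S) = Suc (card (V - insert u S))"
    using assms graph_on_finite_verts[OF assms(1)]
    by (metis Diff_insert card_Suc_Diff1 finite_Diff)
  then show ?thesis
    using card_spanners_split[of E u s S V] assms graph_on_finite_edges
    unfolding num_trees_def by metis
qed

lemma num_unicyclic_split:
  assumes "graph_on V E" "u \<in> V - S" "s \<in> S" "{u, s} \<in> E"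
  shows "num_unicyclic V E S =
    num_unicyclic V (E - {{u, s}}) S + num_unicyclic V (E - {{u, s}}) (insert u S)"
proof -
  have "card (V - S) = Suc (card (V - insert u S))"
    using assms graph_on_finite_verts[OF assms(1)]
    by (metis Diff_insert card_Suc_Diff1 finite_Diff)
  then show ?thesis
    using card_spanners_split[of E u s S V] assms graph_on_finite_edges
    unfolding num_unicyclic_def by metis
qed

text \<open>The induction behind the counting identities for trees, paths and sandpiles. Deleting an edge between the sink and its
complement, with or without moving its endpoint into the sink, makes the edge set smaller; the
process ends when no such edge is left.\<close>

lemma crossing_induct [consumes 2, case_names full isolated crossing]:
  assumes "graph_on V E" "S \<subseteq> V"
    and full: "\<And>E. graph_on V E \<Longrightarrow> P E V"
    and isolated: "\<And>E S. graph_on V E \<Longrightarrow> S \<subset> V \<Longrightarrow> (\<And>v s. v \<in> V - S \<Longrightarrow> s \<in> S \<Longrightarrow> {v, s} \<notin> E) \<Longrightarrow> P E S"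
    and crossing: "\<And>E S u s. graph_on V E \<Longrightarrow> S \<subseteq> V \<Longrightarrow> u \<in> V - S \<Longrightarrow> s \<in> S \<Longrightarrow> {u, s} \<in> E \<Longrightarrow>
      P (E - {{u, s}}) S \<Longrightarrow> P (E - {{u, s}}) (insert u S) \<Longrightarrow> P E S"
  shows "P E S"
  using assms(1,2)
proof (induction "card E" arbitrary: E S rule: less_induct)
  case less
  consider "S = V" | "S \<subset> V" "\<And>v s. v \<in> V - S \<Longrightarrow> s \<in> S \<Longrightarrow> {v, s} \<notin> E"
    | u s where "u \<in> V - S" "s \<in> S" "{u, s} \<in> E"
    using less.prems by blast
  then show ?case
  proof cases
    case 1
    then show ?thesis using full less.prems by simp
  next
    case 2
    then show ?thesis using isolated less.prems by simp
  next
    case (3 u s)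
    have "card (E - {{u, s}}) < card E"
      by (rule card_Diff1_less[OF graph_on_finite_edges[OF less.prems(1)] 3(3)])
    moreover have "graph_on V (E - {{u, s}})" "insert u S \<subseteq> V"
      using less.prems 3 by (auto intro: graph_on_subset)
    ultimately show ?thesis
      using crossing[OF less.prems 3] less.hyps less.prems(2) by blast
  qed
qed

lemma num_trees_full [simp]:
  assumes "graph_on V E"
  shows "num_trees V E V = 1"
proof -
  have "spanners V E V 0 = {{}}"
    using graph_on_finite_edges[OF assms] finite_subset by (fastforce simp: spanners_def linked_def)
  then show ?thesis by (simp add: num_trees_def)
qed

lemma num_unicyclic_full [simp]:
  assumes "graph_on V E"
  shows "num_unicyclic V E V = card E"
proof -
  have "spanners V E V (Suc 0) = (\<lambda>e. {e}) ` E"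
    by (auto simp: spanners_def linked_def card_1_singleton_iff)
  then show ?thesis by (simp add: num_unicyclic_def card_image)
qed

lemma spanners_isolated:
  assumes "graph_on V E" "S \<subset> V" "\<And>v s. v \<in> V - S \<Longrightarrow> s \<in> S \<Longrightarrow> {v, s} \<notin> E"
  shows "spanners V E S m = {}"
proof -
  obtain v where v: "v \<in> V - S" using assms(2) by blast
  have "x \<in> V - S" if "joined H v x" "H \<subseteq> E" for H x
    using that
  proof (induction rule: rtranclp_induct)
    case (step y z)
    then show ?case using assms(3)[of y z] graph_onD[OF assms(1), of y z] by blast
  qed (use v in auto)
  then show ?thesis
    using v by (fastforce simp: spanners_def linked_def)
qed

lemma num_trees_isolated:
  assumes "graph_on V E" "S \<subset> V" "\<And>v s. v \<in> V - S \<Longrightarrow> s \<in> S \<Longrightarrow> {v, s} \<notin> E"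
  shows "num_trees V E S = 0" "num_unicyclic V E S = 0"
  using spanners_isolated[OF assms] by (auto simp: num_trees_def num_unicyclic_def)

lemma card_edges_inside:
  assumes "graph_on V E" "u \<notin> S"
  shows "card {e \<in> E. e \<subseteq> insert u S} = card {e \<in> E. e \<subseteq> S} + card (nbs E u \<inter> S)"
proof -
  have inj: "inj_on (\<lambda>x. {u, x}) (nbs E u \<inter> S)" by (auto intro!: inj_onI simp: doubleton_eq_iff)
  have "{e \<in> E. e \<subseteq> insert u S} = {e \<in> E. e \<subseteq> S} \<union> (\<lambda>x. {u, x}) ` (nbs E u \<inter> S)"
    (is "?A = ?B \<union> ?C")
  proof (intro equalityI subsetI)
    fix e assume e: "e \<in> ?A"
    then have "e \<in> E" by blast
    then obtain a b where ab: "e = {a, b}" "a \<noteq> b" using assms(1) unfolding graph_on_def by meson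
    show "e \<in> ?B \<union> ?C"
    proof (cases "u \<in> e")
      case True
      then obtain c where c: "e = {u, c}" "c \<noteq> u" using ab by auto
      then have "c \<in> nbs E u \<inter> S" using e by (auto simp: nbs_def)
      with c show ?thesis by blast
    qed (use e in auto)
  qed (use assms(2) in \<open>auto simp: nbs_def\<close>)
  moreover have "?B \<inter> ?C = {}" using assms(2) by auto
  ultimately have "card ?A = card ?B + card ?C"
    using finite_nbs[OF assms(1), of u] graph_on_finite_edges[OF assms(1)] by (simp add: card_Un_disjoint)
  then show ?thesis using card_image[OF inj] by simp
qed

text \<open>A tree contains no loop. By deletion and contraction the claim reduces to the trivial cases,
because an edge inside \<open>S\<close> differs from each crossing edge and stays inside the sink.\<close>

lemma num_trees_edge_in_sink:
  assumes "graph_on V E" "S \<subseteq> V" "u \<in> S" "s \<in> S"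
  shows "num_trees V (E - {{u, s}}) S = num_trees V E S"
proof -
  have "\<forall>e. e \<subseteq> S \<longrightarrow> num_trees V (E - {e}) S = num_trees V E S"
    using assms(1,2)
  proof (induction rule: crossing_induct)
    case (full E)
    then show ?case by (auto simp: graph_on_subset)
  next
    case (isolated E S)
    have g: "graph_on V (E - {e})" for e using isolated(1) by (auto intro: graph_on_subset)
    show ?case
      using spanners_isolated[OF isolated(1,2)] spanners_isolated[OF g isolated(2)] isolated(3)
      by (simp add: num_trees_def)
  next
    case (crossing E S u s)
    show ?case
    proof (intro allI impI)
      fix e assume e: "e \<subseteq> S"
      have g: "graph_on V (E - {e})" using crossing(1) by (auto intro: graph_on_subset)
      have ne: "{u, s} \<in> E - {e}" using crossing e by auto
      have eq: "E - {{u, s}} - {e} = E - {e} - {{u, s}}" by blast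
      have "num_trees V (E - {e} - {{u, s}}) S = num_trees V (E - {{u, s}}) S"
        "num_trees V (E - {e} - {{u, s}}) (insert u S) = num_trees V (E - {{u, s}}) (insert u S)"
        using crossing(6)[rule_format, OF e] crossing(7)[rule_format, OF subset_insertI2[OF e]]
        unfolding eq by blast+
      then show "num_trees V (E - {e}) S = num_trees V E S"
        unfolding num_trees_split[OF g crossing(3,4) ne] num_trees_split[OF crossing(1,3-5)] by (rule arg_cong2)
    qed
  qed
  from this[rule_format, of "{u, s}"] show ?thesis using assms(3,4) by simp
qed

section \<open>Simple paths to the sink\<close>

definition simple_paths :: "'a set set \<Rightarrow> 'a set \<Rightarrow> 'a \<Rightarrow> 'a list set" where
  "simple_paths E S v = {\<gamma>. \<gamma> \<noteq> [] \<and> hd \<gamma> = v \<and> distinct \<gamma> \<and> successively (\<lambda>x y. {x, y} \<in> E) \<gamma> \<and>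
     last \<gamma> \<in> S \<and> set (butlast \<gamma>) \<inter> S = {}}"

lemma successively_in_verts:
  assumes "graph_on V E" "successively (\<lambda>x y. {x, y} \<in> E) \<gamma>" "\<gamma> \<noteq> [] \<longrightarrow> hd \<gamma> \<in> V"
  shows "set \<gamma> \<subseteq> V"
  using assms(2,3)
proof (induction \<gamma>)
  case (Cons x \<gamma>)
  then show ?case using graph_onD[OF assms(1)] by (auto simp: successively_Cons)
qed simp

lemma simple_paths_in_verts:
  assumes "graph_on V E" "v \<in> V" "\<gamma> \<in> simple_paths E S v"
  shows "set \<gamma> \<subseteq> V"
  using successively_in_verts[OF assms(1), of \<gamma>] assms by (auto simp: simple_paths_def)

lemma finite_simple_paths:
  assumes "graph_on V E" "v \<in> V"
  shows "finite (simple_paths E S v)"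
proof (rule finite_subset)
  show "simple_paths E S v \<subseteq> {\<gamma>. set \<gamma> \<subseteq> V \<and> distinct \<gamma>}"
    using simple_paths_in_verts[OF assms] by (auto simp: simple_paths_def)
qed (simp add: finite_subset_distinct graph_on_finite_verts[OF assms(1)])

lemma simple_paths_sink: "v \<in> S \<Longrightarrow> simple_paths E S v = {[v]}"
proof (intro equalityI subsetI)
  fix \<gamma> assume *: "v \<in> S" "\<gamma> \<in> simple_paths E S v"
  then show "\<gamma> \<in> {[v]}"
    by (cases \<gamma>) (auto simp: simple_paths_def split: if_splits)
qed (auto simp: simple_paths_def)

lemma simple_paths_nonsink:
  assumes "v \<notin> S"
  shows "simple_paths E S v = {\<gamma> @ [t] | \<gamma> t. \<gamma> \<noteq> [] \<and> hd \<gamma> = v \<and> distinct \<gamma> \<and>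
    successively (\<lambda>x y. {x, y} \<in> E) \<gamma> \<and> set \<gamma> \<inter> S = {} \<and> t \<in> S \<and> {last \<gamma>, t} \<in> E}" (is "_ = ?R")
proof (intro equalityI subsetI)
  fix \<gamma> assume *: "\<gamma> \<in> simple_paths E S v"
  then have "\<gamma> \<noteq> []" by (simp add: simple_paths_def)
  then obtain \<gamma>' t where \<gamma>: "\<gamma> = \<gamma>' @ [t]" by (metis rev_exhaust)
  with * assms show "\<gamma> \<in> ?R"
    by (cases "\<gamma>' = []") (auto simp: simple_paths_def successively_append_iff)
qed (auto simp: simple_paths_def successively_append_iff)

lemma successively_avoiding:
  assumes "s \<notin> set \<gamma>"
  shows "successively (\<lambda>x y. {x, y} \<in> E - {{u, s}}) \<gamma> \<longleftrightarrow> successively (\<lambda>x y. {x, y} \<in> E) \<gamma>"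
  using assms
proof (induction \<gamma>)
  case (Cons x \<gamma>)
  then show ?case
    by (cases \<gamma>) (auto simp: successively_Cons doubleton_eq_iff)
qed simp

lemma set_append_last: "xs \<noteq> [] \<Longrightarrow> set xs = insert (last xs) (set (butlast xs))"
  by (metis Un_insert_right append_butlast_last_id list.set(1) list.set(2) set_append sup_bot_right)

text \<open>An edge from \<open>u\<close> to a sink \<open>s\<close> can only be the last step of a path; without that step the path
ends at \<open>u\<close>.\<close>

lemma simple_paths_split:
  assumes "v \<notin> S" "u \<notin> S" "s \<in> S" "{u, s} \<in> E"
  shows "simple_paths E S v = simple_paths (E - {{u, s}}) S v \<union>
    (\<lambda>\<gamma>. \<gamma> @ [s]) ` {\<gamma> \<in> simple_paths (E - {{u, s}}) (insert u S) v. last \<gamma> = u}" (is "?L = ?A \<union> ?B")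
proof (intro equalityI subsetI)
  fix \<gamma> assume "\<gamma> \<in> ?L"
  then obtain \<gamma>' t where g: "\<gamma> = \<gamma>' @ [t]" "\<gamma>' \<noteq> []" "hd \<gamma>' = v" "distinct \<gamma>'"
      "successively (\<lambda>x y. {x, y} \<in> E) \<gamma>'" "set \<gamma>' \<inter> S = {}" "t \<in> S" "{last \<gamma>', t} \<in> E"
    unfolding simple_paths_nonsink[OF assms(1)] by blast
  have suc: "successively (\<lambda>x y. {x, y} \<in> E - {{u, s}}) \<gamma>'"
    using g assms successively_avoiding[of s \<gamma>' E u] by blast
  show "\<gamma> \<in> ?A \<union> ?B"
  proof (cases "{last \<gamma>', t} = {u, s}")
    case True
    have "last \<gamma>' \<notin> S" using g last_in_set[of \<gamma>'] by blast
    then have ut: "last \<gamma>' = u" "t = s" using True assms by (auto simp: doubleton_eq_iff)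
    have "u \<notin> set (butlast \<gamma>')"
      using g ut by (metis append_butlast_last_id distinct_butlast not_distinct_conv_prefix)
    moreover have "set (butlast \<gamma>') \<inter> S = {}" using g in_set_butlastD by fastforce
    ultimately have "\<gamma>' \<in> simple_paths (E - {{u, s}}) (insert u S) v"
      using g ut suc by (auto simp: simple_paths_def)
    then show ?thesis using ut g by blast
  next
    case False
    then have "\<gamma> \<in> ?A"
      unfolding simple_paths_nonsink[OF assms(1)] using g suc by blast
    then show ?thesis ..
  qed
next
  fix \<gamma> assume "\<gamma> \<in> ?A \<union> ?B"
  then show "\<gamma> \<in> ?L"
  proof
    assume "\<gamma> \<in> ?A"
    then show ?thesis
      by (auto simp: simple_paths_def elim: successively_mono)
  next
    assume "\<gamma> \<in> ?B"
    then obtain \<gamma>' where g: "\<gamma> = \<gamma>' @ [s]" "\<gamma>' \<in> simple_paths (E - {{u, s}}) (insert u S) v" "last \<gamma>' = u"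
      by blast
    have "set \<gamma>' = insert u (set (butlast \<gamma>'))"
      using g(2,3) set_append_last[of \<gamma>'] by (simp add: simple_paths_def)
    then have "set \<gamma>' \<inter> S = {}" using g assms by (auto simp: simple_paths_def)
    moreover have "successively (\<lambda>x y. {x, y} \<in> E) \<gamma>'"
      using g by (auto simp: simple_paths_def elim: successively_mono)
    ultimately show ?thesis
      unfolding simple_paths_nonsink[OF assms(1)] using g assms by (auto simp: simple_paths_def)
  qed
qed

lemma simple_paths_avoiding:
  assumes "u \<notin> S"
  shows "{\<gamma> \<in> simple_paths E S v. u \<notin> set \<gamma>} = {\<gamma> \<in> simple_paths E (insert u S) v. last \<gamma> \<noteq> u}"
proof -
  have "u \<in> set \<gamma> \<longleftrightarrow> last \<gamma> = u \<or> u \<in> set (butlast \<gamma>)" if "\<gamma> \<noteq> []" for \<gamma>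
    using set_append_last[OF that] by auto
  then show ?thesis using assms by (auto simp: simple_paths_def)
qed

text \<open>Deletion and contraction for sums over simple paths. Paths through \<open>u\<close> are not affected by the
deletion, since the edge then lies inside the sink \<open>S \<union> \<gamma>\<close>. A path that avoids \<open>u\<close> contributes
to both terms by \<open>num_trees_split\<close>; in the second term it is joined by the paths whose last step is
the deleted edge, which end at the new sink \<open>u\<close>.\<close>

lemma path_sum_split:
  fixes f :: "'a list \<Rightarrow> real"
  assumes g: "graph_on V E" and S: "S \<subseteq> V" and u: "u \<in> V - S" and s: "s \<in> S"
    and e: "{u, s} \<in> E" and v: "v \<in> V - S"
  defines "E' \<equiv> E - {{u, s}}"
  shows "(\<Sum>\<gamma>\<in>simple_paths E S v. real (num_trees V E (S \<union> set \<gamma>)) * f \<gamma>) =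
    (\<Sum>\<gamma>\<in>simple_paths E' S v. real (num_trees V E' (S \<union> set \<gamma>)) * f \<gamma>) +
    (\<Sum>\<gamma>\<in>simple_paths E' (insert u S) v. real (num_trees V E' (insert u S \<union> set \<gamma>)) *
       f (if last \<gamma> = u then \<gamma> @ [s] else \<gamma>))"
proof -
  have g': "graph_on V E'" using g by (auto simp: E'_def intro: graph_on_subset)
  have vV: "v \<in> V" using v by simp
  let ?P = "simple_paths E' S v" and ?Q = "simple_paths E' (insert u S) v"
  let ?TA = "\<lambda>\<gamma>. real (num_trees V E (S \<union> set \<gamma>)) * f \<gamma>"
  let ?TB = "\<lambda>\<gamma>. real (num_trees V E' (S \<union> set \<gamma>)) * f \<gamma>"
  let ?TC = "\<lambda>\<gamma>. real (num_trees V E' (insert u S \<union> set \<gamma>)) * f (if last \<gamma> = u then \<gamma> @ [s] else \<gamma>)"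
  have fin: "finite ?P" "finite ?Q"
    using finite_simple_paths[OF g' vV] by auto
  have inV: "set \<gamma> \<subseteq> V" if "\<gamma> \<in> ?P \<union> ?Q" for \<gamma>
    using simple_paths_in_verts[OF g' vV] that by blast
  have split: "simple_paths E S v = ?P \<union> (\<lambda>\<gamma>. \<gamma> @ [s]) ` {\<gamma> \<in> ?Q. last \<gamma> = u}"
    unfolding E'_def using simple_paths_split[of v S u s E] u s e v by blast
  have disj: "?P \<inter> (\<lambda>\<gamma>. \<gamma> @ [s]) ` {\<gamma> \<in> ?Q. last \<gamma> = u} = {}"
  proof -
    have False if "\<gamma> \<in> ?Q" "last \<gamma> = u" "\<gamma> @ [s] \<in> ?P" for \<gamma>
    proof -
      have "\<gamma> \<noteq> []" using that(1) by (simp add: simple_paths_def)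
      moreover have "successively (\<lambda>x y. {x, y} \<in> E') (\<gamma> @ [s])"
        using that(3) by (simp add: simple_paths_def)
      ultimately have "{u, s} \<in> E'"
        using that(2) by (simp add: successively_append_iff)
      then show False by (simp add: E'_def)
    qed
    then show ?thesis by blast
  qed
  have "sum ?TA (simple_paths E S v) = sum ?TA ?P + sum ?TA ((\<lambda>\<gamma>. \<gamma> @ [s]) ` {\<gamma> \<in> ?Q. last \<gamma> = u})"
    unfolding split using fin disj by (intro sum.union_disjoint) auto
  also have "sum ?TA ((\<lambda>\<gamma>. \<gamma> @ [s]) ` {\<gamma> \<in> ?Q. last \<gamma> = u}) = sum ?TC {\<gamma> \<in> ?Q. last \<gamma> = u}"
  proof (subst sum.reindex)
    have "?TA (\<gamma> @ [s]) = ?TC \<gamma>" if "\<gamma> \<in> ?Q" "last \<gamma> = u" for \<gamma>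
    proof -
      have "S \<union> set (\<gamma> @ [s]) = insert u S \<union> set \<gamma>"
        using that s last_in_set[of \<gamma>] by (auto simp: simple_paths_def)
      moreover have "num_trees V E' (insert u S \<union> set \<gamma>) = num_trees V E (insert u S \<union> set \<gamma>)"
        unfolding E'_def using that inV[of \<gamma>] u S s
        by (intro num_trees_edge_in_sink[OF g]) auto
      ultimately show ?thesis by (simp only: that(2) if_True simp_thms)
    qed
    then show "sum (?TA \<circ> (\<lambda>\<gamma>. \<gamma> @ [s])) {\<gamma> \<in> ?Q. last \<gamma> = u} = sum ?TC {\<gamma> \<in> ?Q. last \<gamma> = u}"
      by (intro sum.cong refl) (simp only: comp_def mem_Collect_eq)
  qed (auto intro: inj_onI)
  also have "sum ?TA ?P = sum ?TB ?P + sum ?TC {\<gamma> \<in> ?Q. last \<gamma> \<noteq> u}"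
  proof -
    have "?TA \<gamma> = ?TB \<gamma> + (if u \<in> set \<gamma> then 0 else ?TC \<gamma>)" if "\<gamma> \<in> ?P" for \<gamma>
    proof (cases "u \<in> set \<gamma>")
      case True
      then show ?thesis
        using num_trees_edge_in_sink[OF g, of "S \<union> set \<gamma>" u s] that inV[of \<gamma>] S s
        by (simp add: E'_def)
    next
      case False
      moreover have "last \<gamma> \<noteq> u"
        using that u by (auto simp: simple_paths_def)
      moreover have "num_trees V E (S \<union> set \<gamma>) =
          num_trees V E' (S \<union> set \<gamma>) + num_trees V E' (insert u S \<union> set \<gamma>)"
        using num_trees_split[OF g, of u "S \<union> set \<gamma>" s] u s e False by (simp add: E'_def)
      ultimately show ?thesis by (simp only: if_False of_nat_add distrib_right)
    qed
    then have "sum ?TA ?P = (\<Sum>\<gamma>\<in>?P. ?TB \<gamma> + (if u \<in> set \<gamma> then 0 else ?TC \<gamma>))"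
      by (intro sum.cong) auto
    also have "\<dots> = sum ?TB ?P + (\<Sum>\<gamma>\<in>?P. if u \<notin> set \<gamma> then ?TC \<gamma> else 0)"
      by (auto simp: sum.distrib intro!: sum.cong)
    also have "(\<Sum>\<gamma>\<in>?P. if u \<notin> set \<gamma> then ?TC \<gamma> else 0) = sum ?TC {\<gamma> \<in> ?P. u \<notin> set \<gamma>}"
      by (rule sum.inter_filter[OF fin(1), symmetric])
    also have "{\<gamma> \<in> ?P. u \<notin> set \<gamma>} = {\<gamma> \<in> ?Q. last \<gamma> \<noteq> u}"
      by (rule simple_paths_avoiding) (use u in simp)
    finally show ?thesis .
  qed
  also have "sum ?TB ?P + sum ?TC {\<gamma> \<in> ?Q. last \<gamma> \<noteq> u} + sum ?TC {\<gamma> \<in> ?Q. last \<gamma> = u} =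
      sum ?TB ?P + sum ?TC ?Q"
  proof -
    have "?Q = {\<gamma> \<in> ?Q. last \<gamma> \<noteq> u} \<union> {\<gamma> \<in> ?Q. last \<gamma> = u}" by blast
    then have "sum ?TC ?Q = sum ?TC {\<gamma> \<in> ?Q. last \<gamma> \<noteq> u} + sum ?TC {\<gamma> \<in> ?Q. last \<gamma> = u}"
      using fin by (subst sum.union_disjoint[symmetric]) auto
    then show ?thesis by simp
  qed
  finally show ?thesis .
qed

lemma simple_paths_isolated:
  assumes "graph_on V E" "S \<subset> V" "v \<in> V - S" "\<And>v s. v \<in> V - S \<Longrightarrow> s \<in> S \<Longrightarrow> {v, s} \<notin> E"
  shows "simple_paths E S v = {}"
proof -
  have "False" if "\<gamma> \<noteq> []" "hd \<gamma> = v" "successively (\<lambda>x y. {x, y} \<in> E) \<gamma>" "set \<gamma> \<inter> S = {}"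
    "t \<in> S" "{last \<gamma>, t} \<in> E" for \<gamma> t
  proof -
    have "last \<gamma> \<in> V - S"
      using successively_in_verts[OF assms(1) that(3)] that assms(3) last_in_set[OF that(1)] by blast
    then show False using assms(4) that by blast
  qed
  then show ?thesis
    using assms(3) by (subst simple_paths_nonsink) auto
qed

text \<open>Each spanning tree contains exactly one path from \<open>v\<close> to the sink. In
place of a decomposition of trees along this path, \<open>path_sum_split\<close> shows that both sides obey the
same deletion and contraction rule.\<close>

lemma num_trees_path_sum:
  assumes "graph_on V E" "S \<subseteq> V" "v \<in> V"
  shows "(\<Sum>\<gamma>\<in>simple_paths E S v. real (num_trees V E (S \<union> set \<gamma>))) = real (num_trees V E S)"
proof -
  have "v \<in> V - S \<longrightarrow> ?thesis"
    using assms(1,2)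
  proof (induction rule: crossing_induct)
    case (isolated E S)
    then show ?case
      using simple_paths_isolated[OF isolated(1,2)] num_trees_isolated(1)[OF isolated] by simp
  next
    case (crossing E S u s)
    show ?case
    proof
      assume v: "v \<in> V - S"
      let ?E = "E - {{u, s}}"
      have "(\<Sum>\<gamma>\<in>simple_paths ?E (insert u S) v. real (num_trees V ?E (insert u S \<union> set \<gamma>))) =
        real (num_trees V ?E (insert u S))"
      proof (cases "v = u")
        case True
        then show ?thesis by (simp add: simple_paths_sink)
      next
        case False
        then show ?thesis using crossing(7) v by blast
      qed
      then show "(\<Sum>\<gamma>\<in>simple_paths E S v. real (num_trees V E (S \<union> set \<gamma>))) = real (num_trees V E S)"
        using path_sum_split[OF crossing(1-5) v, of "\<lambda>_. 1"] crossing(6) v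
          num_trees_split[OF crossing(1,3-5)] by simp
    qed
  qed simp
  then show ?thesis
    using assms by (cases "v \<in> S") (simp_all add: simple_paths_sink insert_absorb)
qed

lemma simple_paths_first_step:
  assumes "u \<notin> S"
  shows "simple_paths E S u =
    (\<Union>x\<in>nbs E u. (#) u ` {\<gamma> \<in> simple_paths E (insert u S) x. last \<gamma> \<noteq> u})"
proof (intro equalityI subsetI)
  fix \<gamma> assume g: "\<gamma> \<in> simple_paths E S u"
  then obtain \<gamma>' where g': "\<gamma> = u # \<gamma>'" by (cases \<gamma>) (auto simp: simple_paths_def)
  have ne: "\<gamma>' \<noteq> []" using g g' assms by (auto simp: simple_paths_def)
  have "\<gamma>' \<in> simple_paths E (insert u S) (hd \<gamma>')" "last \<gamma>' \<noteq> u" "hd \<gamma>' \<in> nbs E u"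
    using g g' ne in_set_butlastD[of u \<gamma>'] assms
    by (auto simp: simple_paths_def nbs_def successively_Cons)
  then show "\<gamma> \<in> (\<Union>x\<in>nbs E u. (#) u ` {\<gamma> \<in> simple_paths E (insert u S) x. last \<gamma> \<noteq> u})"
    using g' by blast
next
  fix \<gamma> assume "\<gamma> \<in> (\<Union>x\<in>nbs E u. (#) u ` {\<gamma> \<in> simple_paths E (insert u S) x. last \<gamma> \<noteq> u})"
  then obtain x \<gamma>' where x: "x \<in> nbs E u" "\<gamma> = u # \<gamma>'" "\<gamma>' \<in> simple_paths E (insert u S) x" "last \<gamma>' \<noteq> u"
    by blast
  have "\<gamma>' \<noteq> []" using x by (simp add: simple_paths_def)
  note set_append_last[OF this]
  then have "u \<notin> set \<gamma>'" using x by (auto simp: simple_paths_def)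
  then show "\<gamma> \<in> simple_paths E S u"
    using x assms by (auto simp: simple_paths_def nbs_def successively_Cons)
qed

lemma path_sum_first_step:
  fixes f :: "'a list \<Rightarrow> 'b::comm_monoid_add"
  assumes "graph_on V E" "u \<in> V - S"
  shows "(\<Sum>\<gamma>\<in>simple_paths E S u. f \<gamma>) =
    (\<Sum>x\<in>nbs E u. \<Sum>\<gamma> | \<gamma> \<in> simple_paths E (insert u S) x \<and> last \<gamma> \<noteq> u. f (u # \<gamma>))"
proof -
  have u: "u \<notin> S" using assms by simp
  have inV: "x \<in> V" if "x \<in> nbs E u" for x using nbs_subset[OF assms(1)] that by blast
  have "(\<Sum>\<gamma>\<in>simple_paths E S u. f \<gamma>) =
    (\<Sum>x\<in>nbs E u. sum f ((#) u ` {\<gamma> \<in> simple_paths E (insert u S) x. last \<gamma> \<noteq> u}))"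
    unfolding simple_paths_first_step[OF u]
  proof (intro sum.UNION_disjoint ballI impI)
    show "finite ((#) u ` {\<gamma> \<in> simple_paths E (insert u S) x. last \<gamma> \<noteq> u})" if "x \<in> nbs E u" for x
      using finite_simple_paths[OF assms(1) inV[OF that]] by simp
  qed (auto simp: simple_paths_def finite_nbs[OF assms(1)])
  also have "\<dots> = (\<Sum>x\<in>nbs E u. \<Sum>\<gamma> | \<gamma> \<in> simple_paths E (insert u S) x \<and> last \<gamma> \<noteq> u. f (u # \<gamma>))"
    by (rule sum.cong[OF refl], subst sum.reindex) auto
  finally show ?thesis .
qed

lemma num_trees_path_sum_first_step:
  assumes "graph_on V E" "S \<subseteq> V" "u \<in> V - S"
  shows "real (num_trees V E S) =
    (\<Sum>x\<in>nbs E u. \<Sum>\<gamma> | \<gamma> \<in> simple_paths E (insert u S) x \<and> last \<gamma> \<noteq> u.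
        real (num_trees V E (insert u S \<union> set \<gamma>)))"
proof -
  have "v \<in> V" if "v = u" for v using assms that by simp
  then show ?thesis
    using num_trees_path_sum[OF assms(1,2), of u] path_sum_first_step[OF assms(1,3), of "\<lambda>\<gamma>. real (num_trees V E (S \<union> set \<gamma>))"] by simp
qed

text \<open>The left-hand side counts the triples of a tree, a vertex \<open>v\<close> and a neighbour of \<open>v\<close> that is a
sink or lies on the path from \<open>v\<close> to the sink. One neighbour for each \<open>v\<close> is the next vertex of
that path; every other one closes a cycle with the tree. A unicyclic subgraph whose cycle is not a
loop arises twice in this way, from the two edges of the cycle at its vertex closest to the sink.

In the induction, moving \<open>u\<close> into the sink makes it a counted neighbour also for paths that do not
visit it. The resulting correction is evaluated by decomposing the paths from \<open>u\<close> after their first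
step (\<open>num_trees_path_sum_first_step\<close>).\<close>

lemma visited_neighbours_sum:
  assumes "graph_on V E" "S \<subseteq> V"
  shows "(\<Sum>v\<in>V - S. \<Sum>\<gamma>\<in>simple_paths E S v.
        real (num_trees V E (S \<union> set \<gamma>)) * real (card (nbs E v \<inter> (S \<union> set \<gamma>)))) =
    real (card (V - S)) * real (num_trees V E S) +
    2 * (real (num_unicyclic V E S) - real (card {e \<in> E. e \<subseteq> S}) * real (num_trees V E S))"
  using assms
proof (induction rule: crossing_induct)
  case (full E)
  have "{e \<in> E. e \<subseteq> V} = E" using full by (auto simp: graph_on_def)
  then show ?case using full by simp
next
  case (isolated E S)
  then show ?case
    using simple_paths_isolated[OF isolated(1,2)] num_trees_isolated[OF isolated] by simp
next
  case (crossing E S u s)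
  let ?E = "E - {{u, s}}" and ?S = "insert u S"
  let ?T = "\<lambda>E S. real (num_trees V E S)"
  let ?U = "\<lambda>E S. real (num_unicyclic V E S)"
  let ?l = "\<lambda>E S. real (card {e \<in> E. e \<subseteq> S})"
  let ?q = "\<lambda>E S v \<gamma>. real (card (nbs E v \<inter> (S \<union> set \<gamma>)))"
  let ?n = "\<lambda>E S v. \<Sum>\<gamma>\<in>simple_paths E S v. ?T E (S \<union> set \<gamma>) * ?q E S v \<gamma>"
  note g = crossing(1)
  have g': "graph_on V ?E" using g by (auto intro: graph_on_subset)
  have finV: "finite V" using g by (rule graph_on_finite_verts)
  have us: "u \<noteq> s" using crossing(3,4) by auto
  have S': "?S \<subseteq> V" using crossing by auto
  \<comment> \<open>\<open>R v\<close> counts the trees for the sink set \<open>insert u S\<close> in which the path from \<open>v\<close> ends in \<open>S\<close>.\<close>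
  define d where "d = real (card (nbs ?E u \<inter> S))"
  define R where "R v = (\<Sum>\<gamma> | \<gamma> \<in> simple_paths ?E ?S v \<and> last \<gamma> \<noteq> u. ?T ?E (?S \<union> set \<gamma>))" for v
  have nbs_u: "nbs E u = insert s (nbs ?E u)" "s \<notin> nbs ?E u"
    using crossing(5) by (auto simp: nbs_def doubleton_eq_iff)
  have nbs_v: "nbs ?E v = nbs E v" if "v \<noteq> u" "v \<notin> S" for v
    using that crossing(4) by (auto simp: nbs_def doubleton_eq_iff)
  have finn: "finite (nbs ?E v)" for v by (rule finite_nbs[OF g'])
  have nv: "?n E S v = ?n ?E S v + ?n ?E ?S v - (if v \<in> nbs ?E u then R v else 0)"
    if v: "v \<in> V - ?S" for v
  proof -
    have v': "v \<in> V - S" "v \<noteq> u" "v \<notin> S" "v \<in> V" using v by auto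
    have fin: "finite (simple_paths ?E ?S v)" using finite_simple_paths[OF g' v'(4)] .
    have q: "?q E S v (if last \<gamma> = u then \<gamma> @ [s] else \<gamma>) =
        ?q ?E ?S v \<gamma> - (if last \<gamma> \<noteq> u \<and> v \<in> nbs ?E u then 1 else 0)"
      if "\<gamma> \<in> simple_paths ?E ?S v" for \<gamma>
    proof (cases "last \<gamma> = u")
      case True
      have "S \<union> set (\<gamma> @ [s]) = ?S \<union> set \<gamma>"
        using that True crossing(4) last_in_set[of \<gamma>] by (auto simp: simple_paths_def)
      then show ?thesis using True nbs_v[OF v'(2,3)] by simp
    next
      case False
      have "u \<notin> S \<union> set \<gamma>"
        using False that simple_paths_avoiding[of u S ?E v] crossing(3) by blast
      moreover have "u \<in> nbs ?E v \<longleftrightarrow> v \<in> nbs ?E u" by (rule nbs_sym)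
      ultimately show ?thesis
        using False nbs_v[OF v'(2,3)] finn[of v] by (auto simp: Int_insert_right)
    qed
    have "(\<Sum>\<gamma>\<in>simple_paths ?E ?S v. ?T ?E (?S \<union> set \<gamma>) * ?q E S v (if last \<gamma> = u then \<gamma> @ [s] else \<gamma>))
      = (\<Sum>\<gamma>\<in>simple_paths ?E ?S v. ?T ?E (?S \<union> set \<gamma>) * ?q ?E ?S v \<gamma>
          - (if last \<gamma> \<noteq> u then (if v \<in> nbs ?E u then ?T ?E (?S \<union> set \<gamma>) else 0) else 0))"
      by (intro sum.cong refl) (simp only: q, simp add: algebra_simps)
    also have "\<dots> = ?n ?E ?S v - (if v \<in> nbs ?E u then R v else 0)"
      unfolding sum_subtractf R_def
      by (subst sum.inter_filter[symmetric]) (use fin in auto)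
    finally show ?thesis
      using path_sum_split[OF crossing(1-5) v'(1), of "?q E S v"] nbs_v[OF v'(2,3)] by simp
  qed
  have nu: "?n E S u = ?n ?E S u + ?T ?E S + (d + 1) * ?T ?E ?S"
  proof -
    have q: "?q E S u \<gamma> = ?q ?E S u \<gamma> + 1" for \<gamma>
      unfolding nbs_u(1) using crossing(4) nbs_u(2) finn[of u] by simp
    have 1: "(\<Sum>\<gamma>\<in>simple_paths ?E S u. ?T ?E (S \<union> set \<gamma>) * ?q E S u \<gamma>) = ?n ?E S u + ?T ?E S"
      unfolding q num_trees_path_sum[OF g' crossing(2), of u, symmetric]
      using num_trees_path_sum[OF g' crossing(2), of u] crossing(3)
      by (simp add: algebra_simps sum.distrib)
    have "u \<notin> nbs E u" using nbs_subset[OF g] by blast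
    then have "?q E S u [u, s] = d + 1"
      unfolding d_def nbs_u(1) using crossing(4) nbs_u(2) finn[of u] by (simp add: insert_absorb)
    then have 2: "(\<Sum>\<gamma>\<in>simple_paths ?E ?S u. ?T ?E (?S \<union> set \<gamma>) *
        ?q E S u (if last \<gamma> = u then \<gamma> @ [s] else \<gamma>)) = (d + 1) * ?T ?E ?S"
      by (simp add: simple_paths_sink)
    show ?thesis
      unfolding path_sum_split[OF crossing(1-5,3), of "?q E S u"] 1 2 by simp
  qed
  have R: "?T ?E S = d * ?T ?E ?S + (\<Sum>v\<in>nbs ?E u - S. R v)"
  proof -
    have "?T ?E S = (\<Sum>x\<in>nbs ?E u. R x)"
      unfolding R_def by (rule num_trees_path_sum_first_step[OF g' crossing(2,3)])
    also have "\<dots> = (\<Sum>x\<in>nbs ?E u \<inter> S. R x) + (\<Sum>x\<in>nbs ?E u - S. R x)"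
      using finn[of u] by (subst sum.union_disjoint[symmetric]) (auto intro!: sum.cong)
    also have "(\<Sum>x\<in>nbs ?E u \<inter> S. R x) = (\<Sum>x\<in>nbs ?E u \<inter> S. ?T ?E ?S)"
    proof (intro sum.cong refl)
      fix x assume x: "x \<in> nbs ?E u \<inter> S"
      then have xu: "x \<noteq> u" using crossing(3) by blast
      have "{\<gamma>. \<gamma> \<in> simple_paths ?E ?S x \<and> last \<gamma> \<noteq> u} = {[x]}"
        using x xu by (subst simple_paths_sink) auto
      then show "R x = ?T ?E ?S"
        unfolding R_def using x by (simp add: insert_absorb)
    qed
    finally show ?thesis by (simp add: d_def)
  qed
  have sumR: "(\<Sum>v\<in>V - ?S. if v \<in> nbs ?E u then R v else 0) = (\<Sum>v\<in>nbs ?E u - S. R v)"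
  proof -
    have "(V - ?S) \<inter> {v. v \<in> nbs ?E u} = nbs ?E u - S"
      using nbs_subset[OF g', of u] by blast
    then show ?thesis using finV by (simp add: sum.inter_restrict[symmetric] Int_def)
  qed
  have VS1: "V - S = insert u (V - ?S)" "u \<notin> V - ?S"
    using crossing(3) by auto
  have VS3: "card (V - S) = Suc (card (V - ?S))"
    unfolding VS1(1) using VS1(2) finV by (subst card_insert_disjoint) auto
  note VS = VS1 VS3
  have l: "?l ?E S = ?l E S" "?l ?E ?S = ?l E S + d"
  proof -
    have "{e \<in> ?E. e \<subseteq> S} = {e \<in> E. e \<subseteq> S}" using crossing(3) by auto
    then show "?l ?E S = ?l E S" by simp
    show "?l ?E ?S = ?l E S + d"
      using card_edges_inside[OF g', of u S] crossing(3) \<open>?l ?E S = ?l E S\<close> by (simp add: d_def)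
  qed
  have "(\<Sum>v\<in>V - S. ?n E S v) = ?n E S u + (\<Sum>v\<in>V - ?S. ?n E S v)"
    unfolding VS(1) using VS(2) finV by (subst sum.insert) auto
  also have "(\<Sum>v\<in>V - ?S. ?n E S v) =
     (\<Sum>v\<in>V - ?S. ?n ?E S v) + (\<Sum>v\<in>V - ?S. ?n ?E ?S v) - (\<Sum>v\<in>nbs ?E u - S. R v)"
    unfolding sumR[symmetric] sum.distrib[symmetric] sum_subtractf[symmetric]
    by (rule sum.cong[OF refl nv])
  also have "?n E S u + \<dots> = (\<Sum>v\<in>V - S. ?n ?E S v) + (\<Sum>v\<in>V - ?S. ?n ?E ?S v)
      + (2 * d + 1) * ?T ?E ?S"
  proof -
    have "(\<Sum>v\<in>V - S. ?n ?E S v) = ?n ?E S u + (\<Sum>v\<in>V - ?S. ?n ?E S v)"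
      unfolding VS(1) using VS(2) finV by (subst sum.insert) auto
    then show ?thesis using nu R by (simp add: algebra_simps)
  qed
  finally show ?case
    unfolding crossing(6,7) l VS(3)
      num_trees_split[OF g crossing(3-5)] num_unicyclic_split[OF g crossing(3-5)]
    by (simp add: algebra_simps)
qed

section \<open>Counting burnable sandpiles\<close>

definition burnable :: "'a set set \<Rightarrow> 'a set \<Rightarrow> ('a \<Rightarrow> int) \<Rightarrow> bool" where
  "burnable E A \<sigma> \<longleftrightarrow> (\<forall>W. W \<subseteq> A \<and> W \<noteq> {} \<longrightarrow> (\<exists>u\<in>W. int (card (nbs E u \<inter> W)) \<le> \<sigma> u))"

definition allowed :: "'a set \<Rightarrow> 'a set set \<Rightarrow> 'a set \<Rightarrow> ('a \<Rightarrow> int) set" where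
  "allowed V E S = {\<sigma>. (\<forall>v. v \<notin> V - S \<longrightarrow> \<sigma> v = 0) \<and>
     (\<forall>v\<in>V - S. 0 \<le> \<sigma> v \<and> \<sigma> v < int (card (nbs E v))) \<and> burnable E (V - S) \<sigma>}"

lemma allowed_bounds:
  "\<sigma> \<in> allowed V E S \<Longrightarrow> v \<in> V - S \<Longrightarrow> 0 \<le> \<sigma> v"
  "\<sigma> \<in> allowed V E S \<Longrightarrow> v \<in> V - S \<Longrightarrow> \<sigma> v < int (card (nbs E v))"
  by (auto simp: allowed_def)

lemma allowed_full: "allowed V E V = {\<lambda>_. 0}"
  by (auto simp: allowed_def burnable_def)

lemma allowed_isolated:
  assumes "graph_on V E" "S \<subset> V" "\<And>v s. v \<in> V - S \<Longrightarrow> s \<in> S \<Longrightarrow> {v, s} \<notin> E"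
  shows "allowed V E S = {}"
proof -
  have False if \<sigma>: "\<sigma> \<in> allowed V E S" for \<sigma>
  proof -
    have "V - S \<noteq> {}" using assms(2) by blast
    then obtain u where u: "u \<in> V - S" "int (card (nbs E u \<inter> (V - S))) \<le> \<sigma> u"
      using \<sigma> unfolding allowed_def burnable_def by blast
    have "nbs E u \<subseteq> V - S"
      using nbs_subset[OF assms(1), of u] assms(3)[OF u(1)] by (auto simp: nbs_def)
    then have "nbs E u \<inter> (V - S) = nbs E u" by blast
    then show False using u(2) allowed_bounds(2)[OF \<sigma> u(1)] by simp
  qed
  then show ?thesis by blast
qed

text \<open>If \<open>u\<close> has the maximal height \<open>deg u - 1\<close>, then it burns at once thanks to its sink neighbour, and
what remains is a condition with \<open>u\<close> as a sink. Otherwise the height is also stable after the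
deletion of the edge, and the deletion does not change the number of neighbours of any vertex in a
set without sinks.\<close>

lemma allowed_split:
  assumes g: "graph_on V E" and S: "S \<subseteq> V" and u: "u \<in> V - S" and s: "s \<in> S" and e: "{u, s} \<in> E"
  defines "E' \<equiv> E - {{u, s}}"
  shows "allowed V E S = {\<sigma> \<in> allowed V E S. \<sigma> u \<noteq> int (card (nbs E' u))} \<union>
      {\<sigma> \<in> allowed V E S. \<sigma> u = int (card (nbs E' u))}"
    and "{\<sigma> \<in> allowed V E S. \<sigma> u \<noteq> int (card (nbs E' u))} = allowed V E' S"
    and "{\<sigma> \<in> allowed V E S. \<sigma> u = int (card (nbs E' u))} =
      (\<lambda>\<sigma>. \<sigma>(u := int (card (nbs E' u)))) ` allowed V E' (insert u S)"
proof -
  \<comment> \<open>The maximal stable height of \<open>u\<close> is its degree after the deletion.\<close>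
  let ?k = "int (card (nbs E' u))"
  have g': "graph_on V E'" using g by (auto simp: E'_def intro: graph_on_subset)
  have nbs_u: "nbs E u = insert s (nbs E' u)" "s \<notin> nbs E' u"
    using e by (auto simp: E'_def nbs_def doubleton_eq_iff)
  have deg_u: "int (card (nbs E u)) = ?k + 1"
    using nbs_u finite_nbs[OF g', of u] by simp
  have nbs_v: "nbs E' v = nbs E v" if "v \<noteq> u" "v \<notin> S" for v
    using that s by (auto simp: E'_def nbs_def doubleton_eq_iff)
  have nbs_W: "nbs E' v \<inter> W = nbs E v \<inter> W" if "v \<in> V - S" "W \<subseteq> V - S" for v W
    using nbs_v[of v] nbs_u that s by (cases "v = u") auto
  have burn: "burnable E' A \<sigma> \<longleftrightarrow> burnable E A \<sigma>" if "A \<subseteq> V - S" for A \<sigma>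
  proof -
    have "(\<exists>u\<in>W. int (card (nbs E' u \<inter> W)) \<le> \<sigma> u) \<longleftrightarrow> (\<exists>u\<in>W. int (card (nbs E u \<inter> W)) \<le> \<sigma> u)"
      if "W \<subseteq> A" for W
      using nbs_W[of _ W] that \<open>A \<subseteq> V - S\<close> by (intro bex_cong refl) (metis subset_trans subsetD)
    then show ?thesis unfolding burnable_def by blast
  qed
  show "allowed V E S = {\<sigma> \<in> allowed V E S. \<sigma> u \<noteq> ?k} \<union> {\<sigma> \<in> allowed V E S. \<sigma> u = ?k}"
    by blast
  show "{\<sigma> \<in> allowed V E S. \<sigma> u \<noteq> ?k} = allowed V E' S"
  proof -
    have "(\<forall>v\<in>V - S. 0 \<le> \<sigma> v \<and> \<sigma> v < int (card (nbs E v))) \<and> \<sigma> u \<noteq> ?k \<longleftrightarrow>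
        (\<forall>v\<in>V - S. 0 \<le> \<sigma> v \<and> \<sigma> v < int (card (nbs E' v)))" for \<sigma> :: "'a \<Rightarrow> int"
    proof (intro iffI conjI ballI)
      fix v assume *: "(\<forall>v\<in>V - S. 0 \<le> \<sigma> v \<and> \<sigma> v < int (card (nbs E v))) \<and> \<sigma> u \<noteq> ?k" and v: "v \<in> V - S"
      show "0 \<le> \<sigma> v" using * v by blast
      show "\<sigma> v < int (card (nbs E' v))"
      proof (cases "v = u")
        case True
        have "\<sigma> u < ?k + 1" "\<sigma> u \<noteq> ?k"
          unfolding deg_u[symmetric] using * u by blast+
        then show ?thesis using True by simp
      next
        case False
        then show ?thesis using * v nbs_v[of v] by auto
      qed
    next
      fix v assume *: "\<forall>v\<in>V - S. 0 \<le> \<sigma> v \<and> \<sigma> v < int (card (nbs E' v))" and v: "v \<in> V - S"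
      show "0 \<le> \<sigma> v" using * v by blast
      have "\<sigma> v < int (card (nbs E' v))" using * v by blast
      then show "\<sigma> v < int (card (nbs E v))"
        using v nbs_v[of v] deg_u by (cases "v = u") auto
    next
      assume *: "\<forall>v\<in>V - S. 0 \<le> \<sigma> v \<and> \<sigma> v < int (card (nbs E' v))"
      show "\<sigma> u \<noteq> ?k" using bspec[OF * u] by simp
    qed
    then show ?thesis
      unfolding allowed_def burn[OF order_refl] by blast
  qed
  show "{\<sigma> \<in> allowed V E S. \<sigma> u = ?k} = (\<lambda>\<sigma>. \<sigma>(u := ?k)) ` allowed V E' (insert u S)"
  proof (intro equalityI subsetI)
    fix \<sigma> assume "\<sigma> \<in> {\<sigma> \<in> allowed V E S. \<sigma> u = ?k}"
    then have \<sigma>: "\<sigma> \<in> allowed V E S" "\<sigma> u = ?k" by auto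
    have "burnable E (V - insert u S) (\<sigma>(u := 0))"
      unfolding burnable_def
    proof (intro allI impI)
      fix W assume W: "W \<subseteq> V - insert u S \<and> W \<noteq> {}"
      then obtain w where w: "w \<in> W" "int (card (nbs E w \<inter> W)) \<le> \<sigma> w"
        using \<sigma>(1) unfolding allowed_def burnable_def by blast
      then show "\<exists>w\<in>W. int (card (nbs E w \<inter> W)) \<le> (\<sigma>(u := 0)) w"
        using W by (intro bexI[of _ w]) auto
    qed
    then have "burnable E' (V - insert u S) (\<sigma>(u := 0))"
      by (subst burn) auto
    moreover have "0 \<le> \<sigma> v \<and> \<sigma> v < int (card (nbs E' v))" if "v \<in> V - insert u S" for v
      using \<sigma>(1) that nbs_v[of v] by (auto simp: allowed_def)
    ultimately have "\<sigma>(u := 0) \<in> allowed V E' (insert u S)"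
      using \<sigma>(1) by (auto simp: allowed_def)
    moreover have "\<sigma> = (\<sigma>(u := 0))(u := ?k)" using \<sigma>(2) by auto
    ultimately show "\<sigma> \<in> (\<lambda>\<sigma>. \<sigma>(u := ?k)) ` allowed V E' (insert u S)" by blast
  next
    fix \<sigma>' assume "\<sigma>' \<in> (\<lambda>\<sigma>. \<sigma>(u := ?k)) ` allowed V E' (insert u S)"
    then obtain \<sigma> where \<sigma>: "\<sigma> \<in> allowed V E' (insert u S)" "\<sigma>' = \<sigma>(u := ?k)" by blast
    have b: "burnable E (V - insert u S) \<sigma>"
      using \<sigma>(1) burn[of "V - insert u S"] by (auto simp: allowed_def)
    have "burnable E (V - S) \<sigma>'"
      unfolding burnable_def
    proof (intro allI impI)
      fix W assume W: "W \<subseteq> V - S \<and> W \<noteq> {}"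
      show "\<exists>w\<in>W. int (card (nbs E w \<inter> W)) \<le> \<sigma>' w"
      proof (cases "u \<in> W")
        case True
        have "nbs E u \<inter> W \<subseteq> nbs E' u" unfolding nbs_u(1) using W s by blast
        then have "card (nbs E u \<inter> W) \<le> card (nbs E' u)"
          by (intro card_mono finite_nbs[OF g'])
        then show ?thesis using True \<sigma>(2) by (intro bexI[of _ u]) auto
      next
        case False
        then have "W \<subseteq> V - insert u S" using W by blast
        then obtain w where "w \<in> W" "int (card (nbs E w \<inter> W)) \<le> \<sigma> w"
          using b W unfolding burnable_def by blast
        then show ?thesis using \<sigma>(2) False by (intro bexI[of _ w]) auto
      qed
    qed
    moreover have "0 \<le> \<sigma>' v \<and> \<sigma>' v < int (card (nbs E v))" if "v \<in> V - S" for v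
    proof (cases "v = u")
      case True
      then show ?thesis using \<sigma>(2) deg_u by simp
    next
      case False
      then have "v \<in> V - insert u S" using that by blast
      from allowed_bounds[OF \<sigma>(1) this] show ?thesis
        using False that nbs_v[of v] \<sigma>(2) by simp
    qed
    moreover have "\<sigma>' v = 0" if "v \<notin> V - S" for v
      using \<sigma> that u by (auto simp: allowed_def)
    ultimately show "\<sigma>' \<in> {\<sigma> \<in> allowed V E S. \<sigma> u = ?k}"
      using \<sigma>(2) by (simp add: allowed_def)
  qed
qed

lemma inj_on_fun_upd_allowed: "inj_on (\<lambda>\<sigma>. \<sigma>(u := k)) (allowed V E (insert u S))"
proof (rule inj_onI)
  fix \<sigma> \<tau> :: "'a \<Rightarrow> int"
  assume *: "\<sigma> \<in> allowed V E (insert u S)" "\<tau> \<in> allowed V E (insert u S)" "\<sigma>(u := k) = \<tau>(u := k)"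
  show "\<sigma> = \<tau>"
  proof
    fix v
    show "\<sigma> v = \<tau> v"
    proof (cases "v = u")
      case True
      then show ?thesis using * by (simp add: allowed_def)
    next
      case False
      then show ?thesis using fun_cong[OF *(3), of v] by simp
    qed
  qed
qed

lemma finite_allowed: "graph_on V E \<Longrightarrow> S \<subseteq> V \<Longrightarrow> finite (allowed V E S)"
proof (induction rule: crossing_induct)
  case (full E)
  then show ?case by (simp add: allowed_full)
next
  case (isolated E S)
  then show ?case using allowed_isolated[OF isolated] by simp
next
  case (crossing E S u s)
  note sp = allowed_split[OF crossing(1-5)]
  have "finite ({\<sigma> \<in> allowed V E S. \<sigma> u \<noteq> int (card (nbs (E - {{u, s}}) u))} \<union>
      {\<sigma> \<in> allowed V E S. \<sigma> u = int (card (nbs (E - {{u, s}}) u))})"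
    unfolding sp(2,3) using crossing(6,7) by blast
  then show ?case by (subst sp(1))
qed

lemma card_allowed: "graph_on V E \<Longrightarrow> S \<subseteq> V \<Longrightarrow> card (allowed V E S) = num_trees V E S"
proof (induction rule: crossing_induct)
  case (full E)
  then show ?case by (simp add: allowed_full)
next
  case (isolated E S)
  then show ?case using allowed_isolated[OF isolated] num_trees_isolated[OF isolated] by simp
next
  case (crossing E S u s)
  let ?E = "E - {{u, s}}"
  have g': "graph_on V ?E" "insert u S \<subseteq> V" using crossing(1-3) by (auto intro: graph_on_subset)
  note sp = allowed_split[OF crossing(1-5)]
  have "card (allowed V E S) = card {\<sigma> \<in> allowed V E S. \<sigma> u \<noteq> int (card (nbs ?E u))} +
      card {\<sigma> \<in> allowed V E S. \<sigma> u = int (card (nbs ?E u))}"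
    by (subst sp(1), rule card_Un_disjoint) (use finite_allowed[OF crossing(1,2)] in auto)
  then have "card (allowed V E S) = card (allowed V ?E S) + card (allowed V ?E (insert u S))"
    unfolding sp(2,3) card_image[OF inj_on_fun_upd_allowed] .
  then show ?case
    using crossing(6,7) num_trees_split[OF crossing(1,3-5)] by simp
qed

lemma card_edges_avoiding:
  assumes "graph_on V E" "u \<notin> S"
  shows "card {e \<in> E. e \<inter> S = {}} = card {e \<in> E. e \<inter> insert u S = {}} + card (nbs E u - S)"
proof -
  have inj: "inj_on (\<lambda>x. {u, x}) (nbs E u - S)" by (auto intro!: inj_onI simp: doubleton_eq_iff)
  have "{e \<in> E. e \<inter> S = {}} = {e \<in> E. e \<inter> insert u S = {}} \<union> (\<lambda>x. {u, x}) ` (nbs E u - S)"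
    (is "?A = ?B \<union> ?C")
  proof (intro equalityI subsetI)
    fix e assume e: "e \<in> ?A"
    then have "e \<in> E" by blast
    then obtain a b where ab: "e = {a, b}" "a \<noteq> b" using assms(1) unfolding graph_on_def by meson
    show "e \<in> ?B \<union> ?C"
    proof (cases "u \<in> e")
      case True
      then obtain c where c: "e = {u, c}" using ab by auto
      then have "c \<in> nbs E u - S" using e by (auto simp: nbs_def)
      with c show ?thesis by blast
    qed (use e in auto)
  qed (use assms(2) in \<open>auto simp: nbs_def\<close>)
  moreover have "?B \<inter> ?C = {}" by auto
  ultimately have "card ?A = card ?B + card ?C"
    using finite_nbs[OF assms(1), of u] graph_on_finite_edges[OF assms(1)] by (simp add: card_Un_disjoint)
  then show ?thesis using card_image[OF inj] by simp
qed

text \<open>The first moment of Merino's theorem. In the contraction step the vertex \<open>u\<close> contributes its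
maximal height, which is its number of neighbours after the deletion; this is the loss of edges
outside the sink plus the gain of edges inside it.\<close>

lemma sum_allowed_heights:
  "graph_on V E \<Longrightarrow> S \<subseteq> V \<Longrightarrow>
   (\<Sum>\<sigma>\<in>allowed V E S. \<Sum>v\<in>V. real_of_int (\<sigma> v)) =
     (real (card {e \<in> E. e \<inter> S = {}}) - real (card {e \<in> E. e \<subseteq> S})) * real (num_trees V E S)
     + real (num_unicyclic V E S)"
proof (induction rule: crossing_induct)
  case (full E)
  have "e \<subseteq> V \<and> e \<inter> V \<noteq> {}" if e: "e \<in> E" for e
  proof -
    obtain a b where "a \<in> V" "b \<in> V" "e = {a, b}" using full e unfolding graph_on_def by meson
    then show ?thesis by auto
  qed
  then have 1: "{e \<in> E. e \<subseteq> V} = E" and 2: "{e \<in> E. e \<inter> V = {}} = {}" by blast+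
  show ?case unfolding 1 2 using full by (simp add: allowed_full)
next
  case (isolated E S)
  then show ?case using allowed_isolated[OF isolated] num_trees_isolated[OF isolated] by simp
next
  case (crossing E S u s)
  let ?E = "E - {{u, s}}"
  let ?M = "\<lambda>\<sigma>. \<Sum>v\<in>V. real_of_int (\<sigma> v)"
  let ?k = "int (card (nbs ?E u))"
  note g = crossing(1)
  have g': "graph_on V ?E" "insert u S \<subseteq> V" using crossing(1-3) by (auto intro: graph_on_subset)
  have finV: "finite V" using g by (rule graph_on_finite_verts)
  note sp = allowed_split[OF crossing(1-5)]
  have fin: "finite (allowed V E S)" by (rule finite_allowed[OF crossing(1,2)])
  have "sum ?M (allowed V E S) = sum ?M {\<sigma> \<in> allowed V E S. \<sigma> u \<noteq> ?k} + sum ?M {\<sigma> \<in> allowed V E S. \<sigma> u = ?k}"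
    by (subst sp(1), rule sum.union_disjoint) (use fin in auto)
  also have "sum ?M {\<sigma> \<in> allowed V E S. \<sigma> u = ?k} = (\<Sum>\<sigma>\<in>allowed V ?E (insert u S). ?M (\<sigma>(u := ?k)))"
    unfolding sp(3) by (simp add: sum.reindex[OF inj_on_fun_upd_allowed])
  also have "\<dots> = (\<Sum>\<sigma>\<in>allowed V ?E (insert u S). ?M \<sigma> + real (card (nbs ?E u)))"
  proof (intro sum.cong refl)
    fix \<sigma> assume "\<sigma> \<in> allowed V ?E (insert u S)"
    then have "\<sigma> u = 0" by (simp add: allowed_def)
    then show "?M (\<sigma>(u := ?k)) = ?M \<sigma> + real (card (nbs ?E u))"
      using crossing(3) finV by (simp add: sum.remove[of V u])
  qed
  also have "\<dots> = sum ?M (allowed V ?E (insert u S))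
       + real (num_trees V ?E (insert u S)) * real (card (nbs ?E u))"
    by (simp add: sum.distrib card_allowed[OF g'])
  finally have M: "sum ?M (allowed V E S) = sum ?M (allowed V ?E S) + sum ?M (allowed V ?E (insert u S))
       + real (num_trees V ?E (insert u S)) * real (card (nbs ?E u))"
    unfolding sp(2) by simp
  have "{e \<in> ?E. e \<subseteq> S} = {e \<in> E. e \<subseteq> S}" "{e \<in> ?E. e \<inter> S = {}} = {e \<in> E. e \<inter> S = {}}"
    using crossing(3,4) by auto
  moreover have "card {e \<in> ?E. e \<inter> S = {}} = card {e \<in> ?E. e \<inter> insert u S = {}} + card (nbs ?E u - S)"
    using card_edges_avoiding[OF g'(1)] crossing(3) by blast
  moreover have "card {e \<in> ?E. e \<subseteq> insert u S} = card {e \<in> ?E. e \<subseteq> S} + card (nbs ?E u \<inter> S)"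
    using card_edges_inside[OF g'(1)] crossing(3) by blast
  moreover have "card (nbs ?E u) = card (nbs ?E u - S) + card (nbs ?E u \<inter> S)"
    using finite_nbs[OF g'(1), of u] by (metis add.commute card_Int_Diff)
  ultimately show ?case
    unfolding M crossing(6,7) num_trees_split[OF crossing(1,3-5)] num_unicyclic_split[OF crossing(1,3-5)]
    by (simp add: algebra_simps)
qed

section \<open>Sandpile dynamics\<close>

locale simple_graph =
  fixes G :: "'a graph"
  assumes graph: "graph_on (verts G) (edges G)"
begin

abbreviation "V \<equiv> verts G"
abbreviation "E \<equiv> edges G"

lemma finite_verts: "finite V"
  using graph by (rule graph_on_finite_verts)

lemma neighbors_eq: "neighbors G v = nbs E v"
  using graph_onD[OF graph, of v] by (auto simp: neighbors_def nbs_def)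

lemma deg_eq: "deg G v = card (nbs E v)"
  by (simp add: deg_def neighbors_eq)

lemma nbs_verts: "w \<in> nbs E v \<Longrightarrow> w \<in> V"
  using nbs_subset[OF graph, of v] by blast

lemma nbs_irrefl: "v \<notin> nbs E v"
  using nbs_subset[OF graph, of v] by blast

lemma finite_neighbours: "finite (nbs E v)"
  by (rule finite_nbs[OF graph])

end

locale sink_graph = simple_graph G for G :: "'a graph" +
  fixes S :: "'a set"
  assumes sink: "S \<subset> verts G"
    and reach: "linked (verts G) S (edges G)"
begin

abbreviation "A \<equiv> verts G - S"

lemma deg_less_card_verts: "v \<in> V \<Longrightarrow> deg G v < card V"
  unfolding deg_eq using psubset_card_mono[of V "nbs E v"] finite_verts nbs_subset[OF graph, of v]
  by blast

text \<open>The distance to the sink has these properties.\<close>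

lemma rank_function:
  obtains d :: "'a \<Rightarrow> nat"
  where "\<And>s. s \<in> S \<Longrightarrow> d s = 0" "\<And>v. v \<in> A \<Longrightarrow> \<exists>w\<in>nbs E v. d w < d v"
proof
  let ?R = "\<lambda>x y. {x, y} \<in> E"
  define d where "d v = (LEAST n. \<exists>s\<in>S. (?R ^^ n) v s)" for v
  show "d s = 0" if "s \<in> S" for s
    unfolding d_def using that by (intro Least_eq_0) auto
  show "\<exists>w\<in>nbs E v. d w < d v" if v: "v \<in> A" for v
  proof -
    have "\<exists>n. \<exists>s\<in>S. (?R ^^ n) v s"
      using reach v rtranclp_imp_relpowp[of ?R v] unfolding linked_def by blast
    then have "\<exists>s\<in>S. (?R ^^ d v) v s"
      unfolding d_def by (rule LeastI_ex)
    then obtain s where s: "s \<in> S" "(?R ^^ d v) v s" by blast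
    then obtain m where m: "d v = Suc m"
      using v by (cases "d v") auto
    then obtain w where w: "{v, w} \<in> E" "(?R ^^ m) w s"
      using relpowp_Suc_D2[of m ?R v s] s(2) by auto
    have "d w \<le> m"
      unfolding d_def by (rule Least_le) (use w s in blast)
    then show ?thesis using w m by (intro bexI[of _ w]) (auto simp: nbs_def)
  qed
qed

lemma escape:
  assumes "W \<subseteq> A" "W \<noteq> {}"
  shows "\<exists>u\<in>W. \<exists>w\<in>nbs E u. w \<notin> W"
proof -
  obtain d :: "'a \<Rightarrow> nat" where d: "\<And>v. v \<in> A \<Longrightarrow> \<exists>w\<in>nbs E v. d w < d v"
    using rank_function by blast
  obtain u where u: "u \<in> W" "\<And>w. w \<in> W \<Longrightarrow> d u \<le> d w"
    using ex_has_least_nat[of "\<lambda>w. w \<in> W" _ d] assms(2) by blast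
  obtain w where "w \<in> nbs E u" "d w < d u" using d[of u] u(1) assms(1) by blast
  then show ?thesis using u by (metis not_less)
qed

subsection \<open>The Laplacian\<close>

definition laplacian :: "('a \<Rightarrow> int) \<Rightarrow> 'a \<Rightarrow> int" where
  "laplacian f v = (\<Sum>w\<in>nbs E v. f v - f w)"

text \<open>With \<open>d\<close> the distance to the sink, the function \<open>B^D - B^(D - d)\<close> works: the neighbour that is
closer to the sink outweighs all others as soon as \<open>B\<close> exceeds the degrees. Toppling decreases the
sum of \<open>f\<close> over the particles, which gives termination, and topplings according to multiples of \<open>f\<close> lead back to every burnable sandpile.\<close>

lemma strictly_superharmonic:
  obtains f :: "'a \<Rightarrow> int"
  where "\<And>v. 0 \<le> f v" "\<And>v. v \<notin> A \<Longrightarrow> f v = 0" "\<And>v. v \<in> A \<Longrightarrow> 1 \<le> laplacian f v"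
proof -
  obtain d :: "'a \<Rightarrow> nat" where d: "\<And>s. s \<in> S \<Longrightarrow> d s = 0" "\<And>v. v \<in> A \<Longrightarrow> \<exists>w\<in>nbs E v. d w < d v"
    using rank_function by blast
  define D where "D = (if V = {} then 0 else Max (d ` V))"
  define B where "B = int (card V) + 1"
  define g where "g v = B ^ (D - d v)" for v
  define f where "f v = (if v \<in> A then B ^ D - g v else 0)" for v
  have B1: "1 \<le> B" by (simp add: B_def)
  have gpos: "1 \<le> g v" for v using B1 by (simp add: g_def)
  have dD: "d v \<le> D" if "v \<in> V" for v
    using that finite_verts by (auto simp: D_def)
  have fV: "f v = B ^ D - g v" if "v \<in> V" for v
    using that d(1) by (auto simp: f_def g_def)
  show ?thesis
  proof
    show "0 \<le> f v" for v
      using power_increasing[of "D - d v" D B] B1 by (auto simp: f_def g_def)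
    show "f v = 0" if "v \<notin> A" for v
      using that unfolding f_def by (rule if_not_P)
    show "1 \<le> laplacian f v" if v: "v \<in> A" for v
    proof -
      obtain w where w: "w \<in> nbs E v" "d w < d v" using d(2)[OF v] by blast
      define j where "j = d v - d w - 1"
      have "D - d w = Suc (D - d v) + j" using w(2) dD[of v] v by (auto simp: j_def)
      then have "g w = B * g v * B ^ j"
        by (simp add: g_def power_add)
      moreover have "B * g v * 1 \<le> B * g v * B ^ j"
        using B1 gpos[of v] by (intro mult_left_mono) auto
      ultimately have gw: "B * g v \<le> g w" by simp
      have "1 * 1 \<le> (B - 1 - int (card (nbs E v - {w}))) * g v"
      proof (rule mult_mono)
        have "card (nbs E v - {w}) < card V"
          using deg_less_card_verts[of v] v card_Diff1_le[of "nbs E v" w] by (simp add: deg_eq)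
        then show "1 \<le> B - 1 - int (card (nbs E v - {w}))" by (simp add: B_def)
        then show "0 \<le> B - 1 - int (card (nbs E v - {w}))" by simp
      qed (use gpos in auto)
      also have "\<dots> = (B * g v - g v) + (\<Sum>x\<in>nbs E v - {w}. - g v)"
        by (simp add: algebra_simps)
      also have "\<dots> \<le> (g w - g v) + (\<Sum>x\<in>nbs E v - {w}. g x - g v)"
        using gw order_trans[OF zero_le_one gpos] by (intro add_mono sum_mono) auto
      also have "\<dots> = (\<Sum>x\<in>nbs E v. g x - g v)"
        using finite_neighbours w(1) by (rule sum.remove[symmetric])
      also have "\<dots> = laplacian f v"
        unfolding laplacian_def using v nbs_verts by (intro sum.cong) (auto simp: fV)
      finally show ?thesis by simp
    qed
  qed
qed

subsection \<open>Toppling\<close>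

abbreviation tp :: "('a \<Rightarrow> int) \<Rightarrow> ('a \<Rightarrow> int) \<Rightarrow> bool" where
  "tp \<equiv> topples_to G S"

definition piles :: "('a \<Rightarrow> int) set" where
  "piles = {\<sigma>. (\<forall>v. v \<notin> A \<longrightarrow> \<sigma> v = 0) \<and> (\<forall>v. 0 \<le> \<sigma> v)}"

lemma topple_eq:
  "topple G S v \<sigma> = (\<lambda>u. \<sigma> u - (if u = v then int (deg G v) else 0) + of_bool (u \<in> nbs E v - S))"
  using nbs_irrefl[of v] by (auto simp: topple_def neighbors_eq fun_eq_iff)

lemma topple_commute: "topple G S u (topple G S v \<sigma>) = topple G S v (topple G S u \<sigma>)"
  by (auto simp: topple_eq fun_eq_iff)

lemma topples_to_piles: "tp \<sigma> \<tau> \<Longrightarrow> \<sigma> \<in> piles \<Longrightarrow> \<tau> \<in> piles"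
  using nbs_verts by (fastforce simp: topples_to_def topple_eq piles_def)

lemma topples_piles: "tp\<^sup>*\<^sup>* \<sigma> \<tau> \<Longrightarrow> \<sigma> \<in> piles \<Longrightarrow> \<tau> \<in> piles"
  by (induction rule: rtranclp_induct) (auto intro: topples_to_piles)

text \<open>A toppling never removes particles from other vertices, so two unstable vertices can be toppled in
either order with the same result. Hence stabilizations are unique.\<close>

lemma strong_confluent_topples: "strong_confluentp tp"
proof
  fix \<sigma> \<tau> \<tau>' assume "tp \<sigma> \<tau>" "tp \<sigma> \<tau>'"
  then obtain v v' where v: "v \<in> A" "int (deg G v) \<le> \<sigma> v" "\<tau> = topple G S v \<sigma>"
    and v': "v' \<in> A" "int (deg G v') \<le> \<sigma> v'" "\<tau>' = topple G S v' \<sigma>"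
    by (auto simp: topples_to_def)
  show "\<exists>\<rho>. tp\<^sup>*\<^sup>* \<tau> \<rho> \<and> tp\<^sup>=\<^sup>= \<tau>' \<rho>"
  proof (cases "v = v'")
    case True
    then show ?thesis using v v' by auto
  next
    case False
    then have "int (deg G v') \<le> \<tau> v'" "int (deg G v) \<le> \<tau>' v"
      using v v' by (auto simp: topple_eq)
    then have "tp \<tau> (topple G S v' \<tau>)" "tp \<tau>' (topple G S v \<tau>')"
      using v v' by (auto simp: topples_to_def)
    moreover have "topple G S v' \<tau> = topple G S v \<tau>'"
      using v v' topple_commute by simp
    ultimately show ?thesis by (intro exI[of _ "topple G S v' \<tau>"]) auto
  qed
qed

lemma stable_normal: "stable G S \<sigma> \<Longrightarrow> tp\<^sup>*\<^sup>* \<sigma> \<tau> \<Longrightarrow> \<tau> = \<sigma>"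
  by (erule converse_rtranclpE) (auto simp: stable_def topples_to_def not_le[symmetric])

lemma stabilization_unique:
  assumes "tp\<^sup>*\<^sup>* \<sigma> \<tau>" "stable G S \<tau>" "tp\<^sup>*\<^sup>* \<sigma> \<tau>'" "stable G S \<tau>'"
  shows "\<tau> = \<tau>'"
proof -
  obtain \<rho> where "tp\<^sup>*\<^sup>* \<tau> \<rho>" "tp\<^sup>*\<^sup>* \<tau>' \<rho>"
    using confluentpD[OF strong_confluentp_imp_confluentp[OF strong_confluent_topples] assms(1,3)] by blast
  then show ?thesis using stable_normal assms(2,4) by metis
qed

lemma stabilization_eqI:
  assumes "tp\<^sup>*\<^sup>* \<sigma> \<tau>" "stable G S \<tau>"
  shows "stabilization G S \<sigma> = \<tau>"
  unfolding stabilization_def using assms stabilization_unique by (intro the_equality) auto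

lemma stabilization_exists:
  assumes "\<sigma> \<in> piles"
  shows "\<exists>\<tau>. tp\<^sup>*\<^sup>* \<sigma> \<tau> \<and> stable G S \<tau>"
proof -
  obtain f :: "'a \<Rightarrow> int" where f: "\<And>v. 0 \<le> f v" "\<And>v. v \<notin> A \<Longrightarrow> f v = 0" "\<And>v. v \<in> A \<Longrightarrow> 1 \<le> laplacian f v"
    using strictly_superharmonic by blast
  define \<Phi> where "\<Phi> \<sigma> = (\<Sum>v\<in>A. \<sigma> v * f v)" for \<sigma> :: "'a \<Rightarrow> int"
  have pos: "0 \<le> \<Phi> \<sigma>" if "\<sigma> \<in> piles" for \<sigma>
    unfolding \<Phi>_def using that f(1) by (intro sum_nonneg) (auto simp: piles_def)
  have dec: "\<Phi> (topple G S v \<sigma>) < \<Phi> \<sigma>" if v: "v \<in> A" for v \<sigma>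
  proof -
    have "\<Phi> (topple G S v \<sigma>) = (\<Sum>u\<in>A. \<sigma> u * f u - (if u = v then int (deg G v) * f v else 0)
        + (if u \<in> nbs E v then f u else 0))"
      unfolding \<Phi>_def topple_eq by (intro sum.cong) (auto simp: algebra_simps)
    also have "\<dots> = \<Phi> \<sigma> - int (deg G v) * f v + (\<Sum>u\<in>A \<inter> nbs E v. f u)"
      using finite_verts v by (simp add: sum.distrib sum_subtractf \<Phi>_def sum.inter_restrict)
    also have "(\<Sum>u\<in>A \<inter> nbs E v. f u) = (\<Sum>u\<in>nbs E v. f u)"
      using f(2) nbs_verts by (intro sum.mono_neutral_left finite_neighbours) auto
    also have "\<Phi> \<sigma> - int (deg G v) * f v + (\<Sum>u\<in>nbs E v. f u) = \<Phi> \<sigma> - laplacian f v"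
      by (simp add: laplacian_def sum_subtractf deg_eq)
    finally show ?thesis using f(3)[OF v] by simp
  qed
  show ?thesis
    using assms
  proof (induction "nat (\<Phi> \<sigma>)" arbitrary: \<sigma> rule: less_induct)
    case less
    show ?case
    proof (cases "stable G S \<sigma>")
      case True
      then show ?thesis by blast
    next
      case False
      then obtain v where v: "v \<in> A" "int (deg G v) \<le> \<sigma> v" by (auto simp: stable_def not_less)
      then have t: "tp \<sigma> (topple G S v \<sigma>)" by (auto simp: topples_to_def)
      then have p: "topple G S v \<sigma> \<in> piles" using less.prems topples_to_piles by blast
      have "nat (\<Phi> (topple G S v \<sigma>)) < nat (\<Phi> \<sigma>)"
        using dec[OF v(1), of \<sigma>] pos[OF p] by simp
      from less.hyps[OF this p] t show ?thesis
        by (meson converse_rtranclp_into_rtranclp)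
    qed
  qed
qed

lemma stabilization:
  assumes "\<sigma> \<in> piles"
  shows "tp\<^sup>*\<^sup>* \<sigma> (stabilization G S \<sigma>)" "stable G S (stabilization G S \<sigma>)"
    "stabilization G S \<sigma> \<in> piles"
  using stabilization_exists[OF assms] stabilization_eqI topples_piles assms by metis+

lemma topples_add:
  assumes "tp\<^sup>*\<^sup>* \<sigma> \<tau>" "\<And>v. 0 \<le> \<eta> v"
  shows "tp\<^sup>*\<^sup>* (\<lambda>v. \<sigma> v + \<eta> v) (\<lambda>v. \<tau> v + \<eta> v)"
  using assms(1)
proof (induction rule: rtranclp_induct)
  case (step \<tau> \<rho>)
  then obtain v where v: "v \<in> A" "int (deg G v) \<le> \<tau> v" "\<rho> = topple G S v \<tau>"
    by (auto simp: topples_to_def)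
  have "topple G S v (\<lambda>v. \<tau> v + \<eta> v) = (\<lambda>u. \<rho> u + \<eta> u)"
    using v by (auto simp: topple_eq)
  moreover have "int (deg G v) \<le> \<tau> v + \<eta> v" using v(2) assms(2)[of v] by simp
  ultimately have "tp (\<lambda>v. \<tau> v + \<eta> v) (\<lambda>v. \<rho> v + \<eta> v)"
    using v(1) unfolding topples_to_def by (intro bexI[of _ v]) auto
  then show ?case using step.IH by (rule rtranclp.rtrancl_into_rtrancl[rotated])
qed simp

subsection \<open>Adding particles\<close>

definition add_at :: "('a \<Rightarrow> int) \<Rightarrow> 'a \<Rightarrow> ('a \<Rightarrow> int)" where
  "add_at \<sigma> x = stabilization G S (\<lambda>v. \<sigma> v + of_bool (v = x))"

lemma states_eq: "sandpile_states G S = {\<sigma> \<in> piles. stable G S \<sigma>}"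
  by (auto simp: sandpile_states_def sandpiles_def piles_def)

lemma add_at_states:
  assumes "\<sigma> \<in> sandpile_states G S" "x \<in> A"
  shows "add_at \<sigma> x \<in> sandpile_states G S"
    and "tp\<^sup>*\<^sup>* (\<lambda>v. \<sigma> v + of_bool (v = x)) (add_at \<sigma> x)"
proof -
  have "(\<lambda>v. \<sigma> v + of_bool (v = x)) \<in> piles"
    using assms by (auto simp: states_eq piles_def)
  from stabilization[OF this] show "add_at \<sigma> x \<in> sandpile_states G S"
    "tp\<^sup>*\<^sup>* (\<lambda>v. \<sigma> v + of_bool (v = x)) (add_at \<sigma> x)"
    by (auto simp: add_at_def states_eq)
qed

lemma foldl_add_at:
  assumes "\<sigma> \<in> sandpile_states G S" "set xs \<subseteq> A"
  shows "foldl add_at \<sigma> xs \<in> sandpile_states G S \<and>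
    tp\<^sup>*\<^sup>* (\<lambda>v. \<sigma> v + int (count_list xs v)) (foldl add_at \<sigma> xs)"
  using assms
proof (induction xs arbitrary: \<sigma>)
  case (Cons x xs)
  then have s: "add_at \<sigma> x \<in> sandpile_states G S" "tp\<^sup>*\<^sup>* (\<lambda>v. \<sigma> v + of_bool (v = x)) (add_at \<sigma> x)"
    using add_at_states by auto
  have "(\<lambda>v. \<sigma> v + int (count_list (x # xs) v)) = (\<lambda>v. (\<sigma> v + of_bool (v = x)) + int (count_list xs v))"
    by auto
  then have "tp\<^sup>*\<^sup>* (\<lambda>v. \<sigma> v + int (count_list (x # xs) v)) (\<lambda>v. add_at \<sigma> x v + int (count_list xs v))"
    using topples_add[OF s(2), of "\<lambda>v. int (count_list xs v)"] by simp
  then show ?case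
    using Cons.IH[OF s(1)] Cons.prems(2) by (auto intro: rtranclp_trans)
qed simp

lemma ex_list_counts:
  assumes "finite B"
  shows "\<exists>xs. set xs \<subseteq> B \<and> (\<forall>v\<in>B. count_list xs v = n v)"
  using assms
proof (induction B)
  case (insert x B)
  then obtain xs where xs: "set xs \<subseteq> B" "\<forall>v\<in>B. count_list xs v = n v" by blast
  have "count_list (replicate k x) v = (if v = x then k else 0)" for k v
    by (induction k) auto
  moreover have "count_list xs x = 0" using xs(1) insert.hyps by (auto simp: count_list_0_iff)
  ultimately show ?case
    using xs insert.hyps by (intro exI[of _ "replicate (n x) x @ xs"]) auto
qed auto

definition reachable :: "('a \<Rightarrow> int) \<Rightarrow> ('a \<Rightarrow> int) \<Rightarrow> bool" where
  "reachable \<sigma> \<tau> \<longleftrightarrow> (\<exists>xs. set xs \<subseteq> A \<and> foldl add_at \<sigma> xs = \<tau>)"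

text \<open>Particles can be added one at a time with stabilization in between, instead of all at once with
one stabilization at the end.\<close>

lemma reachable_if_topples:
  assumes "\<tau> \<in> sandpile_states G S" "\<sigma> \<in> sandpile_states G S"
    and "\<rho> \<in> piles" "\<And>v. \<tau> v \<le> \<rho> v" "tp\<^sup>*\<^sup>* \<rho> \<sigma>"
  shows "reachable \<tau> \<sigma>"
proof -
  obtain xs where xs: "set xs \<subseteq> A" "\<forall>v\<in>A. count_list xs v = nat (\<rho> v - \<tau> v)"
    using ex_list_counts[of A "\<lambda>v. nat (\<rho> v - \<tau> v)"] finite_verts by auto
  have "\<tau> v + int (count_list xs v) = \<rho> v" for v
  proof (cases "v \<in> A")
    case True
    then show ?thesis using xs(2) assms(4)[of v] by simp
  next
    case False
    then have "count_list xs v = 0" using xs(1) by (auto simp: count_list_0_iff)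
    then show ?thesis using False assms(1,3) by (simp add: states_eq piles_def)
  qed
  then have "tp\<^sup>*\<^sup>* \<rho> (foldl add_at \<tau> xs)" "foldl add_at \<tau> xs \<in> sandpile_states G S"
    using foldl_add_at[OF assms(1) xs(1)] by simp_all
  then have "foldl add_at \<tau> xs = \<sigma>"
    using stabilization_unique[OF _ _ assms(5)] assms(2) by (auto simp: states_eq)
  then show ?thesis using xs(1) by (auto simp: reachable_def)
qed

subsection \<open>Burnable sandpiles\<close>

lemma burnable_mono:
  assumes "burnable E A \<sigma>" "\<And>v. \<sigma> v \<le> \<tau> v"
  shows "burnable E A \<tau>"
  using assms unfolding burnable_def by (meson order_trans)

text \<open>For a set \<open>W\<close> containing \<open>v\<close>, a burning vertex of \<open>W - {v}\<close> still burns in \<open>W\<close>: the particle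
that it may have received from \<open>v\<close> makes up for the additional neighbour \<open>v\<close>.\<close>

lemma burnable_topple:
  assumes b: "burnable E A \<sigma>" and v: "int (deg G v) \<le> \<sigma> v"
  shows "burnable E A (topple G S v \<sigma>)"
  unfolding burnable_def
proof (intro allI impI)
  fix W assume W: "W \<subseteq> A \<and> W \<noteq> {}"
  show "\<exists>u\<in>W. int (card (nbs E u \<inter> W)) \<le> topple G S v \<sigma> u"
  proof (cases "W - {v} = {}")
    case True
    then have "W = {v}" using W by blast
    then have "nbs E v \<inter> W = {}" using nbs_irrefl by blast
    then show ?thesis using \<open>W = {v}\<close> v nbs_irrefl by (auto simp: topple_eq)
  next
    case False
    then obtain u where u: "u \<in> W - {v}" "int (card (nbs E u \<inter> (W - {v}))) \<le> \<sigma> u"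
      using b W unfolding burnable_def by (metis Diff_subset subset_trans)
    show ?thesis
    proof (cases "v \<in> W \<and> v \<in> nbs E u")
      case True
      then have "nbs E u \<inter> W = insert v (nbs E u \<inter> (W - {v}))" by blast
      then have "card (nbs E u \<inter> W) = Suc (card (nbs E u \<inter> (W - {v})))"
        using finite_neighbours by simp
      moreover have "u \<in> nbs E v - S" using True u W nbs_sym[of v E u] by blast
      ultimately show ?thesis using u by (intro bexI[of _ u]) (auto simp: topple_eq)
    next
      case False
      then have "nbs E u \<inter> W = nbs E u \<inter> (W - {v})" by blast
      then show ?thesis using u by (intro bexI[of _ u]) (auto simp: topple_eq)
    qed
  qed
qed

lemma burnable_topples: "tp\<^sup>*\<^sup>* \<sigma> \<tau> \<Longrightarrow> burnable E A \<sigma> \<Longrightarrow> burnable E A \<tau>"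
  by (induction rule: rtranclp_induct) (auto simp: topples_to_def intro: burnable_topple)

lemma burnable_add_at:
  assumes "\<sigma> \<in> sandpile_states G S" "x \<in> A" "burnable E A \<sigma>"
  shows "burnable E A (add_at \<sigma> x)"
  using burnable_topples[OF add_at_states(2)[OF assms(1,2)]] burnable_mono[OF assms(3)] by simp

text \<open>The maximal stable sandpile is above every stable sandpile, and it is burnable because each set
without sinks has an edge leaving it.\<close>

lemma reachable_burnable:
  assumes \<tau>: "\<tau> \<in> sandpile_states G S"
  shows "\<exists>\<rho>\<in>sandpile_states G S. burnable E A \<rho> \<and> reachable \<tau> \<rho>"
proof -
  define \<rho> where "\<rho> v = (if v \<in> A then int (deg G v) - 1 else 0)" for v
  have dpos: "1 \<le> deg G v" if "v \<in> A" for v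
  proof -
    have "nbs E v \<noteq> {}" using escape[of "{v}"] that by auto
    then show ?thesis using finite_neighbours[of v] by (simp add: deg_eq Suc_le_eq card_gt_0_iff)
  qed
  have st: "\<rho> \<in> sandpile_states G S"
    using dpos by (force simp: states_eq piles_def stable_def \<rho>_def)
  moreover have "burnable E A \<rho>"
    unfolding burnable_def
  proof (intro allI impI)
    fix W assume W: "W \<subseteq> A \<and> W \<noteq> {}"
    then obtain u w where u: "u \<in> W" "w \<in> nbs E u" "w \<notin> W" using escape[of W] by blast
    then have "nbs E u \<inter> W \<subset> nbs E u" by blast
    then have "card (nbs E u \<inter> W) < deg G u"
      unfolding deg_eq by (rule psubset_card_mono[OF finite_neighbours])
    then show "\<exists>u\<in>W. int (card (nbs E u \<inter> W)) \<le> \<rho> u"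
      using u(1) W by (intro bexI[of _ u]) (auto simp: \<rho>_def)
  qed
  moreover have "reachable \<tau> \<rho>"
  proof (rule reachable_if_topples[OF \<tau> st])
    show "\<rho> \<in> piles" using st by (simp add: states_eq)
    show "\<tau> v \<le> \<rho> v" for v
      using \<tau> by (auto simp: states_eq piles_def stable_def \<rho>_def)
  qed simp
  ultimately show ?thesis by blast
qed

text \<open>The legal toppling sequence in which each \<open>v\<close> topples \<open>k v\<close> times. The set \<open>W\<close> on which the
number of pending topplings is maximal contains a vertex \<open>u\<close> that burns in \<open>W\<close>. At \<open>u\<close> the
Laplacian of \<open>k\<close> is at least the number of neighbours outside \<open>W\<close>, so \<open>u\<close> is unstable and can
topple first. For \<open>k = 1\<close> outside the sink this is Dhar's burning test.\<close>

lemma topples_laplacian: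
  assumes \<sigma>: "burnable E A \<sigma>" and k: "\<And>v. 0 \<le> k v" "\<And>v. v \<notin> A \<Longrightarrow> k v = 0"
  shows "tp\<^sup>*\<^sup>* (\<lambda>v. \<sigma> v + (if v \<in> A then laplacian k v else 0)) \<sigma>"
  using k
proof (induction "nat (\<Sum>v\<in>A. k v)" arbitrary: k rule: less_induct)
  case less
  let ?\<eta> = "\<lambda>k v. \<sigma> v + (if v \<in> A then laplacian k v else 0)"
  show ?case
  proof (cases "\<forall>v\<in>A. k v = 0")
    case True
    then have "k v = 0" for v using less.prems(2) by (cases "v \<in> A") auto
    then have "?\<eta> k = \<sigma>" by (auto simp: laplacian_def)
    then show ?thesis by simp
  next
    case False
    define m where "m = Max (k ` A)"
    define W where "W = {v \<in> A. k v = m}"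
    have finA: "finite (k ` A)" using finite_verts by simp
    have le: "k v \<le> m" if "v \<in> A" for v using that finA by (auto simp: m_def)
    have mpos: "0 < m"
    proof -
      obtain v where "v \<in> A" "k v \<noteq> 0" using False by blast
      then show ?thesis using le[of v] less.prems(1)[of v] by simp
    qed
    have kV: "k v \<le> m" for v using le[of v] less.prems(2)[of v] mpos by (cases "v \<in> A") auto
    have "m \<in> k ` A" unfolding m_def using finA False by (intro Max_in) auto
    then have "W \<subseteq> A" "W \<noteq> {}" by (auto simp: W_def)
    then obtain u where u: "u \<in> W" "int (card (nbs E u \<inter> W)) \<le> \<sigma> u"
      using \<sigma> unfolding burnable_def by blast
    have uA: "u \<in> A" "k u = m" using u(1) by (auto simp: W_def)
    have notW: "k w < m" if "w \<notin> W" for w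
    proof (cases "w \<in> A")
      case True
      then show ?thesis using that kV[of w] by (auto simp: W_def)
    next
      case False
      then show ?thesis using less.prems(2) mpos by auto
    qed
    have "int (deg G u) = int (card (nbs E u \<inter> W)) + int (card (nbs E u - W))"
      unfolding deg_eq using card_Int_Diff[OF finite_neighbours, of u W] by simp
    also have "\<dots> \<le> \<sigma> u + laplacian k u"
    proof -
      have "int (card (nbs E u - W)) = (\<Sum>w\<in>nbs E u. if w \<in> W then 0 else 1)"
        using finite_neighbours[of u] by (simp add: sum.If_cases Diff_eq)
      also have "\<dots> \<le> laplacian k u"
        unfolding laplacian_def
      proof (rule sum_mono)
        fix w assume "w \<in> nbs E u"
        show "(if w \<in> W then 0 else 1) \<le> k u - k w"
          using notW[of w] kV[of w] uA(2) by auto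
      qed
      finally show ?thesis using u(2) by simp
    qed
    finally have unst: "int (deg G u) \<le> ?\<eta> k u" using uA(1) by simp
    define k' where "k' = k(u := k u - 1)"
    have "topple G S u (?\<eta> k) = ?\<eta> k'"
    proof
      fix v
      show "topple G S u (?\<eta> k) v = ?\<eta> k' v"
      proof (cases "v = u")
        case True
        have "laplacian k' u = (\<Sum>w\<in>nbs E u. (k u - k w) - 1)"
          unfolding laplacian_def using nbs_irrefl by (intro sum.cong) (auto simp: k'_def)
        also have "\<dots> = laplacian k u - int (deg G u)"
          by (simp add: sum_subtractf laplacian_def deg_eq)
        finally show ?thesis using True uA(1) nbs_irrefl by (auto simp: topple_eq)
      next
        case False
        have "laplacian k' v = (\<Sum>w\<in>nbs E v. (k v - k w) + of_bool (w = u))"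
          unfolding laplacian_def using False by (intro sum.cong) (auto simp: k'_def)
        also have "\<dots> = laplacian k v + of_bool (v \<in> nbs E u)"
          using finite_neighbours[of v] nbs_sym[of u E v]
          by (simp add: sum.distrib laplacian_def of_bool_def)
        finally show ?thesis using False nbs_verts by (auto simp: topple_eq)
      qed
    qed
    then have "tp (?\<eta> k) (?\<eta> k')"
      using uA(1) unst unfolding topples_to_def by (metis (lifting))
    moreover have "tp\<^sup>*\<^sup>* (?\<eta> k') \<sigma>"
    proof (rule less.hyps)
      have "(\<Sum>v\<in>A. k v) = k u + (\<Sum>v\<in>A - {u}. k v)" "(\<Sum>v\<in>A. k' v) = k' u + (\<Sum>v\<in>A - {u}. k' v)"
        using finite_verts uA(1) by (auto intro!: sum.remove)
      moreover have "(\<Sum>v\<in>A - {u}. k' v) = (\<Sum>v\<in>A - {u}. k v)"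
        by (intro sum.cong) (auto simp: k'_def)
      moreover have "0 \<le> (\<Sum>v\<in>A - {u}. k v)" using less.prems(1) by (intro sum_nonneg) auto
      ultimately show "nat (\<Sum>v\<in>A. k' v) < nat (\<Sum>v\<in>A. k v)"
        using uA(2) mpos by (simp add: k'_def)
      show "0 \<le> k' v" for v using less.prems(1) uA(2) mpos by (auto simp: k'_def)
      show "k' v = 0" if "v \<notin> A" for v using less.prems(2) that uA(1) by (auto simp: k'_def)
    qed
    ultimately show ?thesis by (rule converse_rtranclp_into_rtranclp)
  qed
qed

text \<open>Since the Laplacian of a multiple of a strictly superharmonic function is arbitrarily large, adding
it to \<open>\<sigma>\<close> gives a sandpile above \<open>\<tau>\<close>, which topples to \<open>\<sigma>\<close> by \<open>topples_laplacian\<close>.\<close>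

lemma burnable_reachable:
  assumes \<tau>: "\<tau> \<in> sandpile_states G S" and \<sigma>: "\<sigma> \<in> sandpile_states G S" "burnable E A \<sigma>"
  shows "reachable \<tau> \<sigma>"
proof -
  obtain f :: "'a \<Rightarrow> int" where f: "\<And>v. 0 \<le> f v" "\<And>v. v \<notin> A \<Longrightarrow> f v = 0" "\<And>v. v \<in> A \<Longrightarrow> 1 \<le> laplacian f v"
    using strictly_superharmonic by blast
  \<comment> \<open>Stable heights are less than the number of vertices, so this multiple of \<open>f\<close> is large enough.\<close>
  define k where "k v = int (card V) * f v" for v
  have lap: "int (card V) \<le> laplacian k v" if "v \<in> A" for v
  proof -
    have "laplacian k v = int (card V) * laplacian f v"
      by (simp add: laplacian_def k_def sum_distrib_left right_diff_distrib)
    moreover have "int (card V) * 1 \<le> int (card V) * laplacian f v"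
      using f(3)[OF that] by (intro mult_left_mono) auto
    ultimately show ?thesis by simp
  qed
  have s0: "0 \<le> \<sigma> v" "v \<notin> A \<Longrightarrow> \<sigma> v = 0" for v
    using \<sigma>(1) by (auto simp: states_eq piles_def)
  show ?thesis
  proof (rule reachable_if_topples[OF \<tau> \<sigma>(1)])
    show "tp\<^sup>*\<^sup>* (\<lambda>v. \<sigma> v + (if v \<in> A then laplacian k v else 0)) \<sigma>"
      using f by (intro topples_laplacian[OF \<sigma>(2)]) (auto simp: k_def)
    show "\<tau> v \<le> \<sigma> v + (if v \<in> A then laplacian k v else 0)" for v
    proof (cases "v \<in> A")
      case True
      then have "\<tau> v < int (deg G v)" using \<tau> by (auto simp: states_eq stable_def)
      then show ?thesis using True lap[of v] deg_less_card_verts[of v] s0(1)[of v] by simp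
    next
      case False
      then show ?thesis using \<tau> s0 by (auto simp: states_eq piles_def)
    qed
    show "(\<lambda>v. \<sigma> v + (if v \<in> A then laplacian k v else 0)) \<in> piles"
      using s0 lap by (force simp: piles_def)
  qed
qed

end

section \<open>Recurrence of the sandpile Markov chain\<close>

context sink_graph
begin

abbreviation "U \<equiv> uniform_count_measure A"

lemma finite_nonempty: "finite A" "A \<noteq> {}"
  using finite_verts sink by auto

lemma sequence_space_additions: "sequence_space U"
proof -
  interpret prob_space U
    by (rule prob_space_uniform_count_measure[OF finite_nonempty])
  show ?thesis by unfold_locales
qed

lemma additions_first:
  assumes B: "B \<in> sets (additions G S)"
  shows "measure (additions G S) B =
    (\<Sum>x\<in>A. measure (additions G S) {X \<in> space (additions G S). case_nat x X \<in> B}) / card A"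
proof -
  interpret sequence_space U by (rule sequence_space_additions)
  have P: "additions G S = PiM UNIV (\<lambda>_. U)" by (simp add: additions_def)
  let ?P = "PiM (UNIV :: nat set) (\<lambda>_. U)"
  let ?B = "\<lambda>x. {X \<in> space ?P. case_nat x X \<in> B}"
  have meas: "(\<lambda>(s, \<omega>). case_nat s \<omega>) \<in> U \<Otimes>\<^sub>M ?P \<rightarrow>\<^sub>M ?P"
    by measurable
  have "emeasure ?P B = emeasure (distr (U \<Otimes>\<^sub>M ?P) ?P (\<lambda>(s, \<omega>). case_nat s \<omega>)) B"
    by (simp add: PiM_iter)
  also have "\<dots> = emeasure (U \<Otimes>\<^sub>M ?P) ((\<lambda>(s, \<omega>). case_nat s \<omega>) -` B \<inter> space (U \<Otimes>\<^sub>M ?P))"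
    using B meas by (intro emeasure_distr) (auto simp: P)
  also have "\<dots> = (\<integral>\<^sup>+x. emeasure ?P (Pair x -` ((\<lambda>(s, \<omega>). case_nat s \<omega>) -` B \<inter> space (U \<Otimes>\<^sub>M ?P))) \<partial>U)"
    using B measurable_sets[OF meas] by (intro P.emeasure_pair_measure_alt) (auto simp: P)
  also have "\<dots> = (\<integral>\<^sup>+x. emeasure ?P (?B x) \<partial>U)"
    by (intro nn_integral_cong arg_cong2[where f=emeasure] refl)
      (auto simp: space_pair_measure)
  also have "\<dots> = (\<Sum>x\<in>A. emeasure ?P (?B x) * ennreal (1 / card A))"
    unfolding uniform_count_measure_def using finite_nonempty
    by (subst nn_integral_point_measure_finite) (auto simp: mult.commute)
  also have "\<dots> = (\<Sum>x\<in>A. ennreal (measure ?P (?B x) / card A))"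
    by (simp add: P.emeasure_eq_measure ennreal_mult'[symmetric] ennreal_1[symmetric] del: ennreal_1)
  also have "\<dots> = ennreal ((\<Sum>x\<in>A. measure ?P (?B x)) / card A)"
    by (subst sum_ennreal) (auto simp: sum_divide_distrib)
  finally show ?thesis
    unfolding P P.emeasure_eq_measure by (simp add: sum_nonneg)
qed

lemma chain_shift:
  "sandpile_chain G S \<sigma> (case_nat x X) (Suc k) = sandpile_chain G S (add_at \<sigma> x) X k"
  by (induction k) (simp_all add: add_at_def)

lemma chain_states:
  "\<sigma> \<in> sandpile_states G S \<Longrightarrow> (\<And>i. X i \<in> A) \<Longrightarrow> sandpile_chain G S \<sigma> X k \<in> sandpile_states G S"
  by (induction k) (use add_at_states(1) in \<open>auto simp: add_at_def[symmetric]\<close>)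

lemma space_additions: "X \<in> space (additions G S) \<longleftrightarrow> (\<forall>i. X i \<in> A)"
  by (auto simp: additions_def space_PiM space_uniform_count_measure)

lemma finite_states: "finite (sandpile_states G S)"
proof (rule finite_subset)
  show "sandpile_states G S \<subseteq> {\<sigma>. \<forall>v. (v \<in> A \<longrightarrow> \<sigma> v \<in> {0..<int (card V)}) \<and> (v \<notin> A \<longrightarrow> \<sigma> v = 0)}"
  proof clarify
    fix \<sigma> v assume \<sigma>: "\<sigma> \<in> sandpile_states G S"
    have "\<sigma> v < int (card V)" if "v \<in> A"
      using \<sigma> that deg_less_card_verts[of v] by (force simp: states_eq stable_def)
    then show "(v \<in> A \<longrightarrow> \<sigma> v \<in> {0..<int (card V)}) \<and> (v \<notin> A \<longrightarrow> \<sigma> v = 0)"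
      using \<sigma> by (auto simp: states_eq piles_def)
  qed
  show "finite {\<sigma>. \<forall>v. (v \<in> A \<longrightarrow> \<sigma> v \<in> {0..<int (card V)}) \<and> (v \<notin> A \<longrightarrow> \<sigma> v = 0)}"
    using finite_nonempty by (intro finite_set_of_finite_funs) auto
qed

lemma measurable_chain:
  assumes "\<sigma> \<in> sandpile_states G S"
  shows "(\<lambda>X. sandpile_chain G S \<sigma> X k) \<in> additions G S \<rightarrow>\<^sub>M count_space (sandpile_states G S)"
proof (induction k)
  case 0
  then show ?case using assms by simp
next
  case (Suc k)
  have *: "(\<lambda>X. X k) \<in> additions G S \<rightarrow>\<^sub>M count_space A"
    using measurable_component_singleton[of k UNIV "\<lambda>_. U"]
    by (simp add: additions_def uniform_count_measure_def point_measure_def)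
  have "(\<lambda>X. add_at \<tau> (X k)) \<in> additions G S \<rightarrow>\<^sub>M count_space (sandpile_states G S)"
    if "\<tau> \<in> sandpile_states G S" for \<tau>
    by (rule measurable_compose[OF *]) (use that add_at_states in auto)
  from measurable_compose_countable'[OF this Suc] finite_states show ?case
    by (simp add: add_at_def countable_finite)
qed

text \<open>The probability that the chain started in \<open>\<tau>\<close> never visits \<open>\<sigma>\<close> after time \<open>0\<close>. As a function
of \<open>\<tau>\<close> it is an average over the first step.\<close>

definition no_return :: "('a \<Rightarrow> int) \<Rightarrow> ('a \<Rightarrow> int) \<Rightarrow> real" where
  "no_return \<sigma> \<tau> = measure (additions G S)
     {X \<in> space (additions G S). \<forall>k\<ge>1. sandpile_chain G S \<tau> X k \<noteq> \<sigma>}"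

lemma no_return_sets:
  assumes "\<tau> \<in> sandpile_states G S"
  shows "{X \<in> space (additions G S). \<forall>k\<ge>1. sandpile_chain G S \<tau> X k \<noteq> \<sigma>} \<in> sets (additions G S)"
proof -
  have [measurable]: "Measurable.pred (additions G S) (\<lambda>X. sandpile_chain G S \<tau> X k \<noteq> \<sigma>)" for k
    using measurable_compose[OF measurable_chain[OF assms], of "\<lambda>\<rho>. \<rho> \<noteq> \<sigma>"] by simp
  show ?thesis by measurable
qed

lemma no_return_step:
  assumes "\<tau> \<in> sandpile_states G S"
  shows "no_return \<sigma> \<tau> =
    (\<Sum>x\<in>A. if add_at \<tau> x = \<sigma> then 0 else no_return \<sigma> (add_at \<tau> x)) / card A"
  unfolding no_return_def[of \<sigma> \<tau>] additions_first[OF no_return_sets[OF assms]]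
proof (intro arg_cong2[where f="(/)"] sum.cong refl)
  fix x assume x: "x \<in> A"
  have *: "(\<forall>k\<ge>1. sandpile_chain G S \<tau> (case_nat x X) k \<noteq> \<sigma>) \<longleftrightarrow>
    add_at \<tau> x \<noteq> \<sigma> \<and> (\<forall>k\<ge>1. sandpile_chain G S (add_at \<tau> x) X k \<noteq> \<sigma>)" (is "?L \<longleftrightarrow> ?R") for X
  proof -
    have "?L \<longleftrightarrow> (\<forall>k. sandpile_chain G S \<tau> (case_nat x X) (Suc k) \<noteq> \<sigma>)"
      by (metis One_nat_def Suc_le_D le_add1 plus_1_eq_Suc)
    also have "\<dots> \<longleftrightarrow> (\<forall>k. sandpile_chain G S (add_at \<tau> x) X k \<noteq> \<sigma>)"
      by (simp only: chain_shift)
    also have "\<dots> \<longleftrightarrow> ?R"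
      by (metis One_nat_def Suc_leI not_gr_zero sandpile_chain.simps(1))
    finally show ?thesis .
  qed
  have sp: "case_nat x X \<in> space (additions G S) \<longleftrightarrow> X \<in> space (additions G S)" for X
    using x by (auto simp: space_additions split: nat.split)
  have "{X \<in> space (additions G S). case_nat x X \<in>
      {X \<in> space (additions G S). \<forall>k\<ge>1. sandpile_chain G S \<tau> X k \<noteq> \<sigma>}} =
    (if add_at \<tau> x = \<sigma> then {} else {X \<in> space (additions G S). \<forall>k\<ge>1. sandpile_chain G S (add_at \<tau> x) X k \<noteq> \<sigma>})"
    unfolding mem_Collect_eq sp * by auto
  then show "measure (additions G S) {X \<in> space (additions G S). case_nat x X \<in>
      {X \<in> space (additions G S). \<forall>k\<ge>1. sandpile_chain G S \<tau> X k \<noteq> \<sigma>}} =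
    (if add_at \<tau> x = \<sigma> then 0 else no_return \<sigma> (add_at \<tau> x))"
    by (simp add: no_return_def)
qed

lemma no_return_nonneg: "0 \<le> no_return \<sigma> \<tau>"
  by (simp add: no_return_def)

lemma recurrent_iff_no_return:
  assumes "\<sigma> \<in> sandpile_states G S"
  shows "\<sigma> \<in> recurrent_sandpiles G S \<longleftrightarrow> no_return \<sigma> \<sigma> = 0"
proof -
  interpret sequence_space U by (rule sequence_space_additions)
  have P: "additions G S = PiM UNIV (\<lambda>_. U)" by (simp add: additions_def)
  have "(AE X in additions G S. \<exists>k\<ge>1. sandpile_chain G S \<sigma> X k = \<sigma>) \<longleftrightarrow>
     emeasure (additions G S) {X \<in> space (additions G S). \<not> (\<exists>k\<ge>1. sandpile_chain G S \<sigma> X k = \<sigma>)} = 0"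
  proof (rule AE_iff_measurable)
    show "{X \<in> space (additions G S). \<not> (\<exists>k\<ge>1. sandpile_chain G S \<sigma> X k = \<sigma>)} \<in> sets (additions G S)"
      using no_return_sets[OF assms, of \<sigma>] by (simp only: not_ex de_Morgan_conj not_le imp_conv_disj simp_thms)
  qed rule
  then show ?thesis
    using assms unfolding recurrent_sandpiles_def no_return_def
    by (simp add: P P.emeasure_eq_measure)
qed

lemma reachable_closed:
  assumes "reachable \<tau> \<rho>" "\<tau> \<in> Z" "\<And>\<tau> x. \<tau> \<in> Z \<Longrightarrow> x \<in> A \<Longrightarrow> add_at \<tau> x \<in> Z"
  shows "\<rho> \<in> Z"
proof -
  have "foldl add_at \<tau> xs \<in> Z" if "set xs \<subseteq> A" "\<tau> \<in> Z" for xs \<tau>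
    using that assms(3) by (induction xs arbitrary: \<tau>) auto
  then show ?thesis using assms(1,2) by (auto simp: reachable_def)
qed

text \<open>If the chain started in \<open>\<sigma>\<close> returns almost surely, then by \<open>no_return_step\<close> so does the chain
started in any state reachable from \<open>\<sigma>\<close>. Some burnable state is reachable, but the chain never
leaves the burnable states.\<close>

lemma recurrent_imp_burnable:
  assumes "\<sigma> \<in> recurrent_sandpiles G S"
  shows "burnable E A \<sigma>"
proof (rule ccontr)
  assume nb: "\<not> burnable E A \<sigma>"
  have \<sigma>: "\<sigma> \<in> sandpile_states G S" using assms by (simp add: recurrent_sandpiles_def)
  interpret sequence_space U by (rule sequence_space_additions)
  have P: "additions G S = PiM UNIV (\<lambda>_. U)" by (simp add: additions_def)
  obtain \<rho> where \<rho>: "\<rho> \<in> sandpile_states G S" "burnable E A \<rho>" "reachable \<sigma> \<rho>"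
    using reachable_burnable[OF \<sigma>] by blast
  define Z where "Z = {\<tau> \<in> sandpile_states G S. no_return \<sigma> \<tau> = 0}"
  have "\<rho> \<in> Z"
  proof (rule reachable_closed[OF \<rho>(3)])
    show "\<sigma> \<in> Z" using recurrent_iff_no_return[OF \<sigma>] assms \<sigma> by (simp add: Z_def)
    fix \<tau> x assume \<tau>: "\<tau> \<in> Z" and x: "x \<in> A"
    have "(\<Sum>x\<in>A. if add_at \<tau> x = \<sigma> then 0 else no_return \<sigma> (add_at \<tau> x)) = 0"
      using \<tau> no_return_step[of \<tau> \<sigma>] finite_nonempty by (simp add: Z_def)
    then have "(if add_at \<tau> x = \<sigma> then 0 else no_return \<sigma> (add_at \<tau> x)) = 0"
      using x finite_nonempty no_return_nonneg by (subst (asm) sum_nonneg_eq_0_iff) auto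
    then show "add_at \<tau> x \<in> Z"
      using \<tau> x add_at_states(1)[of \<tau> x] \<open>\<sigma> \<in> Z\<close> by (auto simp: Z_def split: if_splits)
  qed
  moreover have "no_return \<sigma> \<rho> = 1"
  proof -
    have "burnable E A (sandpile_chain G S \<rho> X k)" if "X \<in> space (additions G S)" for X k
      using that chain_states[OF \<rho>(1), of X] burnable_add_at
      by (induction k) (auto simp: space_additions \<rho>(2) add_at_def[symmetric])
    then have "{X \<in> space (additions G S). \<forall>k\<ge>1. sandpile_chain G S \<rho> X k \<noteq> \<sigma>} = space (additions G S)"
      using nb by blast
    then show ?thesis by (simp add: no_return_def P P.prob_space)
  qed
  ultimately show False by (simp add: Z_def)
qed

text \<open>A maximum principle: a positive maximum of \<open>no_return \<sigma>\<close> would propagate to all successors, and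
none of them could be \<open>\<sigma>\<close>, although \<open>\<sigma>\<close> is reachable from everywhere.\<close>

lemma burnable_imp_recurrent:
  assumes \<sigma>: "\<sigma> \<in> sandpile_states G S" and b: "burnable E A \<sigma>"
  shows "\<sigma> \<in> recurrent_sandpiles G S"
proof -
  define m where "m = Max (no_return \<sigma> ` sandpile_states G S)"
  have fin: "finite (no_return \<sigma> ` sandpile_states G S)" using finite_states by simp
  have le: "no_return \<sigma> \<tau> \<le> m" if "\<tau> \<in> sandpile_states G S" for \<tau>
    using that fin by (auto simp: m_def)
  have "m \<le> 0"
  proof (rule ccontr)
    assume m: "\<not> m \<le> 0"
    define W where "W = {\<tau> \<in> sandpile_states G S. no_return \<sigma> \<tau> = m}"
    have "m \<in> no_return \<sigma> ` sandpile_states G S"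
      unfolding m_def using fin \<sigma> by (intro Max_in) auto
    then obtain \<tau> where \<tau>: "\<tau> \<in> W" by (auto simp: W_def)
    have step: "add_at \<tau> x \<in> W \<and> add_at \<tau> x \<noteq> \<sigma>" if \<tau>: "\<tau> \<in> W" and x: "x \<in> A" for \<tau> x
    proof -
      let ?h = "\<lambda>x. if add_at \<tau> x = \<sigma> then 0 else no_return \<sigma> (add_at \<tau> x)"
      have st: "\<tau> \<in> sandpile_states G S" using \<tau> by (simp add: W_def)
      have hm: "?h x \<le> m" if "x \<in> A" for x
        using le[OF add_at_states(1)[OF st that]] m by auto
      have "(\<Sum>x\<in>A. ?h x) = m * card A"
        using no_return_step[OF st, of \<sigma>] \<tau> finite_nonempty by (simp add: W_def field_simps)
      then have "(\<Sum>x\<in>A. m - ?h x) = 0" by (simp add: sum_subtractf)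
      then have "m - ?h x = 0"
        using x finite_nonempty hm by (subst (asm) sum_nonneg_eq_0_iff) auto
      then show ?thesis using m add_at_states(1)[OF st x] by (auto simp: W_def split: if_splits)
    qed
    obtain x where x: "x \<in> A" using finite_nonempty by blast
    have "\<sigma> \<in> W - {\<sigma>}"
    proof (rule reachable_closed)
      show "reachable (add_at \<tau> x) \<sigma>"
        using step[OF \<tau> x] by (intro burnable_reachable[OF _ \<sigma> b]) (simp add: W_def)
    qed (use step \<tau> x in auto)
    then show False by simp
  qed
  then have "no_return \<sigma> \<sigma> = 0" using le[OF \<sigma>] no_return_nonneg[of \<sigma> \<sigma>] by simp
  then show ?thesis using recurrent_iff_no_return[OF \<sigma>] by simp
qed

theorem recurrent_eq_allowed: "recurrent_sandpiles G S = allowed V E S"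
proof -
  have "\<sigma> \<in> allowed V E S \<longleftrightarrow> \<sigma> \<in> sandpile_states G S \<and> burnable E A \<sigma>" for \<sigma>
    by (auto simp: allowed_def states_eq piles_def stable_def deg_eq)
  moreover have "\<sigma> \<in> sandpile_states G S" if "\<sigma> \<in> recurrent_sandpiles G S" for \<sigma>
    using that by (simp add: recurrent_sandpiles_def)
  ultimately show ?thesis
    using recurrent_imp_burnable burnable_imp_recurrent by blast
qed

lemma allowed_nonempty: "allowed V E S \<noteq> {}"
proof -
  have "(\<lambda>_. 0) \<in> piles" by (simp add: piles_def)
  then have "stabilization G S (\<lambda>_. 0) \<in> sandpile_states G S"
    using stabilization by (simp add: states_eq)
  then show ?thesis
    using reachable_burnable burnable_imp_recurrent recurrent_eq_allowed by blast
qed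

lemma num_trees_pos: "0 < num_trees V E S"
  using allowed_nonempty finite_allowed[OF graph] card_allowed[OF graph] sink
  by (metis card_gt_0_iff order_less_imp_le)

lemma sum_expected_heights:
  "(\<Sum>v\<in>A. expected_height G S v) =
    real (card {e \<in> E. e \<inter> S = {}}) - real (card {e \<in> E. e \<subseteq> S})
    + real (num_unicyclic V E S) / real (num_trees V E S)"
proof -
  let ?R = "allowed V E S"
  have sub: "S \<subseteq> V" using sink by blast
  have fin: "finite ?R" "?R \<noteq> {}" using finite_allowed[OF graph sub] allowed_nonempty by auto
  have "(\<Sum>v\<in>A. expected_height G S v) = (\<Sum>v\<in>A. (\<Sum>\<sigma>\<in>?R. real_of_int (\<sigma> v)) / card ?R)"
    using fin by (simp add: expected_height_def recurrent_eq_allowed integral_pmf_of_set)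
  also have "\<dots> = (\<Sum>\<sigma>\<in>?R. \<Sum>v\<in>A. real_of_int (\<sigma> v)) / card ?R"
    by (simp add: sum_divide_distrib[symmetric] sum.swap[of _ ?R])
  also have "(\<Sum>\<sigma>\<in>?R. \<Sum>v\<in>A. real_of_int (\<sigma> v)) = (\<Sum>\<sigma>\<in>?R. \<Sum>v\<in>V. real_of_int (\<sigma> v))"
    using finite_verts by (intro sum.cong refl sum.mono_neutral_left) (auto simp: allowed_def)
  finally show ?thesis
    using num_trees_pos
    unfolding sum_allowed_heights[OF graph sub] card_allowed[OF graph sub]
    by (simp add: field_simps)
qed

end

section \<open>Loop erasure\<close>

text \<open>The indices of the loop erasure increase strictly and stay in range until the last vertex is
reached, so the loop erasure is always finite.\<close>

lemma loop_erasure_index_bounds: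
  assumes "\<And>i. i < j \<Longrightarrow> \<beta> ! loop_erasure_index \<beta> i \<noteq> last \<beta>" "\<beta> \<noteq> []"
  shows "j \<le> loop_erasure_index \<beta> j \<and> loop_erasure_index \<beta> j < length \<beta>"
  using assms(1)
proof (induction j)
  case 0
  then show ?case using assms(2) by simp
next
  case (Suc j)
  let ?k = "loop_erasure_index \<beta> j"
  let ?M = "{i. i < length \<beta> \<and> \<beta> ! i = \<beta> ! ?k}"
  have IH: "j \<le> ?k" "?k < length \<beta>" using Suc by auto
  have "?k \<le> Max ?M" using IH by (intro Max_ge) auto
  moreover have "Max ?M \<in> ?M" using IH by (intro Max_in) auto
  moreover have "Max ?M \<noteq> length \<beta> - 1"
    using \<open>Max ?M \<in> ?M\<close> Suc.prems[of j] assms(2) by (auto simp: last_conv_nth)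
  ultimately have "Suc j \<le> Suc (Max ?M) \<and> Suc (Max ?M) < length \<beta>"
    using IH(1) by (intro conjI) (linarith, simp, linarith)
  then show ?case by simp
qed

lemma loop_erasure_stops:
  assumes "\<beta> \<noteq> []"
  shows "\<exists>J. \<beta> ! loop_erasure_index \<beta> J = last \<beta>"
  using loop_erasure_index_bounds[of "length \<beta>" \<beta>] assms by (metis not_less)

lemma hd_loop_erasure: "\<beta> \<noteq> [] \<Longrightarrow> hd (loop_erasure \<beta>) = hd \<beta>"
  unfolding loop_erasure_def by (subst upt_conv_Cons) (auto simp: hd_conv_nth)

lemma last_loop_erasure: "\<beta> \<noteq> [] \<Longrightarrow> last (loop_erasure \<beta>) = last \<beta>"
  unfolding loop_erasure_def using LeastI_ex[OF loop_erasure_stops] by (simp add: last_map)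

lemma loop_erasure_single: "loop_erasure [v] = [v]"
  unfolding loop_erasure_def by simp

text \<open>Here \<open>\<alpha>\<close> ends with the last visit to the starting point \<open>v\<close>. All later indices of the loop
erasure lie in \<open>\<beta>\<close>, where they are those of \<open>\<beta>\<close>, shifted by the length of \<open>\<alpha>\<close>.\<close>

lemma loop_erasure_append:
  assumes \<alpha>: "\<alpha> \<noteq> []" "hd \<alpha> = v" "last \<alpha> = v" and \<beta>: "\<beta> \<noteq> []" "v \<notin> set \<beta>"
  shows "loop_erasure (\<alpha> @ \<beta>) = v # loop_erasure \<beta>"
proof -
  let ?\<omega> = "\<alpha> @ \<beta>" and ?a = "length \<alpha>"
  let ?i = "loop_erasure_index \<beta>" and ?k = "loop_erasure_index (\<alpha> @ \<beta>)"
  define J where "J = (LEAST J. \<beta> ! ?i J = last \<beta>)"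
  have J: "\<beta> ! ?i J = last \<beta>"
    unfolding J_def by (rule LeastI_ex[OF loop_erasure_stops[OF \<beta>(1)]])
  have less_J: "\<beta> ! ?i j \<noteq> last \<beta>" if "j < J" for j
    using not_less_Least[of j "\<lambda>j. \<beta> ! ?i j = last \<beta>"] that by (simp add: J_def)
  have valid: "?i j < length \<beta>" if "j \<le> J" for j
    using loop_erasure_index_bounds[of j \<beta>] less_J \<beta>(1) that by fastforce
  have \<omega>0: "?\<omega> ! 0 = v" using \<alpha> by (simp add: hd_conv_nth nth_append)
  have shift: "?k (Suc j) = ?a + ?i j" if "j \<le> J" for j
    using that
  proof (induction j)
    case 0
    have "Max {i. i < length ?\<omega> \<and> ?\<omega> ! i = ?\<omega> ! 0} = ?a - 1"
    proof (rule Max_eqI)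
      fix i assume "i \<in> {i. i < length ?\<omega> \<and> ?\<omega> ! i = ?\<omega> ! 0}"
      then have i: "i < ?a + length \<beta>" "?\<omega> ! i = v" using \<omega>0 by auto
      show "i \<le> ?a - 1"
      proof (rule ccontr)
        assume "\<not> i \<le> ?a - 1"
        then have "?a \<le> i" by simp
        then have "\<beta> ! (i - ?a) = v" "i - ?a < length \<beta>" using i by (auto simp: nth_append)
        then show False using \<beta>(2) by (metis nth_mem)
      qed
    next
      have "?\<omega> ! (?a - 1) = v" using \<alpha> by (simp add: nth_append last_conv_nth)
      then show "?a - 1 \<in> {i. i < length ?\<omega> \<and> ?\<omega> ! i = ?\<omega> ! 0}" using \<alpha>(1) \<omega>0 by (cases \<alpha>) auto
    qed auto
    then show ?case using \<alpha>(1) by (cases \<alpha>) auto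
  next
    case (Suc j)
    let ?A = "{i. i < length \<beta> \<and> \<beta> ! i = \<beta> ! ?i j}"
    have ij: "?i j < length \<beta>" using valid Suc.prems by simp
    have eq: "?\<omega> ! ?k (Suc j) = \<beta> ! ?i j"
      using Suc ij by (simp add: nth_append)
    have "Max ?A \<in> ?A" using ij by (intro Max_in) auto
    have "Max {i. i < length ?\<omega> \<and> ?\<omega> ! i = ?\<omega> ! ?k (Suc j)} = ?a + Max ?A"
      unfolding eq
    proof (rule Max_eqI)
      fix i assume i: "i \<in> {i. i < length ?\<omega> \<and> ?\<omega> ! i = \<beta> ! ?i j}"
      show "i \<le> ?a + Max ?A"
      proof (cases "i < ?a")
        case False
        then have "i - ?a \<in> ?A" using i by (auto simp: nth_append)
        then have "i - ?a \<le> Max ?A" by (intro Max_ge) auto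
        then show ?thesis by simp
      qed simp
    next
      show "?a + Max ?A \<in> {i. i < length ?\<omega> \<and> ?\<omega> ! i = \<beta> ! ?i j}"
        using \<open>Max ?A \<in> ?A\<close> by auto
    qed auto
    then show ?case by simp
  qed
  have "(LEAST j. ?\<omega> ! ?k j = last ?\<omega>) = Suc J"
  proof (rule Least_equality)
    show "?\<omega> ! ?k (Suc J) = last ?\<omega>"
      using shift[of J] J \<beta>(1) by (simp add: nth_append del: loop_erasure_index.simps)
    fix j assume j: "?\<omega> ! ?k j = last ?\<omega>"
    show "Suc J \<le> j"
    proof (rule ccontr)
      assume *: "\<not> Suc J \<le> j"
      show False
      proof (cases j)
        case 0
        then have "v = last \<beta>" using j \<omega>0 \<beta>(1) by simp
        then show False using \<beta> by auto
      next
        case (Suc i)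
        then have "\<beta> ! ?i i = last \<beta>"
          using j shift[of i] * \<beta>(1) by (simp add: nth_append del: loop_erasure_index.simps)
        then show False using less_J[of i] * Suc by simp
      qed
    qed
  qed
  then have "loop_erasure ?\<omega> = map (\<lambda>j. ?\<omega> ! ?k j) [0..<Suc (Suc J)]"
    by (simp add: loop_erasure_def)
  also have "\<dots> = ?\<omega> ! ?k 0 # map (\<lambda>j. ?\<omega> ! ?k (Suc j)) [0..<Suc J]"
    by (simp only: upt_conv_Cons[OF zero_less_Suc] map_Suc_upt[symmetric] list.map map_map comp_def)
  also have "map (\<lambda>j. ?\<omega> ! ?k (Suc j)) [0..<Suc J] = map (\<lambda>j. \<beta> ! ?i j) [0..<Suc J]"
  proof (intro map_cong refl)
    fix j assume "j \<in> set [0..<Suc J]"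
    then have "j \<le> J" by auto
    then show "?\<omega> ! ?k (Suc j) = \<beta> ! ?i j"
      using shift[of j] by (simp add: nth_append del: loop_erasure_index.simps)
  qed
  also have "\<dots> = loop_erasure \<beta>"
    by (simp add: loop_erasure_def J_def)
  finally show ?thesis using \<omega>0 by simp
qed

section \<open>Walks stopped at the sink\<close>

definition stopped_walks :: "'a set set \<Rightarrow> 'a set \<Rightarrow> 'a \<Rightarrow> 'a list set" where
  "stopped_walks E S v = {\<omega>. \<omega> \<noteq> [] \<and> hd \<omega> = v \<and> successively (\<lambda>x y. {x, y} \<in> E) \<omega> \<and>
     last \<omega> \<in> S \<and> set (butlast \<omega>) \<inter> S = {}}"

definition loops_at :: "'a set set \<Rightarrow> 'a set \<Rightarrow> 'a \<Rightarrow> 'a list set" where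
  "loops_at E S v = {\<alpha>. \<alpha> \<noteq> [] \<and> hd \<alpha> = v \<and> last \<alpha> = v \<and> successively (\<lambda>x y. {x, y} \<in> E) \<alpha> \<and>
     set \<alpha> \<inter> S = {}}"

text \<open>For a walk this is the probability that the simple random walk follows it. That
consecutive vertices are adjacent is left to the sets of walks over which it is summed.\<close>

fun walk_weight :: "'a set set \<Rightarrow> 'a list \<Rightarrow> real" where
  "walk_weight E (x # y # ys) = walk_weight E (y # ys) / card (nbs E x)"
| "walk_weight E \<omega> = 1"

lemma walk_weight_nonneg: "0 \<le> walk_weight E \<omega>"
  by (induction E \<omega> rule: walk_weight.induct) auto

lemma walk_weight_append:
  "\<alpha> \<noteq> [] \<Longrightarrow> \<beta> \<noteq> [] \<Longrightarrow>
   walk_weight E (\<alpha> @ \<beta>) = walk_weight E \<alpha> / card (nbs E (last \<alpha>)) * walk_weight E \<beta>"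
proof (induction E \<alpha> rule: walk_weight.induct)
  case ("2_2" E x)
  then show ?case by (cases \<beta>) auto
qed auto

lemma stopped_walks_sink: "v \<in> S \<Longrightarrow> stopped_walks E S v = {[v]}"
proof (intro equalityI subsetI)
  fix \<omega> assume *: "v \<in> S" "\<omega> \<in> stopped_walks E S v"
  then show "\<omega> \<in> {[v]}"
    by (cases \<omega>) (auto simp: stopped_walks_def split: if_splits)
qed (auto simp: stopped_walks_def)

lemma stopped_walk_decomp:
  assumes "v \<notin> S" "\<omega> \<in> stopped_walks E S v"
  obtains \<alpha> \<beta> where "\<omega> = \<alpha> @ \<beta>" "\<alpha> \<in> loops_at E S v" "\<beta> \<in> stopped_walks E (insert v S) (hd \<beta>)"
    "hd \<beta> \<in> nbs E v" "last \<beta> \<noteq> v" "v \<notin> set \<beta>" "\<beta> \<noteq> []"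
proof -
  have "v \<in> set \<omega>" using assms(2) by (auto simp: stopped_walks_def)
  then obtain \<alpha>' \<beta> where w: "\<omega> = \<alpha>' @ v # \<beta>" "v \<notin> set \<beta>"
    using split_list_last by metis
  have ne: "\<beta> \<noteq> []"
    using assms w by (auto simp: stopped_walks_def)
  let ?\<alpha> = "\<alpha>' @ [v]"
  have suc: "successively (\<lambda>x y. {x, y} \<in> E) ?\<alpha>" "successively (\<lambda>x y. {x, y} \<in> E) \<beta>" "{v, hd \<beta>} \<in> E"
    using assms(2) w ne by (auto simp: stopped_walks_def successively_append_iff successively_Cons)
  have bl: "butlast \<omega> = ?\<alpha> @ butlast \<beta>" "last \<omega> = last \<beta>" using w ne by (auto simp: butlast_append)
  have "?\<alpha> \<in> loops_at E S v"
    using assms(2) suc bl w by (cases \<alpha>') (auto simp: loops_at_def stopped_walks_def)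
  moreover have "\<beta> \<in> stopped_walks E (insert v S) (hd \<beta>)"
    using assms(2) suc bl w ne by (auto simp: stopped_walks_def dest: in_set_butlastD)
  moreover have "last \<beta> \<noteq> v" using w ne by auto
  ultimately show thesis
    using that[of ?\<alpha> \<beta>] w ne suc by (auto simp: nbs_def)
qed

lemma stopped_walk_append:
  assumes "v \<notin> S" "\<alpha> \<in> loops_at E S v" "\<beta> \<in> stopped_walks E (insert v S) x" "x \<in> nbs E v" "last \<beta> \<noteq> v"
  shows "\<alpha> @ \<beta> \<in> stopped_walks E S v" "v \<notin> set \<beta>" "loop_erasure (\<alpha> @ \<beta>) = v # loop_erasure \<beta>"
    "walk_weight E (\<alpha> @ \<beta>) = walk_weight E \<alpha> / card (nbs E v) * walk_weight E \<beta>"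
proof -
  have ne: "\<beta> \<noteq> []" using assms(3) by (simp add: stopped_walks_def)
  show nv: "v \<notin> set \<beta>"
    using assms(3,5) set_append_last[OF ne] by (auto simp: stopped_walks_def)
  show "\<alpha> @ \<beta> \<in> stopped_walks E S v"
    using assms ne by (auto simp: stopped_walks_def loops_at_def successively_append_iff butlast_append nbs_def)
  show "loop_erasure (\<alpha> @ \<beta>) = v # loop_erasure \<beta>"
    using assms(2) ne nv by (intro loop_erasure_append) (auto simp: loops_at_def)
  show "walk_weight E (\<alpha> @ \<beta>) = walk_weight E \<alpha> / card (nbs E v) * walk_weight E \<beta>"
    using assms(2) ne by (subst walk_weight_append) (auto simp: loops_at_def)
qed

lemma loop_erasure_in_simple_paths:
  assumes "\<omega> \<in> stopped_walks E S v"
  shows "loop_erasure \<omega> \<in> simple_paths E S v"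
  using assms
proof (induction "length \<omega>" arbitrary: \<omega> S v rule: less_induct)
  case less
  show ?case
  proof (cases "v \<in> S")
    case True
    then show ?thesis
      using less.prems by (simp add: stopped_walks_sink simple_paths_sink loop_erasure_single)
  next
    case False
    obtain \<alpha> \<beta> where d: "\<omega> = \<alpha> @ \<beta>" "\<alpha> \<in> loops_at E S v" "\<beta> \<in> stopped_walks E (insert v S) (hd \<beta>)"
      "hd \<beta> \<in> nbs E v" "last \<beta> \<noteq> v" "v \<notin> set \<beta>" "\<beta> \<noteq> []"
      using stopped_walk_decomp[OF False less.prems] by metis
    have "length \<beta> < length \<omega>" using d(1,2) by (auto simp: loops_at_def)
    from less.hyps[OF this d(3)] have "loop_erasure \<beta> \<in> simple_paths E (insert v S) (hd \<beta>)" .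
    moreover have "last (loop_erasure \<beta>) \<noteq> v" using last_loop_erasure[OF d(7)] d(5) by simp
    moreover have "loop_erasure \<omega> = v # loop_erasure \<beta>"
      unfolding d(1) using stopped_walk_append(3)[OF False d(2-5)] .
    ultimately show ?thesis
      unfolding simple_paths_first_step[OF False] using d(4) by blast
  qed
qed

text \<open>The probability that the loop erasure of the walk started at \<open>v\<close> and stopped in \<open>S\<close> is \<open>\<gamma>\<close>,
written as a sum over walks. A sum over lists makes it possible to cut walks into pieces.\<close>

definition erasure_mass :: "'a set set \<Rightarrow> 'a set \<Rightarrow> 'a \<Rightarrow> 'a list \<Rightarrow> ennreal" where
  "erasure_mass E S v \<gamma> =
     (\<integral>\<^sup>+\<omega>. ennreal (walk_weight E \<omega>) \<partial>count_space {\<omega> \<in> stopped_walks E S v. loop_erasure \<omega> = \<gamma>})"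

definition return_mass :: "'a set set \<Rightarrow> 'a set \<Rightarrow> 'a \<Rightarrow> ennreal" where
  "return_mass E S v = (\<integral>\<^sup>+\<alpha>. ennreal (walk_weight E \<alpha> / card (nbs E v)) \<partial>count_space (loops_at E S v))"

lemma nn_integral_count_space_Times:
  "(\<integral>\<^sup>+z. f (fst z) * g (snd z) \<partial>count_space (A \<times> B)) =
    (\<integral>\<^sup>+x. f x \<partial>count_space A) * (\<integral>\<^sup>+y. g y \<partial>count_space B)"
proof -
  have "(\<integral>\<^sup>+z. f (fst z) * g (snd z) \<partial>count_space (A \<times> B)) =
    (\<integral>\<^sup>+z. f (fst z) * g (snd z) * indicator (A \<times> B) z \<partial>count_space UNIV)"
    by (rule nn_integral_count_space_indicator) simp
  also have "\<dots> = (\<integral>\<^sup>+x. \<integral>\<^sup>+y. f x * g y * indicator (A \<times> B) (x, y) \<partial>count_space UNIV \<partial>count_space UNIV)"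
    by (subst nn_integral_fst_count_space[symmetric]) simp
  also have "\<dots> = (\<integral>\<^sup>+x. \<integral>\<^sup>+y. (f x * indicator A x) * (g y * indicator B y) \<partial>count_space UNIV \<partial>count_space UNIV)"
    by (intro nn_integral_cong) (auto simp: indicator_def)
  also have "\<dots> = (\<integral>\<^sup>+x. f x * indicator A x \<partial>count_space UNIV) * (\<integral>\<^sup>+y. g y * indicator B y \<partial>count_space UNIV)"
    by (simp add: nn_integral_cmult nn_integral_multc)
  finally show ?thesis
    by (simp add: nn_integral_count_space_indicator)
qed

text \<open>Last-exit decomposition. A stopped walk is a closed walk at \<open>v\<close>, up to the last visit to \<open>v\<close>,
followed by a walk that starts at a neighbour and never visits \<open>v\<close>, that is, a walk stopped in
\<open>S \<union> {v}\<close> that ends in \<open>S\<close>. The loop erasure of the whole is \<open>v\<close> followed by that of the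
second part.\<close>

lemma erasure_mass_Cons:
  assumes v: "v \<notin> S" and x: "x \<in> nbs E v" and \<gamma>: "\<gamma> \<in> simple_paths E (insert v S) x" "last \<gamma> \<noteq> v"
  shows "erasure_mass E S v (v # \<gamma>) = return_mass E S v * erasure_mass E (insert v S) x \<gamma>"
proof -
  let ?L = "loops_at E S v"
  let ?B = "{\<beta> \<in> stopped_walks E (insert v S) x. loop_erasure \<beta> = \<gamma>}"
  let ?W = "{\<omega> \<in> stopped_walks E S v. loop_erasure \<omega> = v # \<gamma>}"
  have ne: "\<beta> \<noteq> []" "last \<beta> \<noteq> v" if "\<beta> \<in> ?B" for \<beta>
    using that last_loop_erasure[of \<beta>] \<gamma>(2) by (auto simp: stopped_walks_def)
  note app = stopped_walk_append[OF v _ _ x]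
  have "bij_betw (\<lambda>z. fst z @ snd z) (?L \<times> ?B) ?W"
    unfolding bij_betw_def
  proof
    show "inj_on (\<lambda>z. fst z @ snd z) (?L \<times> ?B)"
    proof (rule inj_onI, clarsimp)
      fix \<alpha> \<beta> \<alpha>' \<beta>'
      assume *: "\<alpha> \<in> ?L" "\<alpha>' \<in> ?L" "\<beta> \<in> stopped_walks E (insert v S) x" "\<beta>' \<in> stopped_walks E (insert v S) x"
        "\<gamma> = loop_erasure \<beta>" "loop_erasure \<beta>' = loop_erasure \<beta>" "\<alpha> @ \<beta> = \<alpha>' @ \<beta>'"
      \<comment> \<open>The cut is at the last visit to \<open>v\<close>, which the whole walk determines.\<close>
      have tw: "rev \<beta> = takeWhile (\<lambda>y. y \<noteq> v) (rev (\<alpha> @ \<beta>))"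
        if "\<alpha> \<in> ?L" "v \<notin> set \<beta>" for \<alpha> \<beta>
      proof -
        have "\<alpha> = butlast \<alpha> @ [v]"
          using that(1) append_butlast_last_id[of \<alpha>] by (simp add: loops_at_def)
        from arg_cong[OF this, of rev] have "rev \<alpha> = v # rev (butlast \<alpha>)" by simp
        then show ?thesis unfolding rev_append using that(2) by (simp only:) (simp add: takeWhile_append)
      qed
      have "v \<notin> set \<beta>" "v \<notin> set \<beta>'"
        using app(2)[OF *(1), of \<beta>] app(2)[OF *(2), of \<beta>'] ne * by auto
      then have "rev \<beta> = rev \<beta>'" using tw[OF *(1)] tw[OF *(2)] *(7) by metis
      then show "\<alpha> = \<alpha>' \<and> \<beta> = \<beta>'" using *(7) by simp
    qed
    show "(\<lambda>z. fst z @ snd z) ` (?L \<times> ?B) = ?W"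
    proof (intro equalityI subsetI)
      fix \<omega> assume "\<omega> \<in> (\<lambda>z. fst z @ snd z) ` (?L \<times> ?B)"
      then obtain \<alpha> \<beta> where *: "\<omega> = \<alpha> @ \<beta>" "\<alpha> \<in> ?L" "\<beta> \<in> ?B" by auto
      then show "\<omega> \<in> ?W" using app(1,3)[OF *(2), of \<beta>] ne[OF *(3)] by auto
    next
      fix \<omega> assume \<omega>: "\<omega> \<in> ?W"
      then obtain \<alpha> \<beta> where d: "\<omega> = \<alpha> @ \<beta>" "\<alpha> \<in> loops_at E S v" "\<beta> \<in> stopped_walks E (insert v S) (hd \<beta>)"
        "hd \<beta> \<in> nbs E v" "last \<beta> \<noteq> v" "v \<notin> set \<beta>" "\<beta> \<noteq> []"
        using stopped_walk_decomp[OF v, of \<omega> E] by (metis (lifting) mem_Collect_eq)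
      have "loop_erasure \<beta> = \<gamma>"
        using \<omega> stopped_walk_append(3)[OF v d(2-5)] d(1) by simp
      moreover from this have "hd \<beta> = x"
        using hd_loop_erasure[OF d(7)] \<gamma>(1) by (auto simp: simple_paths_def)
      ultimately show "\<omega> \<in> (\<lambda>z. fst z @ snd z) ` (?L \<times> ?B)"
        using d(1-3) by force
    qed
  qed
  from nn_integral_bij_count_space[OF this, of "\<lambda>\<omega>. ennreal (walk_weight E \<omega>)"]
  have "erasure_mass E S v (v # \<gamma>) =
     (\<integral>\<^sup>+z. ennreal (walk_weight E (fst z @ snd z)) \<partial>count_space (?L \<times> ?B))"
    by (simp add: erasure_mass_def)
  also have "\<dots> = (\<integral>\<^sup>+z. ennreal (walk_weight E (fst z) / card (nbs E v)) * ennreal (walk_weight E (snd z))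
      \<partial>count_space (?L \<times> ?B))"
  proof (rule nn_integral_cong)
    fix z assume "z \<in> space (count_space (?L \<times> ?B))"
    then have z: "fst z \<in> ?L" "snd z \<in> ?B" by auto
    then show "ennreal (walk_weight E (fst z @ snd z)) =
        ennreal (walk_weight E (fst z) / card (nbs E v)) * ennreal (walk_weight E (snd z))"
      using app(4)[OF z(1), of "snd z"] ne[OF z(2)] walk_weight_nonneg[of E "fst z"]
      by (auto simp: ennreal_mult'[symmetric] divide_nonneg_nonneg walk_weight_nonneg)
  qed
  also have "\<dots> = return_mass E S v * erasure_mass E (insert v S) x \<gamma>"
    unfolding return_mass_def erasure_mass_def by (rule nn_integral_count_space_Times)
  finally show ?thesis .
qed

lemma sum_erasure_mass:
  assumes "graph_on V E" "v \<in> V"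
  shows "(\<Sum>\<gamma>\<in>simple_paths E S v. erasure_mass E S v \<gamma>) =
    (\<integral>\<^sup>+\<omega>. ennreal (walk_weight E \<omega>) \<partial>count_space (stopped_walks E S v))"
proof -
  have fin: "finite (simple_paths E S v)" by (rule finite_simple_paths[OF assms])
  have "(\<Sum>\<gamma>\<in>simple_paths E S v. erasure_mass E S v \<gamma>) =
    (\<Sum>\<gamma>\<in>simple_paths E S v. \<integral>\<^sup>+\<omega>. ennreal (walk_weight E \<omega>) *
       indicator {\<omega> \<in> stopped_walks E S v. loop_erasure \<omega> = \<gamma>} \<omega> \<partial>count_space UNIV)"
    by (simp add: erasure_mass_def nn_integral_count_space_indicator)
  also have "\<dots> = (\<integral>\<^sup>+\<omega>. (\<Sum>\<gamma>\<in>simple_paths E S v. ennreal (walk_weight E \<omega>) *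
       indicator {\<omega> \<in> stopped_walks E S v. loop_erasure \<omega> = \<gamma>} \<omega>) \<partial>count_space UNIV)"
    by (subst nn_integral_sum) auto
  also have "\<dots> = (\<integral>\<^sup>+\<omega>. ennreal (walk_weight E \<omega>) * indicator (stopped_walks E S v) \<omega> \<partial>count_space UNIV)"
  proof (rule nn_integral_cong)
    fix \<omega>
    show "(\<Sum>\<gamma>\<in>simple_paths E S v. ennreal (walk_weight E \<omega>) *
       indicator {\<omega> \<in> stopped_walks E S v. loop_erasure \<omega> = \<gamma>} \<omega>) =
       ennreal (walk_weight E \<omega>) * indicator (stopped_walks E S v) \<omega>"
    proof (cases "\<omega> \<in> stopped_walks E S v")
      case True
      then have "(\<Sum>\<gamma>\<in>simple_paths E S v. ennreal (walk_weight E \<omega>) *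
         indicator {\<omega> \<in> stopped_walks E S v. loop_erasure \<omega> = \<gamma>} \<omega>) =
         (\<Sum>\<gamma>\<in>simple_paths E S v. if loop_erasure \<omega> = \<gamma> then ennreal (walk_weight E \<omega>) else 0)"
        by (intro sum.cong) auto
      also have "\<dots> = ennreal (walk_weight E \<omega>)"
        using fin loop_erasure_in_simple_paths[OF True] by simp
      finally show ?thesis using True by simp
    qed simp
  qed
  finally show ?thesis
    by (simp add: nn_integral_count_space_indicator)
qed

section \<open>The law of the loop-erased walk\<close>

locale walk_graph = simple_graph G for G :: "'a graph" +
  assumes nbs_nonempty: "v \<in> verts G \<Longrightarrow> nbs (edges G) v \<noteq> {}"
begin

abbreviation "M \<equiv> (\<lambda>_::nat. count_space V)"

lemma deg_pos: "v \<in> V \<Longrightarrow> 0 < card (nbs E v)"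
  using nbs_nonempty finite_nbs[OF graph] by (simp add: card_gt_0_iff)

lemma Ionescu_Tulcea_G: "v \<in> V \<Longrightarrow> Ionescu_Tulcea (srw_kernel G v) M"
  using nbs_nonempty neighbors_eq by (intro Ionescu_Tulcea_srw finite_verts) auto

lemma sets_srw: "v \<in> V \<Longrightarrow> sets (srw G v) = sets (PiM UNIV M)"
proof -
  assume v: "v \<in> V"
  interpret IT: Ionescu_Tulcea "srw_kernel G v" M by (rule Ionescu_Tulcea_G[OF v])
  show ?thesis by (simp add: srw_def)
qed

lemma space_srw: "v \<in> V \<Longrightarrow> space (srw G v) = {X. \<forall>i. X i \<in> V}"
  using sets_eq_imp_space_eq[OF sets_srw] by (auto simp: space_PiM)

lemma prob_space_srw: "v \<in> V \<Longrightarrow> prob_space (srw G v)"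
proof -
  assume v: "v \<in> V"
  interpret IT: Ionescu_Tulcea "srw_kernel G v" M by (rule Ionescu_Tulcea_G[OF v])
  have "prob_space (distr IT.PF.lim (PiM {} M) (\<lambda>x. restrict x {}))"
    using IT.PF.prob_space_P[of "{}"] by (simp add: IT.distr_lim)
  then have "prob_space IT.PF.lim"
    by (rule prob_space_distrD[rotated]) (simp add: measurable_cong_sets[OF IT.PF.sets_lim refl])
  then show ?thesis by (simp add: srw_def)
qed

text \<open>The first \<open>n\<close> positions are an atom of the law given by the Ionescu-Tulcea construction; each
further position multiplies its mass by one transition probability.\<close>

lemma emeasure_C_walk:
  assumes v: "v \<in> V" and \<omega>: "successively (\<lambda>x y. {x, y} \<in> E) \<omega>" "hd \<omega> = v" and n: "n \<le> length \<omega>"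
  shows "emeasure (Ionescu_Tulcea.C (srw_kernel G v) M 0 n (\<lambda>_. undefined)) {restrict ((!) \<omega>) {0..<n}} =
    ennreal (walk_weight E (take n \<omega>))"
proof -
  interpret IT: Ionescu_Tulcea "srw_kernel G v" M by (rule Ionescu_Tulcea_G[OF v])
  let ?r = "\<lambda>n. restrict ((!) \<omega>) {0..<n}"
  have inV: "set \<omega> \<subseteq> V"
    using successively_in_verts[OF graph \<omega>(1)] \<omega>(2) v by blast
  have \<omega>V: "\<omega> ! i \<in> V" if "i < length \<omega>" for i using that inV by auto
  have r_space: "?r n \<in> space (PiM {0..<n} M)" if "n \<le> length \<omega>" for n
    using that \<omega>V by (auto simp: space_PiM)
  have r_sets: "{?r n} \<in> sets (PiM {0..<n} M)" if "n \<le> length \<omega>" for n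
  proof -
    have "{?r n} = PiE {0..<n} (\<lambda>i. {\<omega> ! i})"
      by (auto simp: PiE_iff extensional_def fun_eq_iff restrict_def)
    moreover have "PiE {0..<n} (\<lambda>i. {\<omega> ! i}) \<in> sets (PiM {0..<n} M)"
      using that \<omega>V by (intro sets_PiM_I_finite) auto
    ultimately show ?thesis by simp
  qed
  have empty_space: "(\<lambda>_. undefined) \<in> space (PiM {0..<0} M)" by (simp add: space_PiM)
  show ?thesis
    using n
  proof (induction n)
    case 0
    have "?r 0 = (\<lambda>_. undefined)" by (auto simp: restrict_def)
    then show ?case using r_sets[of 0] by simp
  next
    case (Suc n)
    let ?C = "IT.C 0 n (\<lambda>_. undefined)"
    have n: "n < length \<omega>" using Suc.prems by simp
    have spC: "space ?C = space (PiM {0..<n} M)" using IT.space_C[OF empty_space, of n] by simp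
    have setC: "sets ?C = sets (PiM {0..<n} M)" using IT.sets_C[OF empty_space, of n] by simp
    have eP: "emeasure (IT.eP n x) {?r (Suc n)} =
        emeasure (srw_kernel G v n (?r n)) {\<omega> ! n} * indicator {?r n} x" if "x \<in> space ?C" for x
    proof -
      have x: "x \<in> space (PiM {0..<n} M)" using that spC by simp
      have xn: "x n = undefined" using x by (auto simp: space_PiM PiE_iff extensional_def)
      have "(\<lambda>y. x(n := y)) -` {?r (Suc n)} \<inter> space (M n) = (if x = ?r n then {\<omega> ! n} else {})"
      proof (cases "x = ?r n")
        case True
        have "x(n := y) = ?r (Suc n) \<longleftrightarrow> y = \<omega> ! n" for y
        proof
          assume "x(n := y) = ?r (Suc n)"
          from fun_cong[OF this, of n] show "y = \<omega> ! n" by simp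
        qed (use True in \<open>auto simp: fun_eq_iff restrict_def\<close>)
        then show ?thesis using \<omega>V[OF n] True by auto
      next
        case False
        have "x(n := y) \<noteq> ?r (Suc n)" for y
        proof
          assume *: "x(n := y) = ?r (Suc n)"
          have "x i = ?r n i" for i
            using fun_cong[OF *, of i] xn by (cases "i = n") (auto simp: restrict_def split: if_splits)
          then show False using False by blast
        qed
        then show ?thesis using False by auto
      qed
      then show ?thesis
        using IT.emeasure_eP[OF x r_sets[OF Suc.prems]] by auto
    qed
    have "emeasure (IT.C 0 (Suc n) (\<lambda>_. undefined)) {?r (Suc n)} =
      (\<integral>\<^sup>+x. emeasure (IT.eP n x) {?r (Suc n)} \<partial>?C)"
    proof -
      have "IT.eP n \<in> ?C \<rightarrow>\<^sub>M subprob_algebra (PiM {0..<Suc n} M)"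
        using IT.measurable_eP[of n] by (simp add: measurable_cong_sets[OF setC refl])
      moreover have "?r n \<in> space ?C" unfolding spC by (rule r_space) (use n in simp)
      then have "space ?C \<noteq> {}" by blast
      ultimately show ?thesis
        using emeasure_bind[of ?C "IT.eP n" "PiM {0..<Suc n} M" "{?r (Suc n)}"] r_sets[OF Suc.prems] by simp
    qed
    also have "\<dots> = (\<integral>\<^sup>+x. emeasure (srw_kernel G v n (?r n)) {\<omega> ! n} * indicator {?r n} x \<partial>?C)"
      by (intro nn_integral_cong eP)
    also have "\<dots> = emeasure (srw_kernel G v n (?r n)) {\<omega> ! n} * emeasure ?C {?r n}"
      using r_sets[of n] n setC by (intro nn_integral_cmult_indicator) simp
    also have "emeasure ?C {?r n} = ennreal (walk_weight E (take n \<omega>))"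
      by (rule Suc.IH) (use n in simp)
    also have "emeasure (srw_kernel G v n (?r n)) {\<omega> ! n} * ennreal (walk_weight E (take n \<omega>)) =
      ennreal (walk_weight E (take (Suc n) \<omega>))"
    proof (cases "n = 0")
      case True
      have "take (Suc 0) \<omega> = [v]" "\<omega> ! 0 = v"
        using n \<omega>(2) by (cases \<omega>; simp)+
      then show ?thesis using True v by (simp add: srw_kernel_def)
    next
      case False
      then have adj: "{\<omega> ! (n - 1), \<omega> ! n} \<in> E"
        using successively_nth[OF \<omega>(1), of "n - 1"] n by simp
      let ?u = "\<omega> ! (n - 1)"
      have "take (Suc n) \<omega> = take n \<omega> @ [\<omega> ! n]" using n by (rule take_Suc_conv_app_nth)
      moreover have ne: "take n \<omega> \<noteq> []" using n False by auto
      moreover have "last (take n \<omega>) = ?u" using last_conv_nth[OF ne] n False by simp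
      ultimately have "walk_weight E (take (Suc n) \<omega>) = walk_weight E (take n \<omega>) / card (nbs E ?u)"
        by (simp add: walk_weight_append)
      moreover have "emeasure (srw_kernel G v n (?r n)) {\<omega> ! n} = ennreal (1 / card (nbs E ?u))"
        using False adj finite_verts \<omega>V[OF n]
        by (simp add: srw_kernel_def emeasure_point_measure_finite neighbors_eq deg_eq nbs_def)
      ultimately show ?thesis
        by (simp add: ennreal_mult'[symmetric])
    qed
    finally show ?case .
  qed
qed

definition cylinder :: "'a list \<Rightarrow> (nat \<Rightarrow> 'a) set" where
  "cylinder \<omega> = {X. (\<forall>i. X i \<in> V) \<and> (\<forall>i<length \<omega>. X i = \<omega> ! i)}"

lemma emeasure_cylinder:
  assumes v: "v \<in> V" and \<omega>: "successively (\<lambda>x y. {x, y} \<in> E) \<omega>" "hd \<omega> = v"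
  shows "cylinder \<omega> \<in> sets (srw G v)" "emeasure (srw G v) (cylinder \<omega>) = ennreal (walk_weight E \<omega>)"
proof -
  interpret IT: Ionescu_Tulcea "srw_kernel G v" M by (rule Ionescu_Tulcea_G[OF v])
  let ?n = "length \<omega>"
  let ?R = "{restrict ((!) \<omega>) {0..<?n}}"
  have \<omega>V: "\<omega> ! i \<in> V" if "i < length \<omega>" for i
    using that successively_in_verts[OF graph \<omega>(1)] \<omega>(2) v by (meson nth_mem subsetD)
  have R: "?R = PiE {0..<?n} (\<lambda>i. {\<omega> ! i})"
    by (auto simp: PiE_iff extensional_def fun_eq_iff restrict_def)
  have R_sets: "?R \<in> sets (PiM {0..<?n} M)"
    unfolding R using \<omega>V by (intro sets_PiM_I_finite) auto
  have "restrict X {0..<?n} = restrict ((!) \<omega>) {0..<?n} \<longleftrightarrow> (\<forall>i<?n. X i = \<omega> ! i)" for X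
  proof
    assume *: "restrict X {0..<?n} = restrict ((!) \<omega>) {0..<?n}"
    show "\<forall>i<?n. X i = \<omega> ! i"
    proof (intro allI impI)
      fix i assume "i < ?n"
      then show "X i = \<omega> ! i" using fun_cong[OF *, of i] by simp
    qed
  qed (auto intro: restrict_ext)
  then have cyl: "cylinder \<omega> = IT.PF.emb UNIV {0..<?n} ?R"
    by (auto simp: cylinder_def prod_emb_def space_PiM)
  show "cylinder \<omega> \<in> sets (srw G v)"
    unfolding cyl sets_srw[OF v] using R_sets by (intro measurable_prod_emb) auto
  have "emeasure (srw G v) (cylinder \<omega>) = emeasure (IT.CI {0..<?n}) ?R"
    unfolding cyl srw_def by (rule IT.lim[OF _ R_sets]) simp
  also have "\<dots> = emeasure (IT.C 0 ?n (\<lambda>_. undefined)) (IT.PF.emb {0..<?n} {0..<?n} ?R)"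
    by (rule IT.emeasure_CI[OF order_refl R_sets])
  also have "IT.PF.emb {0..<?n} {0..<?n} ?R = ?R"
    using sets.sets_into_space[OF R_sets] by (intro prod_emb_id) (simp add: space_PiM)
  finally show "emeasure (srw G v) (cylinder \<omega>) = ennreal (walk_weight E \<omega>)"
    using emeasure_C_walk[OF v \<omega> order_refl] by simp
qed

lemma stopped_path_cylinder:
  assumes "\<omega> \<in> stopped_walks E S v" "X \<in> cylinder \<omega>"
  shows "stopped_path S X = \<omega>"
proof -
  have ne: "\<omega> \<noteq> []" using assms(1) by (simp add: stopped_walks_def)
  have "(LEAST k. X k \<in> S) = length \<omega> - 1"
  proof (rule Least_equality)
    show "X (length \<omega> - 1) \<in> S"
      using assms ne by (auto simp: cylinder_def stopped_walks_def last_conv_nth)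
    fix k assume k: "X k \<in> S"
    show "length \<omega> - 1 \<le> k"
    proof (rule ccontr)
      assume "\<not> length \<omega> - 1 \<le> k"
      then have "k < length (butlast \<omega>)" "X k = butlast \<omega> ! k"
        using assms(2) by (auto simp: cylinder_def nth_butlast)
      then have "X k \<in> set (butlast \<omega>)" by (metis nth_mem)
      then show False using assms(1) k by (auto simp: stopped_walks_def)
    qed
  qed
  then have "stopped_path S X = map X [0..<length \<omega>]"
    using ne by (simp add: stopped_path_def)
  also have "\<dots> = map ((!) \<omega>) [0..<length \<omega>]"
    using assms(2) by (intro map_cong) (auto simp: cylinder_def)
  finally show ?thesis by (simp add: map_nth)
qed

lemma countable_stopped_walks:
  assumes "v \<in> V"
  shows "countable (stopped_walks E S v)"
proof (rule countable_subset)
  show "stopped_walks E S v \<subseteq> lists V"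
    using successively_in_verts[OF graph] assms by (fastforce simp: stopped_walks_def)
  show "countable (lists V)" using finite_verts by (intro countable_lists countable_finite)
qed

lemma emeasure_stopped_walks:
  assumes v: "v \<in> V" and K: "K \<subseteq> stopped_walks E S v"
  shows "(\<Union>\<omega>\<in>K. cylinder \<omega>) \<in> sets (srw G v)"
    "emeasure (srw G v) (\<Union>\<omega>\<in>K. cylinder \<omega>) = (\<integral>\<^sup>+\<omega>. ennreal (walk_weight E \<omega>) \<partial>count_space K)"
proof -
  have cK: "countable K" using countable_subset[OF K countable_stopped_walks[OF v]] .
  have cyl: "cylinder \<omega> \<in> sets (srw G v)" "emeasure (srw G v) (cylinder \<omega>) = ennreal (walk_weight E \<omega>)"
    if "\<omega> \<in> K" for \<omega>
    using emeasure_cylinder[OF v, of \<omega>] that K by (auto simp: stopped_walks_def)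
  show "(\<Union>\<omega>\<in>K. cylinder \<omega>) \<in> sets (srw G v)"
    using cK cyl(1) by (intro sets.countable_UN') auto
  have "disjoint_family_on cylinder K"
    unfolding disjoint_family_on_def
  proof (intro ballI impI)
    fix \<omega> \<omega>' assume *: "\<omega> \<in> K" "\<omega>' \<in> K" "\<omega> \<noteq> \<omega>'"
    have "\<omega> = \<omega>'" if "X \<in> cylinder \<omega>" "X \<in> cylinder \<omega>'" for X
      using stopped_path_cylinder[OF subsetD[OF K *(1)] that(1)]
        stopped_path_cylinder[OF subsetD[OF K *(2)] that(2)] by simp
    then show "cylinder \<omega> \<inter> cylinder \<omega>' = {}" using *(3) by blast
  qed
  then have "emeasure (srw G v) (\<Union>\<omega>\<in>K. cylinder \<omega>) = (\<integral>\<^sup>+\<omega>. emeasure (srw G v) (cylinder \<omega>) \<partial>count_space K)"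
    using cyl(1) cK by (intro emeasure_UN_countable)
  also have "\<dots> = (\<integral>\<^sup>+\<omega>. ennreal (walk_weight E \<omega>) \<partial>count_space K)"
    using cyl(2) by (intro nn_integral_cong) simp
  finally show "emeasure (srw G v) (\<Union>\<omega>\<in>K. cylinder \<omega>) = (\<integral>\<^sup>+\<omega>. ennreal (walk_weight E \<omega>) \<partial>count_space K)" .
qed

text \<open>The probability of ever visiting \<open>S\<close>.\<close>

definition hit_mass :: "'a set \<Rightarrow> 'a \<Rightarrow> ennreal" where
  "hit_mass S v = (\<integral>\<^sup>+\<omega>. ennreal (walk_weight E \<omega>) \<partial>count_space (stopped_walks E S v))"

lemma hit_mass_le_1: "v \<in> V \<Longrightarrow> hit_mass S v \<le> 1"
  unfolding hit_mass_def using emeasure_stopped_walks(2)[OF _ order_refl, of v S]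
    prob_space.emeasure_le_1[OF prob_space_srw] by metis

lemma stopped_walks_Cons:
  assumes "v \<notin> S"
  shows "stopped_walks E S v = (\<Union>x\<in>nbs E v. (#) v ` stopped_walks E S x)"
proof (intro equalityI subsetI)
  fix \<omega> assume w: "\<omega> \<in> stopped_walks E S v"
  then obtain \<omega>' where \<omega>': "\<omega> = v # \<omega>'" by (cases \<omega>) (auto simp: stopped_walks_def)
  have ne: "\<omega>' \<noteq> []" using w \<omega>' assms by (auto simp: stopped_walks_def)
  have "hd \<omega>' \<in> nbs E v" "\<omega>' \<in> stopped_walks E S (hd \<omega>')"
    using w \<omega>' ne by (auto simp: stopped_walks_def successively_Cons nbs_def)
  then show "\<omega> \<in> (\<Union>x\<in>nbs E v. (#) v ` stopped_walks E S x)" using \<omega>' by blast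
qed (use assms in \<open>auto simp: stopped_walks_def successively_Cons nbs_def\<close>)

lemma hit_mass_step:
  assumes "v \<in> V - S"
  shows "hit_mass S v = (\<Sum>x\<in>nbs E v. hit_mass S x) * ennreal (1 / card (nbs E v))"
proof -
  let ?w = "\<lambda>\<omega>. ennreal (walk_weight E \<omega>)"
  have fin: "finite (nbs E v)" by (rule finite_nbs[OF graph])
  have "hit_mass S v = (\<integral>\<^sup>+\<omega>. ?w \<omega> * indicator (stopped_walks E S v) \<omega> \<partial>count_space UNIV)"
    unfolding hit_mass_def by (simp add: nn_integral_count_space_indicator)
  also have "\<dots> = (\<integral>\<^sup>+\<omega>. (\<Sum>x\<in>nbs E v. ?w \<omega> * indicator ((#) v ` stopped_walks E S x) \<omega>) \<partial>count_space UNIV)"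
  proof (rule nn_integral_cong)
    fix \<omega> :: "'a list"
    have dis: "disjoint_family_on (\<lambda>x. (#) v ` stopped_walks E S x) (nbs E v)"
      by (auto simp: disjoint_family_on_def stopped_walks_def)
    have "stopped_walks E S v = (\<Union>x\<in>nbs E v. (#) v ` stopped_walks E S x)"
      using assms by (intro stopped_walks_Cons) simp
    then show "?w \<omega> * indicator (stopped_walks E S v) \<omega> =
       (\<Sum>x\<in>nbs E v. ?w \<omega> * indicator ((#) v ` stopped_walks E S x) \<omega>)"
      by (simp add: sum_distrib_left[symmetric] indicator_UN_disjoint[OF fin dis])
  qed
  also have "\<dots> = (\<Sum>x\<in>nbs E v. \<integral>\<^sup>+\<omega>. ?w \<omega> * indicator ((#) v ` stopped_walks E S x) \<omega> \<partial>count_space UNIV)"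
    by (subst nn_integral_sum) auto
  also have "\<dots> = (\<Sum>x\<in>nbs E v. hit_mass S x * ennreal (1 / card (nbs E v)))"
  proof (intro sum.cong refl)
    fix x assume x: "x \<in> nbs E v"
    have "(\<integral>\<^sup>+\<omega>. ?w \<omega> * indicator ((#) v ` stopped_walks E S x) \<omega> \<partial>count_space UNIV) =
      (\<integral>\<^sup>+\<omega>. ?w \<omega> \<partial>count_space ((#) v ` stopped_walks E S x))"
      by (simp add: nn_integral_count_space_indicator)
    also have "\<dots> = (\<integral>\<^sup>+\<omega>. ?w (v # \<omega>) \<partial>count_space (stopped_walks E S x))"
      by (rule nn_integral_bij_count_space[symmetric]) (auto simp: bij_betw_def)
    also have "\<dots> = (\<integral>\<^sup>+\<omega>. ?w \<omega> * ennreal (1 / card (nbs E v)) \<partial>count_space (stopped_walks E S x))"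
    proof (rule nn_integral_cong)
      fix \<omega> assume "\<omega> \<in> space (count_space (stopped_walks E S x))"
      then have "\<omega> \<noteq> []" by (simp add: stopped_walks_def)
      then show "?w (v # \<omega>) = ?w \<omega> * ennreal (1 / card (nbs E v))"
        by (cases \<omega>) (auto simp: ennreal_mult''[symmetric])
    qed
    finally show "(\<integral>\<^sup>+\<omega>. ?w \<omega> * indicator ((#) v ` stopped_walks E S x) \<omega> \<partial>count_space UNIV) =
      hit_mass S x * ennreal (1 / card (nbs E v))"
      by (simp add: hit_mass_def nn_integral_multc)
  qed
  finally show ?thesis by (simp add: sum_distrib_right)
qed

text \<open>The probability of not visiting \<open>S\<close> is harmonic outside \<open>S\<close> and vanishes on \<open>S\<close>. The set where
it is maximal would have no edge leaving it if the maximum were positive.\<close>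

lemma hit_mass_eq_1:
  assumes S: "S \<subset> V" and L: "linked V S E" and v: "v \<in> V"
  shows "hit_mass S v = 1"
proof -
  have sg: "sink_graph G S"
    by unfold_locales (use S L in auto)
  define a where "a v = 1 - enn2real (hit_mass S v)" for v
  have fin: "hit_mass S v = ennreal (1 - a v)" "0 \<le> a v" "a v \<le> 1" if "v \<in> V" for v
  proof -
    have "hit_mass S v \<noteq> \<top>" using hit_mass_le_1[OF that, of S] by (auto simp: top_unique)
    then show "hit_mass S v = ennreal (1 - a v)" by (simp add: a_def less_top)
    have "enn2real (hit_mass S v) \<le> enn2real 1"
      using hit_mass_le_1[OF that, of S] by (intro enn2real_mono) auto
    then show "0 \<le> a v" "a v \<le> 1" by (auto simp: a_def)
  qed
  have step: "(\<Sum>x\<in>nbs E v. a v - a x) = 0" if "v \<in> V - S" for v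
  proof -
    have v: "v \<in> V" using that by simp
    have "ennreal (1 - a v) = (\<Sum>x\<in>nbs E v. ennreal (1 - a x)) * ennreal (1 / card (nbs E v))"
      using hit_mass_step[OF that] fin(1)[OF v] fin(1)[OF nbs_verts] by (simp cong: sum.cong)
    also have "\<dots> = ennreal ((\<Sum>x\<in>nbs E v. 1 - a x) * (1 / card (nbs E v)))"
      using fin(3)[OF nbs_verts] by (subst sum_ennreal) (auto simp: ennreal_mult''[symmetric])
    finally have "1 - a v = (\<Sum>x\<in>nbs E v. 1 - a x) * (1 / card (nbs E v))"
      using fin(3)[OF v] fin(3)[OF nbs_verts] by (subst (asm) ennreal_inj) (auto intro!: divide_nonneg_nonneg sum_nonneg)
    then have "(1 - a v) * card (nbs E v) = (\<Sum>x\<in>nbs E v. 1 - a x)"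
      using deg_pos[OF v] by (simp add: field_simps)
    then show ?thesis by (simp add: sum_subtractf algebra_simps)
  qed
  have S0: "a s = 0" if "s \<in> S" for s
    using that by (simp add: a_def hit_mass_def stopped_walks_sink nn_integral_count_space_finite)
  define m where "m = Max (a ` V)"
  have finV: "finite (a ` V)" using finite_verts by simp
  have le: "a x \<le> m" if "x \<in> V" for x using that finV by (auto simp: m_def)
  have "m \<le> 0"
  proof (rule ccontr)
    assume m: "\<not> m \<le> 0"
    define W where "W = {x \<in> V. a x = m}"
    have "m \<in> a ` V" unfolding m_def using finV v by (intro Max_in) auto
    then have "W \<noteq> {}" by (auto simp: W_def)
    moreover have "W \<subseteq> V - S" using S0 m by (auto simp: W_def)
    ultimately obtain u w where u: "u \<in> W" "w \<in> nbs E u" "w \<notin> W" using sink_graph.escape[OF sg, of W] by blast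
    have "0 \<le> a u - a x" if "x \<in> nbs E u" for x
      using le[OF nbs_verts[OF that]] u(1) by (simp add: W_def)
    then have "\<forall>x\<in>nbs E u. a u - a x = 0"
      using step[of u] u(1) \<open>W \<subseteq> V - S\<close> finite_nbs[OF graph, of u]
      by (subst sum_nonneg_eq_0_iff[symmetric]) auto
    then have "a u - a w = 0" using u(2) by blast
    then show False using u nbs_verts by (auto simp: W_def)
  qed
  then have "a v = 0" using le[OF v] fin(2)[OF v] by simp
  then show ?thesis using fin(1)[OF v] by simp
qed

lemma num_trees_linked_pos:
  assumes "S \<subseteq> V" "linked V S E"
  shows "0 < num_trees V E S"
proof (cases "S = V")
  case True
  then show ?thesis using graph by simp
next
  case False
  have "sink_graph G S"
    by unfold_locales (use assms False in auto)
  then show ?thesis by (rule sink_graph.num_trees_pos)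
qed

text \<open>By the last-exit decomposition and induction on the size of the complement of the sink, the masses
of the paths from \<open>v\<close> are a common factor times the numbers \<open>T(S \<union> \<gamma>) / T(S \<union> {v})\<close>. The
factor, which is the Green's function at \<open>v\<close> divided by the degree, is found from the total mass
\<open>1\<close> and \<open>num_trees_path_sum\<close>.\<close>

lemma erasure_mass_eq:
  assumes "S \<subseteq> V" "linked V S E" "v \<in> V" "\<gamma> \<in> simple_paths E S v"
  shows "erasure_mass E S v \<gamma> = ennreal (num_trees V E (S \<union> set \<gamma>) / num_trees V E S)"
  using assms
proof (induction "card (V - S)" arbitrary: S v \<gamma> rule: less_induct)
  case less
  let ?T = "\<lambda>S. real (num_trees V E S)"
  show ?case
  proof (cases "v \<in> S")
    case True
    then have \<gamma>: "\<gamma> = [v]" using less.prems by (simp add: simple_paths_sink)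
    have "{\<omega> \<in> stopped_walks E S v. loop_erasure \<omega> = \<gamma>} = {[v]}"
      using True \<gamma> by (auto simp: stopped_walks_sink loop_erasure_single)
    then have "erasure_mass E S v \<gamma> = 1"
      by (simp add: erasure_mass_def nn_integral_count_space_finite)
    then show ?thesis
      using num_trees_linked_pos[OF less.prems(1,2)] True \<gamma> by (simp add: insert_absorb)
  next
    case False
    let ?S = "insert v S"
    have vS: "v \<in> V - S" using False less.prems by simp
    have "V - ?S \<subset> V - S" using vS by blast
    then have "card (V - ?S) < card (V - S)" using finite_verts by (intro psubset_card_mono) auto
    moreover have "?S \<subseteq> V" using less.prems by blast
    moreover have "linked V ?S E" using linked_mono[OF less.prems(2), of ?S] by blast
    ultimately have S': "?S \<subseteq> V" "linked V ?S E" "card (V - ?S) < card (V - S)" by auto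
    have SV: "S \<subset> V" using vS less.prems by blast
    define g where "g = return_mass E S v"
    have pos: "0 < ?T S" "0 < ?T ?S"
      using num_trees_linked_pos less.prems(1,2) S' by simp_all
    have mass: "erasure_mass E S v (v # \<gamma>') = g * ennreal (?T (?S \<union> set \<gamma>') / ?T ?S)"
      if "x \<in> nbs E v" "\<gamma>' \<in> simple_paths E ?S x" "last \<gamma>' \<noteq> v" for x \<gamma>'
      unfolding g_def erasure_mass_Cons[OF False that]
      using less.hyps[OF S'(3,1,2) nbs_verts[OF that(1)] that(2)] by simp
    have "1 = (\<Sum>\<gamma>\<in>simple_paths E S v. erasure_mass E S v \<gamma>)"
      using sum_erasure_mass[OF graph less.prems(3), of S] hit_mass_eq_1[OF SV less.prems(2,3)]
      by (simp add: hit_mass_def)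
    also have "\<dots> = (\<Sum>x\<in>nbs E v. \<Sum>\<gamma>' | \<gamma>' \<in> simple_paths E ?S x \<and> last \<gamma>' \<noteq> v.
        erasure_mass E S v (v # \<gamma>'))"
      by (rule path_sum_first_step[OF graph vS])
    also have "\<dots> = (\<Sum>x\<in>nbs E v. \<Sum>\<gamma>' | \<gamma>' \<in> simple_paths E ?S x \<and> last \<gamma>' \<noteq> v.
        g * ennreal (?T (?S \<union> set \<gamma>') / ?T ?S))"
      by (intro sum.cong refl mass) auto
    also have "\<dots> = g * ennreal (?T S / ?T ?S)"
      unfolding num_trees_path_sum_first_step[OF graph less.prems(1) vS]
      by (simp add: sum_distrib_left[symmetric] sum_divide_distrib sum_ennreal sum_nonneg)
    \<comment> \<open>The total mass of the loop erasures determines the unknown factor \<open>g\<close>.\<close>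
    finally have "g * ennreal (?T S / ?T ?S) = 1" by simp
    then have "g * ennreal (?T S / ?T ?S) * ennreal (?T ?S / ?T S) = ennreal (?T ?S / ?T S)" by simp
    then have g: "g = ennreal (?T ?S / ?T S)"
      using pos by (simp add: mult.assoc ennreal_mult'[symmetric])
    have "\<gamma> \<in> (\<Union>x\<in>nbs E v. (#) v ` {\<gamma> \<in> simple_paths E ?S x. last \<gamma> \<noteq> v})"
      using less.prems(4) unfolding simple_paths_first_step[OF False] .
    then obtain x \<gamma>' where \<gamma>': "x \<in> nbs E v" "\<gamma>' \<in> simple_paths E ?S x" "last \<gamma>' \<noteq> v" "\<gamma> = v # \<gamma>'"
      by blast
    have "S \<union> set \<gamma> = ?S \<union> set \<gamma>'" using \<gamma>'(4) by auto
    then show ?thesis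
      unfolding \<gamma>'(4) mass[OF \<gamma>'(1-3)] g using pos
      by (simp add: ennreal_mult'[symmetric])
  qed
qed

lemma measurable_stopped_path:
  assumes v: "v \<in> V"
  shows "stopped_path S \<in> srw G v \<rightarrow>\<^sub>M count_space (lists V)"
proof -
  have comp: "(\<lambda>X. X i) \<in> srw G v \<rightarrow>\<^sub>M count_space V" for i
    using measurable_component_singleton[of i UNIV M] by (simp add: measurable_cong_sets[OF sets_srw[OF v] refl])
  have [measurable]: "Measurable.pred (srw G v) (\<lambda>X. X i \<in> B)" for i B
    by (rule measurable_compose[OF comp]) simp
  have map_eq: "map X [0..<m] = l \<longleftrightarrow> length l = m \<and> (\<forall>i<length l. X i \<in> {l ! i})"
    for X :: "nat \<Rightarrow> 'a" and l m
    unfolding list_eq_iff_nth_eq by (auto simp del: upt_Suc)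
  have eq: "stopped_path S X = l \<longleftrightarrow> length l = Suc (LEAST k. X k \<in> S) \<and> (\<forall>i<length l. X i \<in> {l ! i})" for X l
    unfolding stopped_path_def by (rule map_eq)
  have "stopped_path S -` {l} \<inter> space (srw G v) \<in> sets (srw G v)" for l
  proof -
    have "{X \<in> space (srw G v). length l = Suc (LEAST k. X k \<in> S) \<and> (\<forall>i<length l. X i \<in> {l ! i})} \<in> sets (srw G v)"
      by measurable
    then show ?thesis unfolding eq[symmetric] by (simp add: vimage_def Int_def conj_commute)
  qed
  moreover have "stopped_path S X \<in> lists V" if "X \<in> space (srw G v)" for X
    using that by (auto simp: stopped_path_def space_srw[OF v])
  moreover have "countable (lists V)" using finite_verts by (intro countable_lists countable_finite)
  ultimately show ?thesis by (simp add: measurable_count_space_eq_countable)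
qed

lemma expectation_loop_erasure:
  fixes f :: "'a list \<Rightarrow> real"
  assumes S: "S \<subset> V" and L: "linked V S E" and v: "v \<in> V"
  shows "(\<integral>X. f (loop_erasure (stopped_path S X)) \<partial>srw G v) =
    (\<Sum>\<gamma>\<in>simple_paths E S v. f \<gamma> * (num_trees V E (S \<union> set \<gamma>) / num_trees V E S))"
proof -
  interpret prob_space "srw G v" by (rule prob_space_srw[OF v])
  let ?K = "\<lambda>\<gamma>. {\<omega> \<in> stopped_walks E S v. loop_erasure \<omega> = \<gamma>}"
  let ?H = "\<lambda>\<gamma>. \<Union>\<omega>\<in>?K \<gamma>. cylinder \<omega>"
  have fin: "finite (simple_paths E S v)" by (rule finite_simple_paths[OF graph v])
  have H_sets[measurable]: "?H \<gamma> \<in> sets (srw G v)" for \<gamma>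
    by (rule emeasure_stopped_walks(1)[OF v]) auto
  have H_prob: "measure (srw G v) (?H \<gamma>) = num_trees V E (S \<union> set \<gamma>) / num_trees V E S"
    if "\<gamma> \<in> simple_paths E S v" for \<gamma>
  proof -
    have "emeasure (srw G v) (?H \<gamma>) = erasure_mass E S v \<gamma>"
      unfolding erasure_mass_def by (rule emeasure_stopped_walks(2)[OF v]) auto
    also have "\<dots> = ennreal (num_trees V E (S \<union> set \<gamma>) / num_trees V E S)"
      using erasure_mass_eq[OF _ L v that] S by blast
    finally show ?thesis by (simp add: measure_def)
  qed
  have H_le: "loop_erasure (stopped_path S X) = \<gamma>" if "X \<in> ?H \<gamma>" for X \<gamma>
    using that stopped_path_cylinder by fastforce
  let ?A = "\<Union>\<omega>\<in>stopped_walks E S v. cylinder \<omega>"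
  have "emeasure (srw G v) ?A = 1"
    using emeasure_stopped_walks(2)[OF v order_refl, of S] hit_mass_eq_1[OF S L v] by (simp add: hit_mass_def)
  moreover have "?A \<in> events" by (rule emeasure_stopped_walks(1)[OF v order_refl])
  ultimately have AE: "AE X in srw G v. X \<in> ?A"
    using AE_in_set_eq_1[of ?A] by (simp add: emeasure_eq_measure)
  have "f (loop_erasure (stopped_path S X)) = (\<Sum>\<gamma>\<in>simple_paths E S v. f \<gamma> * indicator (?H \<gamma>) X)"
    if X: "X \<in> ?A" for X
  proof -
    obtain \<omega> where \<omega>: "\<omega> \<in> stopped_walks E S v" "X \<in> cylinder \<omega>" using X by blast
    let ?\<gamma> = "loop_erasure \<omega>"
    have "X \<in> ?H \<gamma> \<longleftrightarrow> \<gamma> = ?\<gamma>" for \<gamma>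
    proof
      assume "X \<in> ?H \<gamma>"
      from H_le[OF this] show "\<gamma> = ?\<gamma>" using stopped_path_cylinder[OF \<omega>] by simp
    qed (use \<omega> in blast)
    then have "(\<Sum>\<gamma>\<in>simple_paths E S v. f \<gamma> * indicator (?H \<gamma>) X) =
        (\<Sum>\<gamma>\<in>simple_paths E S v. if \<gamma> = ?\<gamma> then f \<gamma> else 0)"
      by (intro sum.cong) (auto simp: indicator_def)
    also have "\<dots> = f ?\<gamma>" using fin loop_erasure_in_simple_paths[OF \<omega>(1)] by simp
    finally show ?thesis using stopped_path_cylinder[OF \<omega>] by simp
  qed
  then have "AE X in srw G v. f (loop_erasure (stopped_path S X)) =
      (\<Sum>\<gamma>\<in>simple_paths E S v. f \<gamma> * indicator (?H \<gamma>) X)"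
    using AE by auto
  moreover have "(\<lambda>X. f (loop_erasure (stopped_path S X))) \<in> borel_measurable (srw G v)"
    by (rule measurable_compose[OF measurable_stopped_path[OF v]]) simp
  ultimately have "(\<integral>X. f (loop_erasure (stopped_path S X)) \<partial>srw G v) =
      (\<integral>X. (\<Sum>\<gamma>\<in>simple_paths E S v. f \<gamma> * indicator (?H \<gamma>) X) \<partial>srw G v)"
    by (intro integral_cong_AE) (auto intro!: borel_measurable_sum borel_measurable_times)
  also have "\<dots> = (\<Sum>\<gamma>\<in>simple_paths E S v. \<integral>X. f \<gamma> * indicator (?H \<gamma>) X \<partial>srw G v)"
    by (intro Bochner_Integration.integral_sum integrable_mult_right integrable_real_indicator)
      (auto simp: less_top[symmetric])
  also have "\<dots> = (\<Sum>\<gamma>\<in>simple_paths E S v. f \<gamma> * (num_trees V E (S \<union> set \<gamma>) / num_trees V E S))"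
    using sets.sets_into_space[OF H_sets]
    by (intro sum.cong refl) (simp add: H_prob Int_absorb2 Int_absorb1)
  finally show ?thesis .
qed

end

section \<open>Connection types of three corners\<close>

datatype corner = Lft | Rgt | Top

text \<open>The five ways in which an edge set can connect the three corners of a graph. In \<open>Apart c\<close> the
corner \<open>c\<close> is separated from the two others, which are connected.\<close>

datatype ctype = Joined | Apart corner | Separate

fun conn :: "ctype \<Rightarrow> corner \<Rightarrow> corner \<Rightarrow> bool" where
  "conn Joined j k = True"
| "conn (Apart c) j k = (j = k \<or> j \<noteq> c \<and> k \<noteq> c)"
| "conn Separate j k = (j = k)"

fun blocks :: "ctype \<Rightarrow> nat" where
  "blocks Joined = 1"
| "blocks (Apart c) = 2"
| "blocks Separate = 3"

lemma corner_UNIV: "(UNIV :: corner set) = {Lft, Rgt, Top}"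
  using corner.exhaust by auto

lemma corner_all: "(\<forall>c. P c) \<longleftrightarrow> P Lft \<and> P Rgt \<and> P Top"
  using corner.exhaust by metis

lemma corner_ex: "(\<exists>c. P c) \<longleftrightarrow> P Lft \<or> P Rgt \<or> P Top"
  using corner.exhaust by metis

lemma conn_refl [simp]: "conn t j j"
  by (cases t) auto

lemma conn_sym: "conn t j k = conn t k j"
  by (cases t) auto

lemma conn_trans: "conn t i j \<Longrightarrow> conn t j k \<Longrightarrow> conn t i k"
  by (cases t) auto

lemma conn_inj: "conn t = conn t' \<Longrightarrow> t = t'"
  by (cases t; cases t') (auto simp: fun_eq_iff corner_all split: corner.splits; metis corner.exhaust)+

lemma conn_exists:
  assumes refl: "\<And>j. r j j" and sym: "\<And>j k. r j k \<Longrightarrow> r k j"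
    and trans: "\<And>i j k. r i j \<Longrightarrow> r j k \<Longrightarrow> r i k"
  shows "\<exists>t. \<forall>j k. r j k \<longleftrightarrow> conn t j k"
proof -
  have s: "r Rgt Lft = r Lft Rgt" "r Top Lft = r Lft Top" "r Top Rgt = r Rgt Top"
    using sym by blast+
  have t: "r Lft Rgt \<Longrightarrow> r Lft Top \<Longrightarrow> r Rgt Top" "r Lft Rgt \<Longrightarrow> r Rgt Top \<Longrightarrow> r Lft Top"
    "r Lft Top \<Longrightarrow> r Rgt Top \<Longrightarrow> r Lft Rgt"
    using sym trans by blast+
  consider "r Lft Rgt" "r Lft Top" "r Rgt Top" | "r Lft Rgt" "\<not> r Lft Top" "\<not> r Rgt Top"
    | "\<not> r Lft Rgt" "r Lft Top" "\<not> r Rgt Top" | "\<not> r Lft Rgt" "\<not> r Lft Top" "r Rgt Top"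
    | "\<not> r Lft Rgt" "\<not> r Lft Top" "\<not> r Rgt Top"
    using t by blast
  then show ?thesis
  proof cases
    case 1
    then show ?thesis by (intro exI[of _ Joined]) (simp add: corner_all refl s)
  next
    case 2
    then show ?thesis by (intro exI[of _ "Apart Top"]) (simp add: corner_all refl s)
  next
    case 3
    then show ?thesis by (intro exI[of _ "Apart Rgt"]) (simp add: corner_all refl s)
  next
    case 4
    then show ?thesis by (intro exI[of _ "Apart Lft"]) (simp add: corner_all refl s)
  next
    case 5
    then show ?thesis by (intro exI[of _ Separate]) (simp add: corner_all refl s)
  qed
qed

text \<open>The corner different from both arguments; the values on the diagonal are a default.\<close>

fun third :: "corner \<Rightarrow> corner \<Rightarrow> corner" where
  "third Lft Rgt = Top" | "third Rgt Lft = Top"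
| "third Lft Top = Rgt" | "third Top Lft = Rgt"
| "third Rgt Top = Lft" | "third Top Rgt = Lft"
| "third Lft Lft = Lft" | "third Rgt Rgt = Rgt" | "third Top Top = Top"

text \<open>Three pieces are arranged in a ring; piece \<open>a\<close> is connected according to \<open>\<tau> a\<close>, and corner
\<open>b\<close> of piece \<open>a\<close> is identified with corner \<open>a\<close> of piece \<open>b\<close>. The definition lists the
routes from the outer corner \<open>i\<close>, which is corner \<open>i\<close> of piece \<open>i\<close>, to corner \<open>b\<close> of piece
\<open>a\<close>: each route leaves piece \<open>i\<close> at one of its two inner corners and then goes around the ring
in one direction.\<close>

definition glued :: "(corner \<Rightarrow> ctype) \<Rightarrow> corner \<Rightarrow> corner \<Rightarrow> corner \<Rightarrow> bool" where
  "glued \<tau> i a b \<longleftrightarrow>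
    (if a = i \<and> b = i then True
     else if a = b then
       conn (\<tau> i) i a \<and> conn (\<tau> a) i a \<or>
       conn (\<tau> i) i (third i a) \<and> conn (\<tau> (third i a)) i a \<and> conn (\<tau> a) (third i a) a
     else if a = i then
       conn (\<tau> i) i b \<or>
       conn (\<tau> i) i (third i b) \<and> conn (\<tau> (third i b)) i b \<and> conn (\<tau> b) (third i b) i
     else if b = i then
       conn (\<tau> i) i a \<or>
       conn (\<tau> i) i (third i a) \<and> conn (\<tau> (third i a)) i a \<and> conn (\<tau> a) (third i a) i
     else conn (\<tau> i) i a \<and> conn (\<tau> a) i b \<or> conn (\<tau> i) i b \<and> conn (\<tau> b) i a)"

lemma glued_start: "glued \<tau> i i i"
  by (simp add: glued_def)

lemma glued_swap: "glued \<tau> i a b = glued \<tau> i b a"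
  by (cases i; cases a; cases b) (auto simp: glued_def)

text \<open>Together with \<open>glued_start\<close> and \<open>glued_swap\<close> this says that the listed routes are closed under
continuation, so no connection is missing.\<close>

lemma glued_step: "glued \<tau> i a b \<Longrightarrow> conn (\<tau> a) b c \<Longrightarrow> glued \<tau> i a c"
proof -
  have s: "conn t Rgt Lft = conn t Lft Rgt" "conn t Top Lft = conn t Lft Top"
    "conn t Top Rgt = conn t Rgt Top" for t by (simp_all add: conn_sym)
  have t: "conn t Lft Rgt \<Longrightarrow> conn t Lft Top \<Longrightarrow> conn t Rgt Top"
    "conn t Lft Rgt \<Longrightarrow> conn t Rgt Top \<Longrightarrow> conn t Lft Top"
    "conn t Lft Top \<Longrightarrow> conn t Rgt Top \<Longrightarrow> conn t Lft Rgt" for t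
    using conn_trans conn_sym by blast+
  assume "glued \<tau> i a b" "conn (\<tau> a) b c"
  then show "glued \<tau> i a c"
    by (cases i; cases a; cases b; cases c) (simp_all add: glued_def s, (use t in blast)+)
qed

lemma glued_induct:
  assumes "glued \<tau> i a b" "P i i"
    and "\<And>a b c. P a b \<Longrightarrow> conn (\<tau> a) b c \<Longrightarrow> P a c" "\<And>a b. P a b \<Longrightarrow> P b a"
  shows "P a b"
proof -
  have "conn (\<tau> i) i x \<Longrightarrow> conn (\<tau> x) i y \<Longrightarrow> conn (\<tau> y) x z \<Longrightarrow> P y z" for x y z
    using assms(2-4) by blast
  moreover have "conn (\<tau> i) i x \<Longrightarrow> conn (\<tau> x) i y \<Longrightarrow> P x y" for x y
    using assms(2-4) by blast
  moreover have "conn (\<tau> i) i x \<Longrightarrow> P i x" for x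
    using assms(2-4) by blast
  ultimately show ?thesis
    using assms(1,2) assms(4) unfolding glued_def by (auto split: if_splits)
qed

text \<open>The edge set obtained by gluing leaves no component without outer corner and connects the outer
corners according to \<open>t\<close>.\<close>

definition glues_to :: "(corner \<Rightarrow> ctype) \<Rightarrow> ctype \<Rightarrow> bool" where
  "glues_to \<tau> t \<longleftrightarrow> (\<forall>a b. \<exists>i. glued \<tau> i a b) \<and> (\<forall>i j. glued \<tau> i j j \<longleftrightarrow> conn t i j)"

section \<open>Gluing three graphs\<close>

definition spans :: "'a set \<Rightarrow> (corner \<Rightarrow> 'a) \<Rightarrow> ctype \<Rightarrow> 'a set set \<Rightarrow> bool" where
  "spans V q t H \<longleftrightarrow> linked V (range q) H \<and> (\<forall>j k. joined H (q j) (q k) \<longleftrightarrow> conn t j k)"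

lemma spans_exists:
  assumes "linked V (range q) H"
  shows "\<exists>t. spans V q t H"
proof -
  have "\<exists>t. \<forall>j k. joined H (q j) (q k) \<longleftrightarrow> conn t j k"
    by (rule conn_exists) (auto intro: joined_sym rtranclp_trans)
  then show ?thesis using assms unfolding spans_def by blast
qed

lemma spans_unique: "spans V q t H \<Longrightarrow> spans V q t' H \<Longrightarrow> t = t'"
  by (rule conn_inj) (auto simp: spans_def fun_eq_iff)

text \<open>\<open>m i j\<close> is corner \<open>j\<close> of piece \<open>i\<close>. Distinct pieces share exactly one vertex, and the vertices
\<open>m i i\<close> become the corners of the union.\<close>

locale gluing =
  fixes V :: "corner \<Rightarrow> 'a set" and E :: "corner \<Rightarrow> 'a set set" and m :: "corner \<Rightarrow> corner \<Rightarrow> 'a"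
  assumes graph: "\<And>i. graph_on (V i) (E i)"
    and m_sym: "\<And>i j. m i j = m j i"
    and m_in: "\<And>i j. m i j \<in> V i"
    and overlap: "\<And>i j. i \<noteq> j \<Longrightarrow> V i \<inter> V j = {m i j}"
    and m_distinct: "\<And>i j k. j \<noteq> k \<Longrightarrow> m i j \<noteq> m i k"
begin

lemma corner_not_shared:
  assumes "i \<noteq> k"
  shows "m k k \<notin> V i"
proof
  assume "m k k \<in> V i"
  then have "m k k \<in> V i \<inter> V k" using m_in[of k k] by simp
  then have "m k k = m k i" using overlap[OF assms] m_sym[of i k] by simp
  then show False using m_distinct[of k i k] assms by simp
qed

lemma edges_disjoint: "i \<noteq> j \<Longrightarrow> E i \<inter> E j = {}"
proof -
  assume ij: "i \<noteq> j"
  have False if "e \<in> E i" "e \<in> E j" for e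
  proof -
    obtain u v where e: "e = {u, v}" "u \<noteq> v"
      using graph[of i] \<open>e \<in> E i\<close> unfolding graph_on_def by meson
    then have "u \<in> V i \<inter> V j" "v \<in> V i \<inter> V j"
      using graph_onD[OF graph] \<open>e \<in> E i\<close> \<open>e \<in> E j\<close> by blast+
    then show False using overlap[OF ij] e(2) by simp
  qed
  then show ?thesis by blast
qed

context
  fixes H \<tau>
  assumes H: "\<And>i. H i \<subseteq> E i"
    and \<tau>: "\<And>i. spans (V i) (m i) (\<tau> i) (H i)"
begin

lemma piece_conn: "joined (H i) (m i j) (m i k) \<longleftrightarrow> conn (\<tau> i) j k"
  using \<tau>[of i] by (simp add: spans_def)

lemma piece_joined: "joined (H i) x y \<Longrightarrow> joined (\<Union>i. H i) x y"
  by (rule joined_mono[of "H i" "\<Union>i. H i"]) blast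

lemma glued_imp_joined: "glued \<tau> i a b \<Longrightarrow> joined (\<Union>i. H i) (m i i) (m a b)"
proof (erule glued_induct)
  fix a b c assume "joined (\<Union>i. H i) (m i i) (m a b)" "conn (\<tau> a) b c"
  then show "joined (\<Union>i. H i) (m i i) (m a c)"
    using piece_joined[of a "m a b" "m a c"] piece_conn[of a b c] by (meson rtranclp_trans)
qed (simp_all add: m_sym)

lemma joined_imp_piece:
  assumes "joined (\<Union>i. H i) (m i i) w" "w \<in> V a"
  shows "\<exists>b. glued \<tau> i a b \<and> joined (H a) (m a b) w"
  using assms
proof (induction arbitrary: a rule: rtranclp_induct)
  case base
  then have "a = i" using corner_not_shared[of a i] by blast
  then show ?case using glued_start by blast
next
  case (step v w)
  then obtain k where k: "{v, w} \<in> H k" by blast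
  then have vw: "v \<in> V k" "w \<in> V k" using graph_onD[OF graph[of k]] H[of k] by blast+
  from step.IH[OF vw(1)] obtain b where b: "glued \<tau> i k b" "joined (H k) (m k b) v" by blast
  have kw: "joined (H k) (m k b) w" using b(2) k by (rule rtranclp.rtrancl_into_rtrancl)
  show ?case
  proof (cases "a = k")
    case True
    then show ?thesis using b kw by blast
  next
    case False
    have "w \<in> V a \<inter> V k" using step.prems vw(2) by blast
    then have w: "w = m k a" using overlap[OF False] m_sym[of a k] by simp
    then have "conn (\<tau> k) b a" using kw piece_conn by simp
    then have "glued \<tau> i a k" using glued_step[OF b(1)] glued_swap by blast
    then show ?thesis using w m_sym[of k a] by (intro exI[of _ k]) simp
  qed
qed

lemma joined_iff_glued: "joined (\<Union>i. H i) (m i i) (m a b) \<longleftrightarrow> glued \<tau> i a b"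
proof
  assume "joined (\<Union>i. H i) (m i i) (m a b)"
  from joined_imp_piece[OF this m_in] obtain b' where "glued \<tau> i a b'" "joined (H a) (m a b') (m a b)"
    by blast
  then show "glued \<tau> i a b" using glued_step piece_conn by blast
qed (rule glued_imp_joined)

lemma spans_glued: "spans (\<Union>i. V i) (\<lambda>i. m i i) t (\<Union>i. H i) \<longleftrightarrow> glues_to \<tau> t"
proof -
  have "linked (\<Union>i. V i) (range (\<lambda>i. m i i)) (\<Union>i. H i) \<longleftrightarrow> (\<forall>a b. \<exists>i. glued \<tau> i a b)"
  proof
    assume L: "linked (\<Union>i. V i) (range (\<lambda>i. m i i)) (\<Union>i. H i)"
    show "\<forall>a b. \<exists>i. glued \<tau> i a b"
    proof (intro allI)
      fix a b
      have "m a b \<in> (\<Union>i. V i)" using m_in by blast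
      then obtain i where "joined (\<Union>i. H i) (m a b) (m i i)" using L unfolding linked_def by blast
      then show "\<exists>i. glued \<tau> i a b" using joined_sym joined_iff_glued by metis
    qed
  next
    assume g: "\<forall>a b. \<exists>i. glued \<tau> i a b"
    show "linked (\<Union>i. V i) (range (\<lambda>i. m i i)) (\<Union>i. H i)"
      unfolding linked_def
    proof
      fix v assume "v \<in> (\<Union>i. V i)"
      then obtain a where "v \<in> V a" by blast
      then obtain b where b: "joined (H a) v (m a b)"
        using \<tau>[of a] unfolding spans_def linked_def by blast
      obtain i where "glued \<tau> i a b" using g by blast
      then have "joined (\<Union>i. H i) (m a b) (m i i)" using joined_iff_glued joined_sym by metis
      then have "joined (\<Union>i. H i) v (m i i)" by (rule rtranclp_trans[OF piece_joined[OF b]])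
      then show "\<exists>s\<in>range (\<lambda>i. m i i). joined (\<Union>i. H i) v s" by blast
    qed
  qed
  then show ?thesis by (simp only: spans_def glues_to_def joined_iff_glued)
qed

end

text \<open>A component of a piece that contains none of its three corners meets no other piece, so it is a
component of the union without outer corner.\<close>

lemma pieces_linked:
  assumes H: "\<And>i. H i \<subseteq> E i" and L: "linked (\<Union>i. V i) (range (\<lambda>i. m i i)) (\<Union>i. H i)"
  shows "linked (V i) (range (m i)) (H i)"
  unfolding linked_def
proof (rule ccontr)
  assume "\<not> (\<forall>v\<in>V i. \<exists>s\<in>range (m i). joined (H i) v s)"
  then obtain v where v: "v \<in> V i" "\<And>j. \<not> joined (H i) v (m i j)" by blast
  have stay: "w \<in> V i \<and> joined (H i) v w" if "joined (\<Union>i. H i) v w" for w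
    using that
  proof (induction rule: rtranclp_induct)
    case (step w x)
    then obtain k where k: "{w, x} \<in> H k" by blast
    then have wx: "w \<in> V k" "x \<in> V k" using graph_onD[OF graph[of k]] H[of k] by blast+
    have "k = i"
    proof (rule ccontr)
      assume "k \<noteq> i"
      then have "w = m i k" using overlap[of i k] step.IH wx by blast
      then show False using step.IH v(2) by blast
    qed
    then show ?case using step.IH k wx by (auto intro: rtranclp.rtrancl_into_rtrancl)
  qed (use v in auto)
  have "v \<in> (\<Union>i. V i)" using v(1) by blast
  then obtain k where "joined (\<Union>i. H i) v (m k k)" using L unfolding linked_def by blast
  then have "m k k \<in> V i" "joined (H i) v (m k k)" using stay by blast+
  then show False using corner_not_shared[of i k] v(2) by blast
qed

end

definition span_poly :: "'a set \<Rightarrow> 'a set set \<Rightarrow> (corner \<Rightarrow> 'a) \<Rightarrow> ctype \<Rightarrow> int poly" where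
  "span_poly V E q t = (\<Sum>H | H \<subseteq> E \<and> spans V q t H. monom 1 (card H))"

lemma prod_corner: "(\<Prod>i\<in>UNIV. f i) = f Lft * f Rgt * f Top" for f :: "corner \<Rightarrow> 'b::comm_monoid_mult"
  by (simp add: corner_UNIV mult.assoc)

context gluing
begin

text \<open>Edge sets of the union correspond to triples of edge sets of the pieces, and their type is
determined by the types of the three parts.\<close>

lemma span_poly_glued:
  "span_poly (\<Union>i. V i) (\<Union>i. E i) (\<lambda>i. m i i) t =
    (\<Sum>\<tau> | glues_to \<tau> t. \<Prod>i\<in>UNIV. span_poly (V i) (E i) (m i) (\<tau> i))"
proof -
  let ?F = "\<lambda>\<tau>. PiE UNIV (\<lambda>i. {H. H \<subseteq> E i \<and> spans (V i) (m i) (\<tau> i) H})"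
  let ?big = "{H. H \<subseteq> (\<Union>i. E i) \<and> spans (\<Union>i. V i) (\<lambda>i. m i i) t H}"
  have finE: "finite (E i)" for i by (rule graph_on_finite_edges[OF graph])
  have fin: "finite {H. H \<subseteq> E i \<and> spans (V i) (m i) s H}" for i s
    using finE by (rule finite_subset[rotated, OF finite_Pow_iff[THEN iffD2]]) auto
  have finU: "finite (UNIV :: corner set)" by (simp add: corner_UNIV)
  have finF: "finite (?F \<tau>)" for \<tau> using finU fin by (intro finite_PiE) auto
  have fin\<tau>: "finite {\<tau>. glues_to \<tau> t}"
  proof -
    have "(UNIV :: ctype set) = insert Joined (insert Separate (Apart ` UNIV))"
      using ctype.exhaust by blast
    then have "finite (UNIV :: ctype set)" using finU by (metis finite_imageI finite_insert)
    then have "finite (UNIV :: (corner \<Rightarrow> ctype) set)"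
      using finite_PiE[OF finU, of "\<lambda>_. UNIV :: ctype set"] by (simp add: PiE_UNIV_domain)
    then show ?thesis by (rule finite_subset[rotated]) simp
  qed
  have memF: "K \<in> ?F \<tau> \<longleftrightarrow> (\<forall>i. K i \<subseteq> E i \<and> spans (V i) (m i) (\<tau> i) (K i))" for K \<tau>
    by (auto simp: PiE_UNIV_domain)
  have part: "(\<Union>i. K i) \<inter> E j = K j" if "\<forall>i. K i \<subseteq> E i" for K j
  proof -
    have "K i \<inter> E j \<subseteq> K j" for i
      using that edges_disjoint[of i j] by (cases "i = j") blast+
    then show ?thesis using that by blast
  qed
  have big: "?big = (\<lambda>K. \<Union>i. K i) ` (\<Union>\<tau>\<in>{\<tau>. glues_to \<tau> t}. ?F \<tau>)"
  proof (intro equalityI subsetI)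
    fix H assume H: "H \<in> ?big"
    define K where "K i = H \<inter> E i" for i
    have K: "K i \<subseteq> E i" for i by (simp add: K_def)
    have HK: "H = (\<Union>i. K i)" using H by (auto simp: K_def)
    have "\<exists>s. spans (V i) (m i) s (K i)" for i
      using pieces_linked[OF K] H unfolding HK by (intro spans_exists) (simp add: spans_def)
    then obtain \<tau> where \<tau>: "\<And>i. spans (V i) (m i) (\<tau> i) (K i)" by metis
    have "glues_to \<tau> t" using spans_glued[OF K \<tau>] H unfolding HK by simp
    moreover have "K \<in> ?F \<tau>" using memF K \<tau> by blast
    ultimately show "H \<in> (\<lambda>K. \<Union>i. K i) ` (\<Union>\<tau>\<in>{\<tau>. glues_to \<tau> t}. ?F \<tau>)"
      using HK by blast
  next
    fix H assume "H \<in> (\<lambda>K. \<Union>i. K i) ` (\<Union>\<tau>\<in>{\<tau>. glues_to \<tau> t}. ?F \<tau>)"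
    then obtain K \<tau> where K: "H = (\<Union>i. K i)" "glues_to \<tau> t" "K \<in> ?F \<tau>" by blast
    then have 1: "\<And>i. K i \<subseteq> E i" and 2: "\<And>i. spans (V i) (m i) (\<tau> i) (K i)"
      using memF by blast+
    show "H \<in> ?big"
      using spans_glued[OF 1 2, of t] K(1,2) 1 by blast
  qed
  have inj: "inj_on (\<lambda>K. \<Union>i. K i) (\<Union>\<tau>\<in>{\<tau>. glues_to \<tau> t}. ?F \<tau>)"
  proof (rule inj_onI)
    fix K K' assume "K \<in> (\<Union>\<tau>\<in>{\<tau>. glues_to \<tau> t}. ?F \<tau>)" "K' \<in> (\<Union>\<tau>\<in>{\<tau>. glues_to \<tau> t}. ?F \<tau>)"
      and eq: "(\<Union>i. K i) = (\<Union>i. K' i)"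
    then have "\<forall>i. K i \<subseteq> E i" "\<forall>i. K' i \<subseteq> E i" using memF by blast+
    then have "K j = K' j" for j using part[of K j] part[of K' j] eq by simp
    then show "K = K'" by (rule ext)
  qed
  have "span_poly (\<Union>i. V i) (\<Union>i. E i) (\<lambda>i. m i i) t =
      (\<Sum>K\<in>(\<Union>\<tau>\<in>{\<tau>. glues_to \<tau> t}. ?F \<tau>). monom 1 (card (\<Union>i. K i)))"
    unfolding span_poly_def big by (subst sum.reindex[OF inj]) simp
  also have "\<dots> = (\<Sum>\<tau> | glues_to \<tau> t. \<Sum>K\<in>?F \<tau>. monom 1 (card (\<Union>i. K i)))"
  proof (rule sum.UNION_disjoint)
    show "finite {\<tau>. glues_to \<tau> t}" by (rule fin\<tau>)
    show "\<forall>\<tau>\<in>{\<tau>. glues_to \<tau> t}. finite (?F \<tau>)" using finF by blast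
    \<comment> \<open>The type of each part is unique, so triples of different types are different.\<close>
    have "\<tau> = \<tau>'" if "K \<in> ?F \<tau>" "K \<in> ?F \<tau>'" for K \<tau> \<tau>'
    proof
      fix i
      have "spans (V i) (m i) (\<tau> i) (K i)" "spans (V i) (m i) (\<tau>' i) (K i)"
        using that memF by blast+
      then show "\<tau> i = \<tau>' i" by (rule spans_unique)
    qed
    then show "\<forall>\<tau>\<in>{\<tau>. glues_to \<tau> t}. \<forall>\<tau>'\<in>{\<tau>. glues_to \<tau> t}. \<tau> \<noteq> \<tau>' \<longrightarrow> ?F \<tau> \<inter> ?F \<tau>' = {}"
      by blast
  qed
  also have "\<dots> = (\<Sum>\<tau> | glues_to \<tau> t. \<Prod>i\<in>UNIV. span_poly (V i) (E i) (m i) (\<tau> i))"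
  proof (intro sum.cong refl)
    fix \<tau>
    have "(\<Sum>K\<in>?F \<tau>. monom (1::int) (card (\<Union>i. K i))) = (\<Sum>K\<in>?F \<tau>. \<Prod>i\<in>UNIV. monom 1 (card (K i)))"
    proof (intro sum.cong refl)
      fix K assume "K \<in> ?F \<tau>"
      then have K: "K i \<subseteq> E i" for i using memF by blast
      have "card (\<Union>i\<in>UNIV. K i) = (\<Sum>i\<in>UNIV. card (K i))"
        using finU finite_subset[OF K finE] edges_disjoint K
        by (intro card_UN_disjoint) (auto, blast)
      then show "monom (1::int) (card (\<Union>i. K i)) = (\<Prod>i\<in>UNIV. monom 1 (card (K i)))"
        by (simp add: corner_UNIV mult_monom add.assoc)
    qed
    also have "\<dots> = (\<Prod>i\<in>UNIV. span_poly (V i) (E i) (m i) (\<tau> i))"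
      unfolding span_poly_def using finU fin by (subst prod_sum_PiE) (auto simp: PiE_UNIV_domain)
    finally show "(\<Sum>K\<in>?F \<tau>. monom 1 (card (\<Union>i. K i))) = (\<Prod>i\<in>UNIV. span_poly (V i) (E i) (m i) (\<tau> i))" .
  qed
  finally show ?thesis .
qed

end

text \<open>The definition is executable, so that \<open>glue_triples_eq\<close> can test all \<open>125\<close> triples of types.\<close>

definition glue_triples :: "ctype \<Rightarrow> (ctype \<times> ctype \<times> ctype) list" where
  "glue_triples t =
     (let ts = [Joined, Apart Lft, Apart Rgt, Apart Top, Separate]
      in filter (\<lambda>(a, b, c). glues_to (case_corner a b c) t) (List.product ts (List.product ts ts)))"

lemma glues_to_code [code]:
  "glues_to \<tau> t \<longleftrightarrow>
     (let cs = [Lft, Rgt, Top]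
      in list_all (\<lambda>a. list_all (\<lambda>b. list_ex (\<lambda>i. glued \<tau> i a b) cs) cs) cs \<and>
         list_all (\<lambda>i. list_all (\<lambda>j. glued \<tau> i j j \<longleftrightarrow> conn t i j) cs) cs)"
  by (simp add: glues_to_def corner_all corner_ex)

lemma glue_triples_eq:
  "glue_triples Joined =
    [(Joined, Joined, Joined), (Joined, Joined, Apart Lft), (Joined, Joined, Apart Rgt),
     (Joined, Apart Lft, Joined), (Joined, Apart Top, Joined), (Apart Rgt, Joined, Joined),
     (Apart Top, Joined, Joined)]"
  "glue_triples (Apart Lft) =
    [(Joined, Apart Lft, Apart Lft), (Apart Lft, Joined, Joined), (Apart Lft, Joined, Apart Lft),
     (Apart Lft, Joined, Apart Rgt), (Apart Lft, Apart Lft, Joined),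
     (Apart Lft, Apart Top, Joined), (Apart Rgt, Joined, Apart Lft),
     (Apart Top, Apart Lft, Joined), (Separate, Joined, Joined)]"
  "glue_triples (Apart Rgt) =
    [(Joined, Apart Lft, Apart Rgt), (Joined, Apart Rgt, Joined), (Joined, Apart Rgt, Apart Lft),
     (Joined, Apart Rgt, Apart Rgt), (Joined, Separate, Joined), (Apart Rgt, Joined, Apart Rgt),
     (Apart Rgt, Apart Rgt, Joined), (Apart Rgt, Apart Top, Joined), (Apart Top, Apart Rgt, Joined)]"
  "glue_triples (Apart Top) =
    [(Joined, Joined, Apart Top), (Joined, Joined, Separate), (Joined, Apart Lft, Apart Top),
     (Joined, Apart Top, Apart Lft), (Joined, Apart Top, Apart Top),
     (Apart Rgt, Joined, Apart Top), (Apart Top, Joined, Apart Rgt),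
     (Apart Top, Joined, Apart Top), (Apart Top, Apart Top, Joined)]"
  "glue_triples Separate =
    [(Joined, Apart Lft, Separate), (Joined, Apart Rgt, Apart Top), (Joined, Apart Rgt, Separate),
     (Joined, Separate, Apart Lft), (Joined, Separate, Apart Top), (Apart Lft, Joined, Apart Top),
     (Apart Lft, Joined, Separate), (Apart Lft, Apart Lft, Apart Rgt),
     (Apart Lft, Apart Lft, Apart Top), (Apart Lft, Apart Rgt, Joined),
     (Apart Lft, Apart Rgt, Apart Lft), (Apart Lft, Apart Rgt, Apart Rgt),
     (Apart Lft, Apart Top, Apart Lft), (Apart Lft, Apart Top, Apart Top),
     (Apart Lft, Separate, Joined), (Apart Rgt, Joined, Separate),
     (Apart Rgt, Apart Rgt, Apart Lft), (Apart Rgt, Apart Rgt, Apart Top),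
     (Apart Rgt, Apart Top, Apart Lft), (Apart Rgt, Apart Top, Apart Top),
     (Apart Top, Apart Lft, Apart Rgt), (Apart Top, Apart Lft, Apart Top),
     (Apart Top, Apart Rgt, Apart Rgt), (Apart Top, Apart Rgt, Apart Top),
     (Apart Top, Separate, Joined), (Separate, Joined, Apart Rgt), (Separate, Joined, Apart Top),
     (Separate, Apart Rgt, Joined), (Separate, Apart Top, Joined)]"
  by code_simp+

lemma sum_glues_to:
  fixes w :: "corner \<Rightarrow> ctype \<Rightarrow> 'b::comm_semiring_1"
  shows "(\<Sum>\<tau> | glues_to \<tau> t. \<Prod>i\<in>UNIV. w i (\<tau> i)) =
    (\<Sum>(a, b, c)\<leftarrow>glue_triples t. w Lft a * w Rgt b * w Top c)"
proof -
  let ?ts = "[Joined, Apart Lft, Apart Rgt, Apart Top, Separate]"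
  have all: "a \<in> set ?ts" for a
  proof (cases a)
    case (Apart c)
    then show ?thesis by (cases c) auto
  qed auto
  have dist: "distinct (glue_triples t)"
    unfolding glue_triples_def Let_def by (intro distinct_filter distinct_product) simp_all
  have fn: "case_corner (\<tau> Lft) (\<tau> Rgt) (\<tau> Top) = \<tau>" for \<tau> :: "corner \<Rightarrow> ctype"
  proof
    fix c show "case_corner (\<tau> Lft) (\<tau> Rgt) (\<tau> Top) c = \<tau> c" by (cases c) simp_all
  qed
  have "(\<Sum>\<tau> | glues_to \<tau> t. \<Prod>i\<in>UNIV. w i (\<tau> i)) =
      (\<Sum>(a, b, c)\<in>set (glue_triples t). w Lft a * w Rgt b * w Top c)"
  proof (rule sum.reindex_bij_witness[where i="\<lambda>(a, b, c). case_corner a b c"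
        and j="\<lambda>\<tau>. (\<tau> Lft, \<tau> Rgt, \<tau> Top)"])
    fix \<tau> assume "\<tau> \<in> {\<tau>. glues_to \<tau> t}"
    then show "(\<tau> Lft, \<tau> Rgt, \<tau> Top) \<in> set (glue_triples t)"
      unfolding glue_triples_def Let_def set_filter set_product
      using all[of "\<tau> Lft"] all[of "\<tau> Rgt"] all[of "\<tau> Top"] fn[of \<tau>]
      by (intro CollectI conjI SigmaI) (simp_all only: case_prod_conv mem_Collect_eq)
  next
    fix z assume "z \<in> set (glue_triples t)"
    then show "(case z of (a, b, c) \<Rightarrow> case_corner a b c) \<in> {\<tau>. glues_to \<tau> t}"
      unfolding glue_triples_def Let_def set_filter by (cases z) simp
  next
    fix \<tau> assume "\<tau> \<in> {\<tau>. glues_to \<tau> t}"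
    show "(case (\<tau> Lft, \<tau> Rgt, \<tau> Top) of (a, b, c) \<Rightarrow> case_corner a b c) = \<tau>" by (simp add: fn)
  next
    fix z assume "z \<in> set (glue_triples t)"
    show "((case z of (a, b, c) \<Rightarrow> case_corner a b c) Lft, (case z of (a, b, c) \<Rightarrow> case_corner a b c) Rgt,
      (case z of (a, b, c) \<Rightarrow> case_corner a b c) Top) = z" by (cases z) simp
  next
    fix \<tau> assume "\<tau> \<in> {\<tau>. glues_to \<tau> t}"
    show "(case (\<tau> Lft, \<tau> Rgt, \<tau> Top) of (a, b, c) \<Rightarrow> w Lft a * w Rgt b * w Top c) =
      (\<Prod>i\<in>UNIV. w i (\<tau> i))" by (simp add: prod_corner)
  qed
  also have "\<dots> = (\<Sum>(a, b, c)\<leftarrow>glue_triples t. w Lft a * w Rgt b * w Top c)"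
    using dist by (rule sum_list_distinct_conv_sum_set[symmetric])
  finally show ?thesis .
qed

lemma sum_glues_to_uniform:
  fixes w :: "ctype \<Rightarrow> 'b::comm_semiring_1"
  assumes "w Joined = a" "\<And>c. w (Apart c) = b" "w Separate = d"
  shows "(\<Sum>\<tau> | glues_to \<tau> Joined. \<Prod>i\<in>UNIV. w (\<tau> i)) = 6 * (a * a * b) + a * a * a"
    and "(\<Sum>\<tau> | glues_to \<tau> (Apart k). \<Prod>i\<in>UNIV. w (\<tau> i)) = a * a * d + 7 * (a * b * b) + a * a * b"
    and "(\<Sum>\<tau> | glues_to \<tau> Separate. \<Prod>i\<in>UNIV. w (\<tau> i)) =
      14 * (b * b * b) + 12 * (a * b * d) + 3 * (a * b * b)"
proof -
  note s = sum_glues_to[of "\<lambda>_. w"]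
  have "(3::'b) = 1 + 1 + 1" "(6::'b) = 1 + 1 + 1 + 1 + 1 + 1" "(7::'b) = 1 + 1 + 1 + 1 + 1 + 1 + 1"
    "(12::'b) = 1 + 1 + 1 + 1 + 1 + 1 + 1 + 1 + 1 + 1 + 1 + 1"
    "(14::'b) = 1 + 1 + 1 + 1 + 1 + 1 + 1 + 1 + 1 + 1 + 1 + 1 + 1 + 1" by simp_all
  then have e: "3 * x = x + x + x" "6 * x = x + x + x + x + x + x" "7 * x = x + x + x + x + x + x + x"
    "12 * x = x + x + x + x + x + x + x + x + x + x + x + x"
    "14 * x = x + x + x + x + x + x + x + x + x + x + x + x + x + x" for x :: 'b
    by (simp_all only: distrib_right mult_1_left)
  show "(\<Sum>\<tau> | glues_to \<tau> Joined. \<Prod>i\<in>UNIV. w (\<tau> i)) = 6 * (a * a * b) + a * a * a"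
    unfolding s glue_triples_eq e by (simp add: assms ac_simps)
  show "(\<Sum>\<tau> | glues_to \<tau> (Apart k). \<Prod>i\<in>UNIV. w (\<tau> i)) = a * a * d + 7 * (a * b * b) + a * a * b"
    by (cases k) (simp_all only: s glue_triples_eq e, simp_all add: assms ac_simps)
  show "(\<Sum>\<tau> | glues_to \<tau> Separate. \<Prod>i\<in>UNIV. w (\<tau> i)) =
      14 * (b * b * b) + 12 * (a * b * d) + 3 * (a * b * b)"
    unfolding s glue_triples_eq e by (simp add: assms ac_simps)
qed

section \<open>Isomorphic copies\<close>

lemma joined_image:
  assumes "inj f"
  shows "joined ((`) f ` H) (f x) (f y) \<longleftrightarrow> joined H x y"
proof
  have edge: "{f x, f y} \<in> (`) f ` H \<longleftrightarrow> {x, y} \<in> H" for x y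
  proof -
    have "inj ((`) f)" using assms by (metis inj_image_eq_iff injI)
    from inj_image_mem_iff[OF this, of "{x, y}" H] show ?thesis by simp
  qed
  have "\<exists>y'. z = f y' \<and> joined H x y'" if "joined ((`) f ` H) (f x) z" for z
    using that
  proof (induction rule: rtranclp_induct)
    case (step y z)
    then obtain y' where y': "y = f y'" "joined H x y'" by blast
    obtain e where e: "e \<in> H" "{y, z} = f ` e" using step.hyps by blast
    then have "z \<in> f ` e" by blast
    then obtain z' where "z = f z'" by blast
    then have "{y', z'} \<in> H" using step.hyps(2) y'(1) edge by blast
    with y'(2) have "joined H x z'" by (rule rtranclp.rtrancl_into_rtrancl)
    then show ?case using \<open>z = f z'\<close> by blast
  qed auto
  then show "joined ((`) f ` H) (f x) (f y) \<Longrightarrow> joined H x y"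
    using injD[OF assms] by blast
  show "joined H x y \<Longrightarrow> joined ((`) f ` H) (f x) (f y)"
  proof (induction rule: rtranclp_induct)
    case (step y z)
    then show ?case using edge rtranclp.rtrancl_into_rtrancl[OF step.IH] by blast
  qed auto
qed

lemma spans_image:
  assumes "inj f"
  shows "spans (f ` V) (\<lambda>i. f (q i)) t ((`) f ` H) \<longleftrightarrow> spans V q t H"
  by (simp add: spans_def linked_def joined_image[OF assms])

lemma span_poly_image:
  assumes "inj f"
  shows "span_poly (f ` V) ((`) f ` E) (\<lambda>i. f (q i)) t = span_poly V E q t"
proof -
  have inj2: "inj ((`) f)" using assms by (metis inj_image_eq_iff injI)
  have inj3: "inj ((`) ((`) f))" using inj2 by (metis inj_image_eq_iff injI)
  have "{H. H \<subseteq> (`) f ` E \<and> spans (f ` V) (\<lambda>i. f (q i)) t H} =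
      (`) ((`) f) ` {H. H \<subseteq> E \<and> spans V q t H}"
    using spans_image[OF assms, of V q t] by (auto simp: subset_image_iff)
  moreover have "card ((`) f ` H) = card H" for H
    using inj2 by (intro card_image inj_on_subset[OF inj2]) auto
  moreover have "inj_on ((`) ((`) f)) {H. H \<subseteq> E \<and> spans V q t H}"
    using inj3 by (rule inj_on_subset) simp
  ultimately show ?thesis
    by (simp add: span_poly_def sum.reindex)
qed

lemma graph_on_image:
  assumes "inj f" "graph_on V E"
  shows "graph_on (f ` V) ((`) f ` E)"
  unfolding graph_on_def
proof (intro conjI ballI)
  fix e assume "e \<in> (`) f ` E"
  then obtain e' where e': "e' \<in> E" "e = f ` e'" by blast
  then obtain u v where "u \<in> V" "v \<in> V" "u \<noteq> v" "e' = {u, v}"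
    using assms(2) unfolding graph_on_def by meson
  then have "f u \<in> f ` V" "f v \<in> f ` V" "f u \<noteq> f v" "e = {f u, f v}"
    using e'(2) injD[OF assms(1)] by auto
  then show "\<exists>u\<in>f ` V. \<exists>v\<in>f ` V. u \<noteq> v \<and> e = {u, v}" by blast
qed (use assms(2) in \<open>simp add: graph_on_finite_verts\<close>)

section \<open>The Sierpinski graphs as glued copies\<close>

fun corner_of :: "nat \<Rightarrow> corner \<Rightarrow> real \<times> real" where
  "corner_of n Lft = (0, 0)"
| "corner_of n Rgt = right_corner n"
| "corner_of n Top = top_corner n"

definition copy :: "nat \<Rightarrow> corner \<Rightarrow> real \<times> real \<Rightarrow> real \<times> real" where
  "copy n i p = corner_of n i + p"

text \<open>Barycentric coordinates, scaled such that they add up to \<open>2^n\<close>. They are nonnegative on the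
vertices, and passing to copy \<open>j\<close> adds \<open>2^n\<close> to coordinate \<open>j\<close>.\<close>

fun bary :: "nat \<Rightarrow> corner \<Rightarrow> real \<times> real \<Rightarrow> real" where
  "bary n Lft p = 2 ^ n - fst p - snd p / sqrt 3"
| "bary n Rgt p = fst p - snd p / sqrt 3"
| "bary n Top p = 2 * snd p / sqrt 3"

lemma inj_copy: "inj (copy n i)"
  by (auto simp: copy_def intro: injI)

lemma corner_of_Suc: "corner_of (Suc n) i = corner_of n i + corner_of n i"
  by (cases i) (auto simp: right_corner_def top_corner_def zero_prod_def)

lemma corner_of_inj: "corner_of n i = corner_of n j \<Longrightarrow> i = j"
  by (cases i; cases j) (auto simp: right_corner_def top_corner_def)

lemma bary_corner: "bary n i (corner_of n j) = (if i = j then 2 ^ n else 0)"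
  by (cases i; cases j) (auto simp: right_corner_def top_corner_def)

lemma bary_copy: "bary (Suc n) i (copy n j p) = bary n i p + (if i = j then 2 ^ n else 0)"
  by (cases i; cases j) (auto simp: copy_def right_corner_def top_corner_def fst_add snd_add field_simps)

lemma bary_sum: "bary n Lft p + bary n Rgt p + bary n Top p = 2 ^ n"
  by (simp add: field_simps)

lemma bary_inj: "(\<And>i. bary n i p = bary n i q) \<Longrightarrow> p = q"
proof -
  assume *: "\<And>i. bary n i p = bary n i q"
  have "snd p = snd q" using *[of Top] by simp
  moreover have "fst p = fst q" using *[of Rgt] \<open>snd p = snd q\<close> by simp
  ultimately show "p = q" by (simp add: prod_eq_iff)
qed

declare bary.simps [simp del]

lemma verts_SG_Suc: "verts (SG (Suc n)) = (\<Union>i. copy n i ` verts (SG n))"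
proof -
  have "copy n Lft = id" by (auto simp: copy_def zero_prod_def[symmetric])
  moreover have "copy n Rgt = (+) (2 ^ n, 0)" "copy n Top = (+) (2 ^ n / 2, 2 ^ n / 2 * sqrt 3)"
    by (auto simp: copy_def fun_eq_iff right_corner_def top_corner_def)
  ultimately show ?thesis
    by (auto simp: corner_UNIV graph_union_def translate_def)
qed

lemma graph_edges_image:
  assumes "graph_on V E"
  shows "{{x + a, x + b} | a b. {a, b} \<in> E} = (`) ((+) x) ` E"
proof (intro equalityI subsetI)
  fix e assume "e \<in> (`) ((+) x) ` E"
  then obtain e' where e': "e' \<in> E" "e = (+) x ` e'" by blast
  then obtain u v where "e' = {u, v}"
    using assms unfolding graph_on_def by meson
  then show "e \<in> {{x + a, x + b} | a b. {a, b} \<in> E}" using e' by auto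
next
  fix e assume "e \<in> {{x + a, x + b} | a b. {a, b} \<in> E}"
  then obtain a b where "e = (+) x ` {a, b}" "{a, b} \<in> E" by auto
  then show "e \<in> (`) ((+) x) ` E" by blast
qed

lemma edges_SG_Suc:
  assumes "graph_on (verts (SG n)) (edges (SG n))"
  shows "edges (SG (Suc n)) = (\<Union>i. (`) (copy n i) ` edges (SG n))"
proof -
  have "copy n Lft = id" by (auto simp: copy_def zero_prod_def[symmetric])
  moreover have "copy n Rgt = (+) (2 ^ n, 0)" "copy n Top = (+) (2 ^ n / 2, 2 ^ n / 2 * sqrt 3)"
    by (auto simp: copy_def fun_eq_iff right_corner_def top_corner_def)
  moreover have "edges (SG (Suc n)) = edges (SG n) \<union> ((`) ((+) (2 ^ n, 0)) ` edges (SG n) \<union>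
      (`) ((+) (2 ^ n / 2, 2 ^ n / 2 * sqrt 3)) ` edges (SG n))"
    by (simp only: SG.simps(2) graph_union_def translate_def graph.select_convs graph_edges_image[OF assms])
  ultimately show ?thesis
    by (simp only: corner_UNIV) simp
qed

lemma SG_0:
  "verts (SG 0) = {corner_of 0 Lft, corner_of 0 Rgt, corner_of 0 Top}"
  "edges (SG 0) = {{corner_of 0 Lft, corner_of 0 Rgt}, {corner_of 0 Rgt, corner_of 0 Top},
     {corner_of 0 Lft, corner_of 0 Top}}"
  by (simp_all add: right_corner_def top_corner_def Let_def)

declare corner_of.simps [simp del] SG.simps [simp del]

lemma graph_on_SG: "graph_on (verts (SG n)) (edges (SG n))"
proof (induction n)
  case 0
  have "corner_of 0 Lft \<noteq> corner_of 0 Rgt" "corner_of 0 Rgt \<noteq> corner_of 0 Top" "corner_of 0 Lft \<noteq> corner_of 0 Top"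
    using corner_of_inj by blast+
  then show ?case unfolding graph_on_def SG_0 by blast
next
  case (Suc n)
  have "graph_on (copy n i ` verts (SG n)) ((`) (copy n i) ` edges (SG n))" for i
    by (rule graph_on_image[OF inj_copy Suc])
  then have *: "finite (copy n i ` verts (SG n))"
    "\<forall>e\<in>(`) (copy n i) ` edges (SG n). \<exists>u\<in>copy n i ` verts (SG n). \<exists>v\<in>copy n i ` verts (SG n). u \<noteq> v \<and> e = {u, v}"
    for i unfolding graph_on_def by blast+
  have "finite (UNIV :: corner set)" by (simp add: corner_UNIV)
  then have "finite (\<Union>i. copy n i ` verts (SG n))" using *(1) by blast
  moreover have "\<exists>u\<in>(\<Union>i. copy n i ` verts (SG n)). \<exists>v\<in>(\<Union>i. copy n i ` verts (SG n)). u \<noteq> v \<and> e = {u, v}"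
    if e: "e \<in> (\<Union>i. (`) (copy n i) ` edges (SG n))" for e
  proof -
    obtain i where "e \<in> (`) (copy n i) ` edges (SG n)" using e by blast
    then obtain u v where "u \<in> copy n i ` verts (SG n)" "v \<in> copy n i ` verts (SG n)" "u \<noteq> v" "e = {u, v}"
      using *(2) by meson
    then show ?thesis by blast
  qed
  ultimately show ?case
    unfolding graph_on_def verts_SG_Suc edges_SG_Suc[OF Suc] by (intro conjI ballI)
qed

lemmas edges_SG_Suc' = edges_SG_Suc[OF graph_on_SG]

lemma corner_of_in_SG: "corner_of n i \<in> verts (SG n)"
proof (induction n)
  case 0
  then show ?case unfolding SG_0 by (cases i) simp_all
next
  case (Suc n)
  have "corner_of (Suc n) i = copy n i (corner_of n i)" by (simp add: corner_of_Suc copy_def)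
  then show ?case unfolding verts_SG_Suc using Suc by blast
qed

lemma bary_nonneg: "p \<in> verts (SG n) \<Longrightarrow> 0 \<le> bary n i p"
proof (induction n arbitrary: p)
  case 0
  then obtain j where "p = corner_of 0 j" unfolding SG_0 by blast
  then show ?case by (simp add: bary_corner)
next
  case (Suc n)
  then obtain j q where "p = copy n j q" "q \<in> verts (SG n)" unfolding verts_SG_Suc by blast
  then show ?case using Suc.IH[of q] by (simp only: bary_copy) simp
qed

lemma bary_node: "bary (Suc n) k (corner_of n i + corner_of n j) =
    (if k = i then 2 ^ n else 0) + (if k = j then 2 ^ n else 0)"
  using bary_copy[of n k i "corner_of n j"] by (simp only: copy_def bary_corner)

text \<open>A common vertex has coordinates \<open>i\<close> and \<open>j\<close> at least \<open>2^n\<close>, and all three coordinates are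
nonnegative with sum \<open>2^(n+1)\<close>. This leaves only one possibility.\<close>

lemma copies_overlap:
  assumes "i \<noteq> j"
  shows "copy n i ` verts (SG n) \<inter> copy n j ` verts (SG n) = {corner_of n i + corner_of n j}"
proof (intro equalityI subsetI)
  fix p assume p: "p \<in> copy n i ` verts (SG n) \<inter> copy n j ` verts (SG n)"
  have ge: "2 ^ n \<le> bary (Suc n) a p" if pa: "p \<in> copy n a ` verts (SG n)" for a
  proof -
    obtain q where "p = copy n a q" "q \<in> verts (SG n)" using pa by blast
    then show ?thesis using bary_nonneg[of q n a] by (simp add: bary_copy)
  qed
  have "0 \<le> bary (Suc n) a p" for a
    using p bary_nonneg[of p "Suc n"] verts_SG_Suc by blast
  then have nn: "0 \<le> bary (Suc n) Lft p" "0 \<le> bary (Suc n) Rgt p" "0 \<le> bary (Suc n) Top p" by blast+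
  have gi: "2 ^ n \<le> bary (Suc n) i p" "2 ^ n \<le> bary (Suc n) j p" using ge p by blast+
  have "bary (Suc n) k p = bary (Suc n) k (corner_of n i + corner_of n j)" for k
    unfolding bary_node using assms nn gi bary_sum[of "Suc n" p]
    by (cases i; cases j; cases k) simp_all
  then have "p = corner_of n i + corner_of n j" by (rule bary_inj)
  then show "p \<in> {corner_of n i + corner_of n j}" by simp
next
  fix p assume "p \<in> {corner_of n i + corner_of n j}"
  then have "p = copy n i (corner_of n j)" "p = copy n j (corner_of n i)" by (auto simp: copy_def add.commute)
  then show "p \<in> copy n i ` verts (SG n) \<inter> copy n j ` verts (SG n)"
    using corner_of_in_SG by blast
qed

lemma SG_gluing:
  "gluing (\<lambda>i. copy n i ` verts (SG n)) (\<lambda>i. (`) (copy n i) ` edges (SG n)) (\<lambda>i j. copy n i (corner_of n j))"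
proof
  show "graph_on (copy n i ` verts (SG n)) ((`) (copy n i) ` edges (SG n))" for i
    by (rule graph_on_image[OF inj_copy graph_on_SG])
  show "copy n i (corner_of n j) = copy n j (corner_of n i)" for i j
    by (simp add: copy_def add.commute)
  show "copy n i (corner_of n j) \<in> copy n i ` verts (SG n)" for i j
    using corner_of_in_SG by blast
  show "copy n i ` verts (SG n) \<inter> copy n j ` verts (SG n) = {copy n i (corner_of n j)}" if "i \<noteq> j" for i j
    using copies_overlap[OF that] by (simp add: copy_def)
  show "copy n i (corner_of n j) \<noteq> copy n i (corner_of n k)" if "j \<noteq> k" for i j k
    using that corner_of_inj by (auto simp: copy_def)
qed

lemma card_verts_SG: "card (verts (SG (Suc n))) + 3 = 3 * card (verts (SG n))"
proof -
  let ?W = "\<lambda>i. copy n i ` verts (SG n)"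
  interpret gluing ?W "\<lambda>i. (`) (copy n i) ` edges (SG n)" "\<lambda>i j. copy n i (corner_of n j)"
    by (rule SG_gluing)
  let ?m = "\<lambda>i j. copy n i (corner_of n j)"
  have fin: "finite (?W i)" for i using graph_on_finite_verts[OF graph_on_SG] by blast
  have card: "card (?W i) = card (verts (SG n))" for i
    by (rule card_image[OF inj_on_subset[OF inj_copy]]) simp
  have 1: "card (?W Lft \<union> ?W Rgt) + 1 = 2 * card (verts (SG n))"
    using card_Un_Int[OF fin[of Lft] fin[of Rgt]] overlap[of Lft Rgt] card by simp
  have "(?W Lft \<union> ?W Rgt) \<inter> ?W Top = {?m Lft Top} \<union> {?m Rgt Top}"
    using overlap[of Lft Top] overlap[of Rgt Top] by (simp add: Int_Un_distrib2)
  moreover have "?m Lft Top \<noteq> ?m Rgt Top"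
    using corner_of_inj[of n Lft Rgt] by (auto simp: copy_def)
  ultimately have "card ((?W Lft \<union> ?W Rgt) \<inter> ?W Top) = 2" by simp
  then have "card (?W Lft \<union> ?W Rgt \<union> ?W Top) + 2 = card (?W Lft \<union> ?W Rgt) + card (verts (SG n))"
    using card_Un_Int[of "?W Lft \<union> ?W Rgt" "?W Top"] fin card by simp
  moreover have "verts (SG (Suc n)) = ?W Lft \<union> ?W Rgt \<union> ?W Top"
    unfolding verts_SG_Suc by (auto simp: corner_UNIV)
  ultimately show ?thesis using 1 by simp
qed

lemma card_verts_SG_eq: "2 * card (verts (SG n)) = 3 ^ Suc n + 3"
proof (induction n)
  case 0
  have "corner_of 0 Lft \<noteq> corner_of 0 Rgt" "corner_of 0 Rgt \<noteq> corner_of 0 Top" "corner_of 0 Lft \<noteq> corner_of 0 Top"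
    using corner_of_inj by blast+
  then show ?case unfolding SG_0 by simp
next
  case (Suc n)
  then show ?case using card_verts_SG[of n] by simp
qed

lemma card_edges_SG: "card (edges (SG n)) = 3 ^ Suc n"
proof (induction n)
  case 0
  have "corner_of 0 Lft \<noteq> corner_of 0 Rgt" "corner_of 0 Rgt \<noteq> corner_of 0 Top" "corner_of 0 Lft \<noteq> corner_of 0 Top"
    using corner_of_inj by blast+
  then show ?case unfolding SG_0 by (simp add: doubleton_eq_iff)
next
  case (Suc n)
  interpret gluing "\<lambda>i. copy n i ` verts (SG n)" "\<lambda>i. (`) (copy n i) ` edges (SG n)" "\<lambda>i j. copy n i (corner_of n j)"
    by (rule SG_gluing)
  have "inj ((`) (copy n i))" for i using inj_copy by (metis inj_image_eq_iff injI)
  then have c: "card ((`) (copy n i) ` edges (SG n)) = 3 ^ Suc n" for i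
    using Suc card_image[OF inj_on_subset] by (metis subset_UNIV)
  have "card (\<Union>i\<in>UNIV. (`) (copy n i) ` edges (SG n)) = (\<Sum>i\<in>UNIV. card ((`) (copy n i) ` edges (SG n)))"
    using graph_on_finite_edges[OF graph_on_SG[of n]] edges_disjoint
    by (intro card_UN_disjoint) (auto simp: corner_UNIV simp del: Union_iff)
  then show ?case unfolding edges_SG_Suc' c by (simp add: corner_UNIV)
qed

lemma card_edges_at_corner: "card {e \<in> edges (SG n). corner_of n i \<in> e} \<le> 2"
proof (induction n)
  case 0
  have "corner_of 0 Lft \<noteq> corner_of 0 Rgt" "corner_of 0 Rgt \<noteq> corner_of 0 Top" "corner_of 0 Lft \<noteq> corner_of 0 Top"
    using corner_of_inj by blast+
  then have "{e \<in> edges (SG 0). corner_of 0 i \<in> e} \<subseteq> (\<lambda>j. {corner_of 0 i, corner_of 0 j}) ` ({Lft, Rgt, Top} - {i})"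
    unfolding SG_0 by (cases i) auto
  then have "card {e \<in> edges (SG 0). corner_of 0 i \<in> e} \<le> card ({Lft, Rgt, Top} - {i})"
    by (intro surj_card_le) auto
  then show ?case by (cases i) auto
next
  case (Suc n)
  interpret gluing "\<lambda>i. copy n i ` verts (SG n)" "\<lambda>i. (`) (copy n i) ` edges (SG n)" "\<lambda>i j. copy n i (corner_of n j)"
    by (rule SG_gluing)
  have c: "corner_of (Suc n) i = copy n i (corner_of n i)" by (simp add: corner_of_Suc copy_def)
  have "{e \<in> edges (SG (Suc n)). corner_of (Suc n) i \<in> e} \<subseteq>
      (`) (copy n i) ` {e \<in> edges (SG n). corner_of n i \<in> e}"
  proof
    fix e assume e: "e \<in> {e \<in> edges (SG (Suc n)). corner_of (Suc n) i \<in> e}"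
    then obtain k e' where e': "e' \<in> edges (SG n)" "e = copy n k ` e'" unfolding edges_SG_Suc' by blast
    obtain a b where "a \<in> verts (SG n)" "b \<in> verts (SG n)" "e' = {a, b}"
      using graph_on_SG[of n] e'(1) unfolding graph_on_def by meson
    then have "e' \<subseteq> verts (SG n)" by simp
    then have "copy n i (corner_of n i) \<in> copy n k ` verts (SG n)" using e e' c by auto
    then have "k = i" using corner_not_shared[of k i] by blast
    moreover from this have "corner_of n i \<in> e'"
      using e e'(2) c inj_image_mem_iff[OF inj_copy[of n i]] by simp
    ultimately show "e \<in> (`) (copy n i) ` {e \<in> edges (SG n). corner_of n i \<in> e}" using e' by blast
  qed
  then have "card {e \<in> edges (SG (Suc n)). corner_of (Suc n) i \<in> e} \<le> card {e \<in> edges (SG n). corner_of n i \<in> e}"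
    using graph_on_finite_edges[OF graph_on_SG[of n]] by (intro surj_card_le) auto
  then show ?case using Suc by simp
qed

lemma nbs_SG_nonempty: "v \<in> verts (SG n) \<Longrightarrow> nbs (edges (SG n)) v \<noteq> {}"
proof (induction n arbitrary: v)
  case 0
  then consider "v = corner_of 0 Lft" | "v = corner_of 0 Rgt" | "v = corner_of 0 Top"
    unfolding SG_0 by blast
  then show ?case
  proof cases
    case 1
    then have "corner_of 0 Rgt \<in> nbs (edges (SG 0)) v" unfolding nbs_def SG_0 by simp
    then show ?thesis by blast
  next
    case 2
    then have "corner_of 0 Top \<in> nbs (edges (SG 0)) v" unfolding nbs_def SG_0 by simp
    then show ?thesis by blast
  next
    case 3
    then have "corner_of 0 Lft \<in> nbs (edges (SG 0)) v" unfolding nbs_def SG_0 by (simp add: insert_commute)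
    then show ?thesis by blast
  qed
next
  case (Suc n)
  then obtain i u where u: "v = copy n i u" "u \<in> verts (SG n)" unfolding verts_SG_Suc by blast
  then obtain w where "{u, w} \<in> edges (SG n)" using Suc.IH[of u] by (auto simp: nbs_def)
  then have "copy n i ` {u, w} \<in> edges (SG (Suc n))" unfolding edges_SG_Suc' by blast
  then have "copy n i w \<in> nbs (edges (SG (Suc n))) v" using u by (simp add: nbs_def)
  then show ?case by blast
qed

section \<open>The recursion for the spanning polynomials\<close>

text \<open>The generating polynomials, in the number of surplus edges, of the edge sets that are of types
\<open>Joined\<close>, \<open>Apart c\<close> and \<open>Separate\<close>, respectively. In the recursion a factor \<open>X\<close> marks the
cases in which the ring of the three copies is closed, which creates one additional cycle.\<close>

primrec corner_polys :: "nat \<Rightarrow> int poly \<times> int poly \<times> int poly" where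
  "corner_polys 0 = ([:3, 1:], 1, 1)"
| "corner_polys (Suc n) = (case corner_polys n of (a, b, c) \<Rightarrow>
     (6 * (a * a * b) + [:0, 1:] * (a * a * a),
      a * a * c + 7 * (a * b * b) + [:0, 1:] * (a * a * b),
      14 * (b * b * b) + 12 * (a * b * c) + [:0, 1:] * (3 * (a * b * b))))"

text \<open>A forest of type \<open>Joined\<close> has two edges more than one of type \<open>Separate\<close>, a forest of type
\<open>Apart c\<close> one. These factors and the power of \<open>X\<close> in \<open>span_poly_SG\<close> turn the number of
surplus edges into the number of edges.\<close>

fun corner_poly :: "int poly \<times> int poly \<times> int poly \<Rightarrow> ctype \<Rightarrow> int poly" where
  "corner_poly (a, b, c) Joined = [:0, 1:] * [:0, 1:] * a"
| "corner_poly (a, b, c) (Apart _) = [:0, 1:] * b"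
| "corner_poly (a, b, c) Separate = c"

lemma Pow_triple: "Pow {a, b, c} = {{}, {a}, {b}, {c}, {a, b}, {a, c}, {b, c}, {a, b, c}}"
  unfolding Pow_insert Pow_empty by auto

lemma sum_monom_card_pairs:
  assumes "a \<noteq> b" "a \<noteq> c" "b \<noteq> c"
  shows "(\<Sum>H\<in>{{a, b}, {a, c}, {b, c}, {a, b, c}}. monom (1::int) (card H)) =
    monom 1 2 + (monom 1 2 + (monom 1 2 + monom 1 3))"
proof -
  have "{a, b} \<noteq> {a, c}" "{a, b} \<noteq> {b, c}" "{a, c} \<noteq> {b, c}"
    "{a, b} \<noteq> {a, b, c}" "{a, c} \<noteq> {a, b, c}" "{b, c} \<noteq> {a, b, c}"
    using assms by auto
  then show ?thesis using assms by (simp add: numeral_2_eq_2 numeral_3_eq_3)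
qed

lemma span_poly_triangle:
  assumes d: "q Lft \<noteq> q Rgt" "q Rgt \<noteq> q Top" "q Lft \<noteq> q Top"
  shows "span_poly {q Lft, q Rgt, q Top} {{q Lft, q Rgt}, {q Rgt, q Top}, {q Lft, q Top}} q t =
    corner_poly ([:3, 1:], 1, 1) t"
proof -
  let ?V = "{q Lft, q Rgt, q Top}" and ?a = "{q Lft, q Rgt}" and ?b = "{q Rgt, q Top}" and ?c = "{q Lft, q Top}"
  have dd: "?a \<noteq> ?b" "?a \<noteq> ?c" "?b \<noteq> ?c" using d by (auto simp: doubleton_eq_iff)
  have L: "linked ?V (range q) H" for H
    unfolding linked_def by auto
  have spansI: "spans ?V q t H" if "\<And>j k. joined H (q j) (q k) \<longleftrightarrow> conn t j k" for t H
    using that L by (simp add: spans_def)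
  have qinj: "q j = q k \<longleftrightarrow> j = k" for j k using d by (cases j; cases k) auto
  have s0: "spans ?V q Separate {}"
  proof (rule spansI)
    have "joined {} x y \<Longrightarrow> x = y" for x y :: 'a by (erule rtranclp.cases) auto
    then show "joined {} (q j) (q k) \<longleftrightarrow> conn Separate j k" for j k using qinj by auto
  qed
  have one: "joined {{x, y}} u v \<longleftrightarrow> u = v \<or> {u, v} = {x, y}" for x y u v :: 'a
  proof
    show "joined {{x, y}} u v \<Longrightarrow> u = v \<or> {u, v} = {x, y}"
      by (induction rule: rtranclp_induct) (auto simp: doubleton_eq_iff)
    show "u = v \<or> {u, v} = {x, y} \<Longrightarrow> joined {{x, y}} u v"
      by (auto intro: r_into_rtranclp)
  qed
  have s1: "spans ?V q (Apart Top) {?a}" "spans ?V q (Apart Lft) {?b}" "spans ?V q (Apart Rgt) {?c}"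
    by (rule spansI, unfold one, rename_tac j k, case_tac j; case_tac k; simp add: qinj doubleton_eq_iff)+
  have all: "spans ?V q Joined H" if "{e, f} \<subseteq> H" "e \<noteq> f" "e \<in> {?a, ?b, ?c}" "f \<in> {?a, ?b, ?c}" for H e f
  proof (rule spansI)
    have "(?a \<in> H \<and> ?b \<in> H) \<or> (?a \<in> H \<and> ?c \<in> H) \<or> (?b \<in> H \<and> ?c \<in> H)" using that by auto
    then obtain i where i: "\<And>j. j \<noteq> i \<Longrightarrow> {q i, q j} \<in> H"
    proof (elim disjE conjE)
      assume "?a \<in> H" "?b \<in> H"
      then show thesis using that[of Rgt] by (metis corner.exhaust insert_commute)
    next
      assume "?a \<in> H" "?c \<in> H"
      then show thesis using that[of Lft] by (metis corner.exhaust insert_commute)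
    next
      assume "?b \<in> H" "?c \<in> H"
      then show thesis using that[of Top] by (metis corner.exhaust insert_commute)
    qed
    have star: "joined H (q i) (q j)" for j
      using i[of j] by (cases "j = i") (auto intro: r_into_rtranclp)
    show "joined H (q j) (q k) \<longleftrightarrow> conn Joined j k" for j k
      using rtranclp_trans[OF joined_sym[OF star[of j]] star[of k]] by simp
  qed
  \<comment> \<open>Any two sides of the triangle already connect the three corners.\<close>
  have s2: "spans ?V q Joined {?a, ?b}" "spans ?V q Joined {?a, ?c}" "spans ?V q Joined {?b, ?c}"
      "spans ?V q Joined {?a, ?b, ?c}"
    by (rule all[of ?a ?b], simp, rule dd(1), simp, simp)
      (rule all[of ?a ?c], simp, rule dd(2), simp, simp,
       rule all[of ?b ?c], simp, rule dd(3), simp, simp,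
       rule all[of ?a ?b], simp, rule dd(1), simp, simp)
  have sp: "spans ?V q t H \<longleftrightarrow> t = t'" if "spans ?V q t' H" for t t' H
    using that spans_unique by blast
  have P: "H \<subseteq> {?a, ?b, ?c} \<longleftrightarrow> H \<in> {{}, {?a}, {?b}, {?c}, {?a, ?b}, {?a, ?c}, {?b, ?c}, {?a, ?b, ?c}}" for H
  proof -
    have "H \<subseteq> {?a, ?b, ?c} \<longleftrightarrow> H \<in> Pow {?a, ?b, ?c}" by blast
    also have "\<dots> \<longleftrightarrow> H \<in> {{}, {?a}, {?b}, {?c}, {?a, ?b}, {?a, ?c}, {?b, ?c}, {?a, ?b, ?c}}"
      unfolding Pow_triple ..
    finally show ?thesis .
  qed
  have set: "{H. H \<subseteq> {?a, ?b, ?c} \<and> spans ?V q t H} =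
     (case t of Joined \<Rightarrow> {{?a, ?b}, {?a, ?c}, {?b, ?c}, {?a, ?b, ?c}}
       | Apart Top \<Rightarrow> {{?a}} | Apart Lft \<Rightarrow> {{?b}} | Apart Rgt \<Rightarrow> {{?c}} | Separate \<Rightarrow> {{}})"
  proof -
    have "{H. H \<subseteq> {?a, ?b, ?c} \<and> spans ?V q t H} =
      {H \<in> {{}, {?a}, {?b}, {?c}, {?a, ?b}, {?a, ?c}, {?b, ?c}, {?a, ?b, ?c}}. spans ?V q t H}"
      unfolding P by blast
    also have "\<dots> = (case t of Joined \<Rightarrow> {{?a, ?b}, {?a, ?c}, {?b, ?c}, {?a, ?b, ?c}}
       | Apart Top \<Rightarrow> {{?a}} | Apart Lft \<Rightarrow> {{?b}} | Apart Rgt \<Rightarrow> {{?c}} | Separate \<Rightarrow> {{}})"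
      (is "?l = ?r")
    proof -
      have filt: "{H \<in> insert x X. Q H} = (if Q x then insert x {H \<in> X. Q H} else {H \<in> X. Q H})"
        "{H \<in> {}. Q H} = {}" for x :: "'a set set" and X Q by auto
      show "?l = ?r"
        by (unfold filt sp[OF s0] sp[OF s1(1)] sp[OF s1(2)] sp[OF s1(3)]
          sp[OF s2(1)] sp[OF s2(2)] sp[OF s2(3)] sp[OF s2(4)], cases t, simp,
          rename_tac c, case_tac c, simp, simp, simp, simp)
    qed
    finally show ?thesis .
  qed
  have X: "monom (1::int) 2 = [:0, 1:] * [:0, 1:]" "monom (1::int) 3 = [:0, 1:] * [:0, 1:] * [:0, 1:]"
    "monom (1::int) (Suc 0) = [:0, 1:]"
    by (simp_all add: numeral_eq_Suc monom_Suc monom_0)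
  show ?thesis
  proof (cases t)
    case Joined
    have "span_poly ?V {?a, ?b, ?c} q t = monom 1 2 + (monom 1 2 + (monom 1 2 + monom 1 3))"
      unfolding span_poly_def set unfolding Joined ctype.case by (rule sum_monom_card_pairs[OF dd])
    also have "\<dots> = corner_poly ([:3, 1:], 1, 1) t" unfolding X Joined by simp
    finally show ?thesis .
  next
    case (Apart c)
    then show ?thesis unfolding span_poly_def set by (cases c) (simp_all add: X)
  next
    case Separate
    then show ?thesis unfolding span_poly_def set by (simp add: monom_0)
  qed
qed

lemma span_poly_SG:
  "span_poly (verts (SG n)) (edges (SG n)) (corner_of n) t =
    monom 1 (card (verts (SG n)) - 3) * corner_poly (corner_polys n) t"
proof (induction n arbitrary: t)
  case 0
  have d: "corner_of 0 Lft \<noteq> corner_of 0 Rgt" "corner_of 0 Rgt \<noteq> corner_of 0 Top" "corner_of 0 Lft \<noteq> corner_of 0 Top"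
    using corner_of_inj by blast+
  have "card (verts (SG 0)) = 3" using card_verts_SG_eq[of 0] by simp
  then show ?case unfolding SG_0 span_poly_triangle[OF d] by (simp add: monom_0)
next
  case (Suc n)
  interpret gluing "\<lambda>i. copy n i ` verts (SG n)" "\<lambda>i. (`) (copy n i) ` edges (SG n)" "\<lambda>i j. copy n i (corner_of n j)"
    by (rule SG_gluing)
  obtain a b c where abc: "corner_polys n = (a, b, c)" by (cases "corner_polys n") auto
  let ?N = "card (verts (SG n))"
  let ?M = "monom (1::int) (?N - 3)" and ?X = "[:0, 1:] :: int poly"
  have c: "corner_of (Suc n) = (\<lambda>i. copy n i (corner_of n i))" by (auto simp: corner_of_Suc copy_def)
  have "span_poly (verts (SG (Suc n))) (edges (SG (Suc n))) (corner_of (Suc n)) t =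
    (\<Sum>\<tau> | glues_to \<tau> t. \<Prod>i\<in>UNIV. ?M * corner_poly (a, b, c) (\<tau> i))"
    unfolding verts_SG_Suc edges_SG_Suc' c span_poly_glued span_poly_image[OF inj_copy] Suc abc ..
  also have "\<dots> = ?M * ?M * ?M * (?X * ?X * ?X) * corner_poly (corner_polys (Suc n)) t"
  proof -
    note u = sum_glues_to_uniform[of "\<lambda>s. ?M * corner_poly (a, b, c) s" "?M * (?X * ?X * a)" "?M * (?X * b)" "?M * c"]
    show ?thesis
      by (cases t) (simp_all only: u corner_poly.simps abc corner_polys.simps(2) case_prod_conv, simp_all only: algebra_simps)
  qed
  also have "?M * ?M * ?M * (?X * ?X * ?X) = monom 1 (card (verts (SG (Suc n))) - 3)"
  proof -
    have "1 \<le> (3::nat) ^ n" by simp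
    then have "3 \<le> ?N" using card_verts_SG_eq[of n] unfolding power_Suc by linarith
    then have "card (verts (SG (Suc n))) - 3 = (?N - 3) + (?N - 3) + (?N - 3) + 3"
      using card_verts_SG[of n] by simp
    moreover have "?X * ?X * ?X = monom 1 3" by (simp add: numeral_eq_Suc monom_Suc monom_0)
    ultimately show ?thesis by (simp only: mult_monom mult_1)
  qed
  finally show ?case .
qed

lemma coeff_span_poly:
  assumes "finite E"
  shows "coeff (span_poly V E q t) m = int (card {H. H \<subseteq> E \<and> spans V q t H \<and> card H = m})"
proof -
  let ?F = "{H. H \<subseteq> E \<and> spans V q t H}"
  have fin: "finite ?F" using assms by (rule finite_subset[rotated, OF finite_Pow_iff[THEN iffD2]]) auto
  have "coeff (span_poly V E q t) m = (\<Sum>H\<in>?F. if card H = m then 1 else 0)"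
    by (simp add: span_poly_def coeff_sum)
  also have "\<dots> = int (card (?F \<inter> {H. card H = m}))"
    using fin by (simp add: sum.If_cases)
  also have "?F \<inter> {H. card H = m} = {H. H \<subseteq> E \<and> spans V q t H \<and> card H = m}" by blast
  finally show ?thesis .
qed

text \<open>The bottom left corner must be connected to one of the two others, which excludes the two types in
which it is isolated.\<close>

lemma linked_two_corners:
  "linked V {q Top, q Rgt} H \<longleftrightarrow>
    spans V q Joined H \<or> spans V q (Apart Top) H \<or> spans V q (Apart Rgt) H" if qV: "q Lft \<in> V"
proof
  assume L: "linked V {q Top, q Rgt} H"
  then have "linked V (range q) H" unfolding linked_def by blast
  then obtain t where t: "spans V q t H" using spans_exists by blast
  have "joined H (q Lft) (q Top) \<or> joined H (q Lft) (q Rgt)" using L qV unfolding linked_def by blast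
  then have "conn t Lft Top \<or> conn t Lft Rgt" using t by (simp add: spans_def)
  then have "t \<in> {Joined, Apart Top, Apart Rgt}"
    by (cases t; simp) (metis corner.exhaust)
  then show "spans V q Joined H \<or> spans V q (Apart Top) H \<or> spans V q (Apart Rgt) H" using t by blast
next
  assume "spans V q Joined H \<or> spans V q (Apart Top) H \<or> spans V q (Apart Rgt) H"
  then obtain t where t: "spans V q t H" "t \<in> {Joined, Apart Top, Apart Rgt}" by blast
  show "linked V {q Top, q Rgt} H"
    unfolding linked_def
  proof
    fix v assume "v \<in> V"
    then obtain j where j: "joined H v (q j)" using t(1) unfolding spans_def linked_def by blast
    have "\<exists>k\<in>{Top, Rgt}. conn t j k" using t(2) by (cases j) auto
    then obtain k where "k \<in> {Top, Rgt}" "joined H (q j) (q k)" using t(1) by (auto simp: spans_def)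
    then show "\<exists>s\<in>{q Top, q Rgt}. joined H v s" using rtranclp_trans[OF j] by blast
  qed
qed

lemma card_spanners_corners:
  assumes "graph_on V E" "q Lft \<in> V"
  shows "int (card (spanners V E {q Top, q Rgt} m)) =
    coeff (span_poly V E q Joined) m + coeff (span_poly V E q (Apart Top)) m
    + coeff (span_poly V E q (Apart Rgt)) m"
proof -
  let ?F = "\<lambda>t. {H. H \<subseteq> E \<and> spans V q t H \<and> card H = m}"
  have finE: "finite E" by (rule graph_on_finite_edges[OF assms(1)])
  have fin: "finite (?F t)" for t
    using finE by (rule finite_subset[rotated, OF finite_Pow_iff[THEN iffD2]]) auto
  have dis: "?F s \<inter> ?F t = {}" if "s \<noteq> t" for s t
    using spans_unique[of V q s _ t] that by blast
  have 1: "spanners V E {q Top, q Rgt} m = ?F Joined \<union> ?F (Apart Top) \<union> ?F (Apart Rgt)"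
    unfolding spanners_def linked_two_corners[of q V, OF assms(2)] by blast
  have 2: "card (?F Joined \<union> ?F (Apart Top) \<union> ?F (Apart Rgt)) =
      card (?F Joined) + card (?F (Apart Top)) + card (?F (Apart Rgt))"
  proof -
    have "card (?F Joined \<union> ?F (Apart Top)) = card (?F Joined) + card (?F (Apart Top))"
      by (rule card_Un_disjoint[OF fin fin dis]) simp
    moreover have "(?F Joined \<union> ?F (Apart Top)) \<inter> ?F (Apart Rgt) = {}"
      unfolding Int_Un_distrib2 using dis[of Joined "Apart Rgt"] dis[of "Apart Top" "Apart Rgt"] by simp
    ultimately show ?thesis
      using card_Un_disjoint[of "?F Joined \<union> ?F (Apart Top)" "?F (Apart Rgt)"] fin by (simp only: finite_Un simp_thms)
  qed
  show ?thesis unfolding 1 2 by (simp add: coeff_span_poly[OF finE])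
qed

lemma sinks_eq: "sinks n = {corner_of n Top, corner_of n Rgt}"
  by (simp add: sinks_def corner_of.simps)

lemma sinks_subset: "sinks n \<subset> verts (SG n)"
proof -
  have "corner_of n Lft \<notin> sinks n" using corner_of_inj[of n Lft] by (auto simp: sinks_eq)
  then show ?thesis using corner_of_in_SG unfolding sinks_eq by blast
qed

lemma card_minus_sinks: "card (verts (SG n) - sinks n) + 2 = card (verts (SG n))"
proof -
  have "corner_of n Top \<noteq> corner_of n Rgt" using corner_of_inj by blast
  then have "card (sinks n) = 2" by (simp add: sinks_eq)
  moreover have "finite (sinks n)" by (simp add: sinks_eq)
  moreover have "card (sinks n) \<le> card (verts (SG n))"
    using sinks_subset graph_on_finite_verts[OF graph_on_SG] by (intro card_mono) auto
  ultimately show ?thesis using sinks_subset[of n] by (simp add: card_Diff_subset less_imp_le)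
qed

lemma card_verts_ge_3: "3 \<le> card (verts (SG n))"
proof -
  have "1 \<le> (3::nat) ^ n" by simp
  then show ?thesis using card_verts_SG_eq[of n] unfolding power_Suc by linarith
qed

text \<open>If an edge set of type \<open>Joined\<close> is a tree on the Sierpinski graph itself, then identifying the two
sinks closes a cycle. It therefore contributes to the unicyclic subgraphs and not to the trees.\<close>

lemma spanning_counts_SG:
  assumes "corner_polys n = (a, b, c)"
  shows "int (num_trees (verts (SG n)) (edges (SG n)) (sinks n)) = 2 * coeff b 0"
    and "int (num_unicyclic (verts (SG n)) (edges (SG n)) (sinks n)) = coeff a 0 + 2 * coeff b 1"
proof -
  obtain K where K: "card (verts (SG n)) = K + 3" using card_verts_ge_3[of n] by (metis add.commute le_Suc_ex)
  then have m: "card (verts (SG n) - sinks n) = Suc K" using card_minus_sinks[of n] by simp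
  note cs = card_spanners_corners[where q = "corner_of n", OF graph_on_SG[of n] corner_of_in_SG[of n Lft],
      folded sinks_eq]
  note s = span_poly_SG[of n, unfolded K assms]
  have [simp]: "Suc K - K = 1" "Suc (Suc K) - K = Suc 1" by simp_all
  show "int (num_trees (verts (SG n)) (edges (SG n)) (sinks n)) = 2 * coeff b 0"
    unfolding num_trees_def m cs s corner_poly.simps coeff_monom_mult by simp
  show "int (num_unicyclic (verts (SG n)) (edges (SG n)) (sinks n)) = coeff a 0 + 2 * coeff b 1"
    unfolding num_unicyclic_def m cs s corner_poly.simps coeff_monom_mult by simp
qed

section \<open>Convergence\<close>

lemma coeff_mult_Suc_0: "coeff (p * q) (Suc 0) = coeff p 0 * coeff q (Suc 0) + coeff p (Suc 0) * coeff q 0"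
  for p q :: "int poly"
  by (simp add: coeff_mult)

lemma coeff_numeral_poly:
  "coeff (numeral k :: int poly) 0 = numeral k" "coeff (numeral k :: int poly) (Suc m) = 0"
  by (simp_all add: numeral_poly)

text \<open>\<open>tA\<close>, \<open>tB\<close>, \<open>tC\<close> count the forests of the three kinds of types, and \<open>uA\<close>, \<open>uB\<close>, \<open>uC\<close>
count the edge sets of these types with one surplus edge.\<close>

definition "tA n = real_of_int (coeff (fst (corner_polys n)) 0)"
definition "tB n = real_of_int (coeff (fst (snd (corner_polys n))) 0)"
definition "tC n = real_of_int (coeff (snd (snd (corner_polys n))) 0)"
definition "uA n = real_of_int (coeff (fst (corner_polys n)) 1)"
definition "uB n = real_of_int (coeff (fst (snd (corner_polys n))) 1)"
definition "uC n = real_of_int (coeff (snd (snd (corner_polys n))) 1)"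

lemma forest_recursion:
  "tA (Suc n) = 6 * (tA n * tA n * tB n)"
  "tB (Suc n) = tA n * tA n * tC n + 7 * (tA n * tB n * tB n)"
  "tC (Suc n) = 14 * (tB n * tB n * tB n) + 12 * (tA n * tB n * tC n)"
  by (simp_all add: tA_def tB_def tC_def split: prod.split) 
    (auto simp: coeff_mult_0 coeff_numeral_poly)

lemma surplus_recursion:
  "uA (Suc n) = 12 * tA n * uA n * tB n + 6 * tA n ^ 2 * uB n + tA n ^ 3"
  "uB (Suc n) = 2 * tA n * uA n * tC n + tA n ^ 2 * uC n + 7 * uA n * tB n ^ 2 + 14 * tA n * tB n * uB n
     + tA n ^ 2 * tB n"
  "uC (Suc n) = 42 * tB n ^ 2 * uB n + 12 * (uA n * tB n * tC n + tA n * uB n * tC n + tA n * tB n * uC n)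
     + 3 * tA n * tB n ^ 2"
  by (simp_all add: uA_def uB_def uC_def tA_def tB_def tC_def split: prod.split)
    (auto simp: coeff_mult_0 coeff_numeral_poly coeff_mult_Suc_0 algebra_simps power2_eq_square power3_eq_cube)

lemma initial_counts: "tA 0 = 3" "tB 0 = 1" "tC 0 = 1" "uA 0 = 1" "uB 0 = 0" "uC 0 = 0"
  by (simp_all add: tA_def tB_def tC_def uA_def uB_def uC_def)

text \<open>The invariant \<open>tA n * tC n = 3 * (tB n)^2\<close> turns the recursion for the forests into one with a
single monomial on each right-hand side.\<close>

lemma forest_counts_positive: "0 < tA n \<and> 0 < tB n \<and> 0 < tC n \<and> tC n = 3 * tB n ^ 2 / tA n"
proof (induction n)
  case 0
  then show ?case by (simp add: initial_counts)
next
  case (Suc n)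
  then have a: "0 < tA n" and b: "0 < tB n" and c: "tC n = 3 * tB n ^ 2 / tA n" by auto
  have "tB (Suc n) = 10 * tA n * tB n ^ 2" "tC (Suc n) = 50 * tB n ^ 3"
    unfolding forest_recursion c using a by (simp_all add: field_simps power2_eq_square power3_eq_cube)
  moreover have "tA (Suc n) = 6 * tA n ^ 2 * tB n" unfolding forest_recursion by (simp add: power2_eq_square)
  ultimately show ?case using a b
    by (simp add: field_simps power2_eq_square power3_eq_cube)
qed

lemma forest_recursion_monomial:
  "tA (Suc n) = 6 * tA n ^ 2 * tB n" "tB (Suc n) = 10 * tA n * tB n ^ 2" "tC (Suc n) = 50 * tB n ^ 3"
  using forest_counts_positive[of n] unfolding forest_recursion by (simp_all add: field_simps power2_eq_square power3_eq_cube)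

lemma ratio_AB: "tA n / tB n = 3 * (3 / 5) ^ n"
proof (induction n)
  case 0
  then show ?case by (simp add: initial_counts)
next
  case (Suc n)
  have "tA (Suc n) / tB (Suc n) = 3 / 5 * (tA n / tB n)"
    using forest_counts_positive[of n] unfolding forest_recursion_monomial by (simp add: field_simps power2_eq_square)
  then show ?case using Suc by simp
qed

definition "xA n = uA n / tA n / 3 ^ n"
definition "xB n = uB n / tB n / 3 ^ n"
definition "xC n = uC n / tC n / 3 ^ n"

text \<open>The coefficients in each row of this linear recursion add up to \<open>1\<close>. The perturbation
\<open>\<rho> n\<close> is the ratio of \<open>ratio_AB\<close> divided by \<open>3^n\<close>; it stems from the configurations with a
closed ring.\<close>

lemma quotient_recursion:
  defines "\<rho> \<equiv> \<lambda>n. 3 * (1 / 5) ^ n :: real"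
  shows "xA (Suc n) = (2 * xA n + xB n) / 3 + \<rho> n / 18"
    and "xB (Suc n) = (13 * xA n + 14 * xB n + 3 * xC n) / 30 + \<rho> n / 30"
    and "xC (Suc n) = (36 * xA n + 78 * xB n + 36 * xC n) / 150 + \<rho> n / 50"
proof -
  have a: "0 < tA n" and b: "0 < tB n" and c: "tC n = 3 * tB n ^ 2 / tA n" using forest_counts_positive[of n] by auto
  have \<rho>: "\<rho> n = tA n / tB n / 3 ^ n"
    unfolding ratio_AB \<rho>_def by (simp add: power_divide field_simps flip: power_mult_distrib)
  have three: "(0::real) < 3 ^ n" by simp
  show "xA (Suc n) = (2 * xA n + xB n) / 3 + \<rho> n / 18"
    unfolding xA_def xB_def \<rho> surplus_recursion forest_recursion_monomial using a b three
    by (simp add: field_simps power2_eq_square power3_eq_cube)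
  show "xB (Suc n) = (13 * xA n + 14 * xB n + 3 * xC n) / 30 + \<rho> n / 30"
    unfolding xA_def xB_def xC_def \<rho> surplus_recursion forest_recursion_monomial c using a b three
    by (simp add: field_simps power2_eq_square power3_eq_cube)
  show "xC (Suc n) = (36 * xA n + 78 * xB n + 36 * xC n) / 150 + \<rho> n / 50"
    unfolding xA_def xB_def xC_def \<rho> surplus_recursion forest_recursion_monomial c using a b three
    by (simp add: field_simps power2_eq_square power3_eq_cube)
qed

text \<open>The differences of consecutive quotients obey a recursion whose matrix has row sums of absolute
values at most \<open>1 / 3\<close>; the last estimate bounds the increments of one quotient.\<close>

lemma contraction_step:
  fixes a b h f :: real
  assumes "\<bar>a\<bar> \<le> h" "\<bar>b\<bar> \<le> h" "0 \<le> f" "f \<le> h"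
  shows "\<bar>(7 * a + 3 * b) / 30 + f / 15\<bar> \<le> h / 2"
    and "\<bar>(29 * a + 21 * b) / 150 + f / 25\<bar> \<le> h / 2"
    and "\<bar>(13 * a - 3 * b) / 30 + f / 10\<bar> \<le> h"
proof -
  have "a \<le> h" "- a \<le> h" "b \<le> h" "- b \<le> h" using assms(1,2) by (auto simp: abs_le_iff)
  note ab = this assms(3,4)
  show "\<bar>(7 * a + 3 * b) / 30 + f / 15\<bar> \<le> h / 2"
    unfolding abs_le_iff using ab by (auto simp: field_simps)
  show "\<bar>(29 * a + 21 * b) / 150 + f / 25\<bar> \<le> h / 2"
    unfolding abs_le_iff using ab by (auto simp: field_simps)
  show "\<bar>(13 * a - 3 * b) / 30 + f / 10\<bar> \<le> h"
    unfolding abs_le_iff using ab by (auto simp: field_simps)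
qed

lemma quotient_differences: "\<bar>xA n - xB n\<bar> \<le> (1 / 2) ^ n \<and> \<bar>xB n - xC n\<bar> \<le> (1 / 2) ^ n"
proof (induction n)
  case 0
  then show ?case by (simp add: xA_def xB_def xC_def initial_counts)
next
  case (Suc n)
  let ?h = "(1 / 2 :: real) ^ n" and ?f = "(1 / 5 :: real) ^ n"
  have f: "0 \<le> ?f" "?f \<le> ?h" by (auto intro: power_mono)
  have d1: "xA (Suc n) - xB (Suc n) = (7 * (xA n - xB n) + 3 * (xB n - xC n)) / 30 + ?f / 15"
    unfolding quotient_recursion by (simp add: field_simps)
  have d2: "xB (Suc n) - xC (Suc n) = (29 * (xA n - xB n) + 21 * (xB n - xC n)) / 150 + ?f / 25"
    unfolding quotient_recursion by (simp add: field_simps)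
  have h: "(1 / 2 :: real) ^ Suc n = ?h / 2" by simp
  show ?case
    unfolding d1 d2 h using contraction_step(1,2)[OF _ _ f] Suc by blast
qed

lemma convergent_xB: "convergent xB"
proof -
  have "summable (\<lambda>n. xB (Suc n) - xB n)"
  proof (rule summable_comparison_test')
    show "summable (\<lambda>n. (1 / 2 :: real) ^ n)" by (intro summable_geometric) simp
    fix n :: nat
    let ?h = "(1 / 2 :: real) ^ n" and ?f = "(1 / 5 :: real) ^ n"
    have f: "0 \<le> ?f" "?f \<le> ?h" by (auto intro: power_mono)
    have d: "xB (Suc n) - xB n = (13 * (xA n - xB n) - 3 * (xB n - xC n)) / 30 + ?f / 10"
      unfolding quotient_recursion by (simp add: field_simps)
    show "norm (xB (Suc n) - xB n) \<le> ?h"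
      unfolding d real_norm_def using contraction_step(3)[OF _ _ f] quotient_differences[of n] by blast
  qed
  then have "convergent (\<lambda>n. \<Sum>i<n. xB (Suc i) - xB i)"
    by (simp add: summable_iff_convergent)
  then have "convergent (\<lambda>n. xB n - xB 0)" by (simp add: sum_lessThan_telescope)
  then have "convergent (\<lambda>n. (xB n - xB 0) + xB 0)" by (intro convergent_add convergent_const)
  then show ?thesis by simp
qed

definition unicycle_ratio :: "nat \<Rightarrow> real" where
  "unicycle_ratio n = real (num_unicyclic (verts (SG n)) (edges (SG n)) (sinks n)) /
     real (num_trees (verts (SG n)) (edges (SG n)) (sinks n))"

lemma num_trees_SG_pos: "0 < num_trees (verts (SG n)) (edges (SG n)) (sinks n)"
proof -
  obtain a b c where abc: "corner_polys n = (a, b, c)" by (cases "corner_polys n") auto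
  then have "real_of_int (coeff b 0) = tB n" by (simp add: tB_def)
  then have "0 < coeff b 0" using forest_counts_positive[of n] by simp
  then show ?thesis using spanning_counts_SG(1)[OF abc] by simp
qed

lemma unicycle_ratio_eq: "unicycle_ratio n / 3 ^ n = xB n + 3 / 2 * (1 / 5) ^ n"
proof -
  obtain a b c where abc: "corner_polys n = (a, b, c)" by (cases "corner_polys n") auto
  have "real (num_trees (verts (SG n)) (edges (SG n)) (sinks n)) = real_of_int (2 * coeff b 0)"
    "real (num_unicyclic (verts (SG n)) (edges (SG n)) (sinks n)) = real_of_int (coeff a 0 + 2 * coeff b 1)"
    unfolding spanning_counts_SG[OF abc, symmetric] by simp_all
  then have "unicycle_ratio n = (tA n + 2 * uB n) / (2 * tB n)"
    by (simp add: unicycle_ratio_def tA_def tB_def uB_def abc)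
  also have "\<dots> = uB n / tB n + (tA n / tB n) / 2"
    using forest_counts_positive[of n] by (simp add: field_simps)
  finally have "unicycle_ratio n / 3 ^ n = xB n + 3 * (3 / 5) ^ n / 3 ^ n / 2"
    unfolding ratio_AB by (simp add: xB_def add_divide_distrib)
  also have "3 * (3 / 5 :: real) ^ n / 3 ^ n / 2 = 3 / 2 * (1 / 5) ^ n"
    by (simp add: power_divide)
  finally show ?thesis .
qed

lemma convergent_unicycle_ratio: "convergent (\<lambda>n. unicycle_ratio n / 3 ^ n)"
  unfolding unicycle_ratio_eq
  by (intro convergent_add convergent_xB convergent_mult convergent_const)
     (auto intro: convergentI[OF LIMSEQ_realpow_zero])

section \<open>Bulk averages\<close>

lemma linked_SG: "linked (verts (SG n)) (sinks n) (edges (SG n))"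
proof -
  have "spanners (verts (SG n)) (edges (SG n)) (sinks n) (card (verts (SG n) - sinks n)) \<noteq> {}"
    using num_trees_SG_pos[of n] unfolding num_trees_def by (metis card.empty less_irrefl)
  then obtain H where "H \<subseteq> edges (SG n)" "linked (verts (SG n)) (sinks n) H"
    by (auto simp: spanners_def)
  then show ?thesis unfolding linked_def using joined_mono by metis
qed

interpretation SG_sink: sink_graph "SG n" "sinks n" for n
  by unfold_locales (rule graph_on_SG sinks_subset linked_SG)+

interpretation SG_walk: walk_graph "SG n" for n
  by unfold_locales (rule graph_on_SG | erule nbs_SG_nonempty)+

lemma card_edges_at_sinks: "card {e \<in> edges (SG n). e \<inter> sinks n \<noteq> {}} \<le> 4"
proof -
  have "{e \<in> edges (SG n). e \<inter> sinks n \<noteq> {}} =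
      {e \<in> edges (SG n). corner_of n Top \<in> e} \<union> {e \<in> edges (SG n). corner_of n Rgt \<in> e}"
    unfolding sinks_eq by blast
  also have "card \<dots> \<le> 2 + 2"
    by (rule order_trans[OF card_Un_le add_mono[OF card_edges_at_corner card_edges_at_corner]])
  finally show ?thesis by simp
qed

lemma card_edges_inside_sinks:
  "card {e \<in> edges (SG n). e \<subseteq> sinks n} \<le> card {e \<in> edges (SG n). e \<inter> sinks n \<noteq> {}}"
proof (rule card_mono)
  have "e \<noteq> {}" if e: "e \<in> edges (SG n)" for e
    using graph_on_SG[of n] e unfolding graph_on_def by (metis insert_not_empty)
  then show "{e \<in> edges (SG n). e \<subseteq> sinks n} \<subseteq> {e \<in> edges (SG n). e \<inter> sinks n \<noteq> {}}" by blast
qed (simp add: graph_on_finite_edges[OF graph_on_SG])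

text \<open>Of the \<open>3 ^ Suc n\<close> edges at most \<open>4\<close> touch a sink; they are missing in the number of edges that
avoid the sinks, and some of them may join two sinks.\<close>

lemma sum_heights_SG:
  "\<bar>(\<Sum>v\<in>verts (SG n) - sinks n. expected_height (SG n) (sinks n) v) - 3 ^ Suc n - unicycle_ratio n\<bar> \<le> 8"
proof -
  let ?E = "edges (SG n)" and ?S = "sinks n"
  have fin: "finite ?E" by (rule graph_on_finite_edges[OF graph_on_SG])
  have "?E = {e \<in> ?E. e \<inter> ?S = {}} \<union> {e \<in> ?E. e \<inter> ?S \<noteq> {}}" by blast
  then have "card ?E = card {e \<in> ?E. e \<inter> ?S = {}} + card {e \<in> ?E. e \<inter> ?S \<noteq> {}}"
    using fin by (metis (no_types, lifting) card_Un_disjoint disjoint_iff finite_Un mem_Collect_eq)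
  moreover note card_edges_inside_sinks[of n]
  ultimately have "\<bar>real (card {e \<in> ?E. e \<inter> ?S = {}}) - real (card {e \<in> ?E. e \<subseteq> ?S}) - real (card ?E)\<bar> \<le> 8"
    using card_edges_at_sinks[of n] by linarith
  then show ?thesis
    unfolding SG_sink.sum_expected_heights unicycle_ratio_def card_edges_SG by simp
qed

text \<open>The identity of \<open>visited_neighbours_sum\<close> also counts sinks that the path does not visit. The
correction \<open>d\<close>, summed over \<open>v\<close>, is at most the number of edges at the sinks, hence at most
\<open>4\<close>. The bound \<open>14\<close> is \<open>4\<close> for this correction, \<open>2\<close> for the sinks as starting points and
\<open>2 * 4\<close> for the edges between sinks.\<close>

lemma sum_visited_SG:
  "\<bar>(\<Sum>v\<in>verts (SG n). expected_visited_neighbors (SG n) (sinks n) v) - real (card (verts (SG n)))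
     - 2 * unicycle_ratio n\<bar> \<le> 14"
proof -
  let ?V = "verts (SG n)" and ?E = "edges (SG n)" and ?S = "sinks n"
  let ?T = "\<lambda>S. real (num_trees ?V ?E S)"
  let ?p = "\<lambda>\<gamma>. ?T (?S \<union> set \<gamma>) / ?T ?S"
  have finV: "finite ?V" by (rule graph_on_finite_verts[OF graph_on_SG])
  have SV: "?S \<subseteq> ?V" using sinks_subset by blast
  have finN: "finite (nbs ?E v)" for v by (rule finite_nbs[OF graph_on_SG])
  have Tpos: "0 < ?T ?S" using num_trees_SG_pos by simp
  have ev: "expected_visited_neighbors (SG n) ?S v =
      (\<Sum>\<gamma>\<in>simple_paths ?E ?S v. real (card (nbs ?E v \<inter> set \<gamma>)) * ?p \<gamma>)" if "v \<in> ?V" for v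
    unfolding expected_visited_neighbors_def SG_sink.neighbors_eq
    using SG_walk.expectation_loop_erasure[OF sinks_subset linked_SG that,
        of "\<lambda>\<gamma>. real (card (nbs ?E v \<inter> set \<gamma>))"] .
  have ev0: "expected_visited_neighbors (SG n) ?S v = 0" if "v \<in> ?S" for v
  proof -
    have "nbs ?E v \<inter> {v} = {}" using nbs_subset[OF graph_on_SG[of n], of v] by blast
    then show ?thesis using ev[of v] SV that by (auto simp: simple_paths_sink)
  qed
  define d where "d v = (\<Sum>\<gamma>\<in>simple_paths ?E ?S v. real (card (nbs ?E v \<inter> (?S - set \<gamma>))) * ?p \<gamma>)" for v
  have d0: "0 \<le> d v" for v unfolding d_def by (intro sum_nonneg mult_nonneg_nonneg) auto
  have d1: "d v \<le> real (card (nbs ?E v \<inter> ?S))" if "v \<in> ?V" for v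
  proof -
    have "d v \<le> (\<Sum>\<gamma>\<in>simple_paths ?E ?S v. real (card (nbs ?E v \<inter> ?S)) * ?p \<gamma>)"
    proof -
      have "card (nbs ?E v \<inter> (?S - set \<gamma>)) \<le> card (nbs ?E v \<inter> ?S)" for \<gamma>
        by (rule card_mono) (use finN[of v] in \<open>blast+\<close>)
      then show ?thesis unfolding d_def by (intro sum_mono mult_right_mono) simp_all
    qed
    also have "\<dots> = real (card (nbs ?E v \<inter> ?S)) * ((\<Sum>\<gamma>\<in>simple_paths ?E ?S v. ?T (?S \<union> set \<gamma>)) / ?T ?S)"
      by (simp add: sum_distrib_left sum_divide_distrib)
    also have "\<dots> = real (card (nbs ?E v \<inter> ?S))"
      unfolding num_trees_path_sum[OF graph_on_SG SV that] using Tpos by simp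
    finally show ?thesis .
  qed
  have dsum: "(\<Sum>v\<in>?V - ?S. d v) \<le> 4"
  proof -
    have nb2: "card (nbs ?E (corner_of n i)) \<le> 2" for i
    proof -
      have "card (nbs ?E (corner_of n i)) = card ((\<lambda>w. {corner_of n i, w}) ` nbs ?E (corner_of n i))"
        by (rule card_image[symmetric]) (auto intro!: inj_onI simp: doubleton_eq_iff)
      also have "\<dots> \<le> card {e \<in> ?E. corner_of n i \<in> e}"
        using graph_on_finite_edges[OF graph_on_SG[of n]] by (intro card_mono) (auto simp: nbs_def)
      also have "\<dots> \<le> 2" by (rule card_edges_at_corner)
      finally show ?thesis .
    qed
    have finS: "finite ?S" by (simp add: sinks_eq)
    have "(\<Sum>v\<in>?V - ?S. d v) \<le> (\<Sum>v\<in>?V - ?S. real (card (nbs ?E v \<inter> ?S)))"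
      using d1 by (intro sum_mono) auto
    also have "\<dots> = (\<Sum>v\<in>?V - ?S. \<Sum>s\<in>?S. if s \<in> nbs ?E v then 1 else 0)"
      using finS by (intro sum.cong refl) (simp add: sum.If_cases Int_commute)
    also have "\<dots> = (\<Sum>s\<in>?S. \<Sum>v\<in>?V - ?S. if s \<in> nbs ?E v then 1 else 0)"
      by (rule sum.swap)
    also have "\<dots> = (\<Sum>s\<in>?S. real (card ((?V - ?S) \<inter> {v. s \<in> nbs ?E v})))"
      using finV by (intro sum.cong refl) (simp add: sum.If_cases)
    also have "\<dots> \<le> (\<Sum>s\<in>?S. 2)"
    proof (rule sum_mono)
      fix s assume "s \<in> ?S"
      then obtain i where s: "s = corner_of n i" unfolding sinks_eq by blast
      have "card ((?V - ?S) \<inter> {v. s \<in> nbs ?E v}) \<le> card (nbs ?E s)"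
        using finN[of s] nbs_sym[of s ?E] by (intro card_mono subsetI) simp_all
      then show "real (card ((?V - ?S) \<inter> {v. s \<in> nbs ?E v})) \<le> 2" using nb2[of i] s by simp
    qed
    also have "\<dots> \<le> 4"
      using card_insert_le_m1[of 2 "{corner_of n Rgt}" "corner_of n Top"] by (simp add: sinks_eq)
    finally show ?thesis .
  qed
  have split: "expected_visited_neighbors (SG n) ?S v + d v =
      (\<Sum>\<gamma>\<in>simple_paths ?E ?S v. ?T (?S \<union> set \<gamma>) * real (card (nbs ?E v \<inter> (?S \<union> set \<gamma>)))) / ?T ?S"
    if "v \<in> ?V" for v
  proof -
    have "real (card (nbs ?E v \<inter> (?S \<union> set \<gamma>))) =
        real (card (nbs ?E v \<inter> set \<gamma>)) + real (card (nbs ?E v \<inter> (?S - set \<gamma>)))" for \<gamma>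
    proof -
      have "nbs ?E v \<inter> (?S \<union> set \<gamma>) = (nbs ?E v \<inter> set \<gamma>) \<union> (nbs ?E v \<inter> (?S - set \<gamma>))" by blast
      moreover have "(nbs ?E v \<inter> set \<gamma>) \<inter> (nbs ?E v \<inter> (?S - set \<gamma>)) = {}" by blast
      ultimately show ?thesis using finN[of v] by (simp add: card_Un_disjoint)
    qed
    then show ?thesis
      unfolding ev[OF that] d_def sum.distrib[symmetric] sum_divide_distrib
      by (intro sum.cong refl) (simp add: algebra_simps add_divide_distrib)
  qed
  have "(\<Sum>v\<in>?V. expected_visited_neighbors (SG n) ?S v) =
      (\<Sum>v\<in>?V - ?S. expected_visited_neighbors (SG n) ?S v)"
    using finV ev0 by (intro sum.mono_neutral_right) auto
  then have "(\<Sum>v\<in>?V. expected_visited_neighbors (SG n) ?S v) + (\<Sum>v\<in>?V - ?S. d v) =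
      (\<Sum>v\<in>?V - ?S. \<Sum>\<gamma>\<in>simple_paths ?E ?S v.
         ?T (?S \<union> set \<gamma>) * real (card (nbs ?E v \<inter> (?S \<union> set \<gamma>)))) / ?T ?S"
    by (simp add: sum.distrib[symmetric] split flip: sum_divide_distrib)
  also have "\<dots> = real (card (?V - ?S)) + 2 * unicycle_ratio n - 2 * real (card {e \<in> ?E. e \<subseteq> ?S})"
    unfolding visited_neighbours_sum[OF graph_on_SG SV] unicycle_ratio_def
    using Tpos by (simp add: field_simps)
  finally have eq: "(\<Sum>v\<in>?V. expected_visited_neighbors (SG n) ?S v) + (\<Sum>v\<in>?V - ?S. d v) =
      real (card (?V - ?S)) + 2 * unicycle_ratio n - 2 * real (card {e \<in> ?E. e \<subseteq> ?S})" .
  have "card {e \<in> ?E. e \<subseteq> ?S} \<le> 4"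
    using card_edges_inside_sinks[of n] card_edges_at_sinks[of n] by simp
  moreover have "real (card (?V - ?S)) = real (card ?V) - 2" using card_minus_sinks[of n] by simp
  moreover have "0 \<le> (\<Sum>v\<in>?V - ?S. d v)" using d0 by (intro sum_nonneg) auto
  ultimately show ?thesis using eq dsum by linarith
qed

lemma real_card_verts_SG: "real (card (verts (SG n))) = (3 * 3 ^ n + 3) / 2"
proof -
  have "real (2 * card (verts (SG n))) = real (3 ^ Suc n + 3)" unfolding card_verts_SG_eq ..
  then show ?thesis by simp
qed

lemma bounded_over_verts_tendsto:
  assumes "\<And>n. \<bar>f n\<bar> \<le> K"
  shows "(\<lambda>n. f n / real (card (verts (SG n)))) \<longlonglongrightarrow> 0"
proof (rule Lim_null_comparison)
  note card = real_card_verts_SG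
  show "\<forall>\<^sub>F n in sequentially. norm (f n / real (card (verts (SG n)))) \<le> \<bar>K\<bar> * (1 / 3) ^ n"
  proof (intro always_eventually allI)
    fix n
    have "norm (f n / real (card (verts (SG n)))) = \<bar>f n\<bar> / ((3 * 3 ^ n + 3) / 2)"
    proof -
      have "0 < (3 * 3 ^ n + 3 :: real) / 2" by (simp add: add_pos_pos)
      then show ?thesis unfolding card real_norm_def by (simp only: abs_divide[of "f n"] abs_of_pos)
    qed
    also have "\<dots> \<le> \<bar>K\<bar> / 3 ^ n"
      using assms[of n] by (intro frac_le) (auto simp: add_pos_pos)
    finally show "norm (f n / real (card (verts (SG n)))) \<le> \<bar>K\<bar> * (1 / 3) ^ n"
      by (simp add: power_divide)
  qed
  show "(\<lambda>n. \<bar>K\<bar> * (1 / 3 :: real) ^ n) \<longlonglongrightarrow> 0"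
    by (intro tendsto_mult_right_zero LIMSEQ_realpow_zero) auto
qed

theorem proposition5p1:
  shows "convergent bulk_height \<and> convergent bulk_looping \<and>
         lim bulk_height = (lim bulk_looping + 3) / 2"
proof -
  let ?N = "\<lambda>n. real (card (verts (SG n)))"
  note card = real_card_verts_SG
  have Npos: "0 < ?N n" for n unfolding card by (simp add: add_pos_pos)
  obtain y where y: "(\<lambda>n. unicycle_ratio n / 3 ^ n) \<longlonglongrightarrow> y"
    using convergent_unicycle_ratio by (auto simp: convergent_def)
  have "(\<lambda>n. (1 / 3 :: real) ^ n) \<longlonglongrightarrow> 0" by (rule LIMSEQ_realpow_zero) auto
  then have "(\<lambda>n. (2 / 3) / (1 + (1 / 3) ^ n)) \<longlonglongrightarrow> (2 / 3) / (1 + 0 :: real)"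
    by (intro tendsto_intros) auto
  moreover have "3 ^ n / ?N n = (2 / 3) / (1 + (1 / 3) ^ n)" for n
    unfolding card by (simp add: power_divide field_simps)
  ultimately have pow: "(\<lambda>n. 3 ^ n / ?N n) \<longlonglongrightarrow> 2 / 3" by simp
  have ratio: "(\<lambda>n. unicycle_ratio n / ?N n) \<longlonglongrightarrow> y * (2 / 3)"
    using tendsto_mult[OF y pow] by simp
  define f where "f n = (\<Sum>v\<in>verts (SG n) - sinks n. expected_height (SG n) (sinks n) v)
    - 3 ^ Suc n - unicycle_ratio n" for n
  define g where "g n = (\<Sum>v\<in>verts (SG n). expected_visited_neighbors (SG n) (sinks n) v)
    - ?N n - 2 * unicycle_ratio n" for n
  have "bulk_height = (\<lambda>n. f n / ?N n + 3 * (3 ^ n / ?N n) + unicycle_ratio n / ?N n)"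
    by (rule ext) (simp add: bulk_height_def f_def add_divide_distrib diff_divide_distrib)
  moreover have "(\<lambda>n. f n / ?N n + 3 * (3 ^ n / ?N n) + unicycle_ratio n / ?N n) \<longlonglongrightarrow> 0 + 3 * (2 / 3) + y * (2 / 3)"
    using bounded_over_verts_tendsto[of f 8] sum_heights_SG
    by (intro tendsto_intros pow ratio) (simp add: f_def)
  ultimately have h: "bulk_height \<longlonglongrightarrow> 0 + 3 * (2 / 3) + y * (2 / 3)" by (simp only:)
  have "bulk_looping = (\<lambda>n. g n / ?N n + 1 + 2 * (unicycle_ratio n / ?N n))"
  proof
    fix n
    show "bulk_looping n = g n / ?N n + 1 + 2 * (unicycle_ratio n / ?N n)"
      using Npos[of n] by (simp add: bulk_looping_def g_def field_simps)
  qed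
  moreover have "(\<lambda>n. g n / ?N n + 1 + 2 * (unicycle_ratio n / ?N n)) \<longlonglongrightarrow> 0 + 1 + 2 * (y * (2 / 3))"
    using bounded_over_verts_tendsto[of g 14] sum_visited_SG
    by (intro tendsto_intros ratio) (simp add: g_def)
  ultimately have l: "bulk_looping \<longlonglongrightarrow> 0 + 1 + 2 * (y * (2 / 3))" by (simp only:)
  show ?thesis
    using h l limI[OF h] limI[OF l] by (auto simp: convergent_def)
qed

end
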